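(* Let $Z=[a,b]$, $d\ge1$, $l\ge0$ an integer, $\alpha>0$, and let $f:Z\times[0,1]^d\to\mathbb{R}$ be $l+1$ times continuously differentiable on $Z\times[0,1]^d$, with a constant $C_f>0$ such that \[ \Bigl|\frac{\partial^{r+1}f(z,x)}{\partial z\,\partial x_{s_1}\cdots\partial x_{s_r}}\Bigr|\le C_f,\quad x\in[0,1]^d, \] for all $0\le r\le l$, $s_1,\dots,s_r\in\{1,\dots,d\}$, and \[ \Bigl|\frac{\partial^{l+1}f(z,x^{(1)})}{\partial z\,\partial x_{s_1}\cdots\partial x_{s_l}}-\frac{\partial^{l+1}f(z,x^{(2)})}{\partial z\,\partial x_{s_1}\cdots\partial x_{s_l}}\Bigr|\le C_f|x^{(1)}-x^{(2)}|^\alpha \] for all $x^{(1)},x^{(2)}\in[0,1]^d$, $z\in Z$, $s_1,\dots,s_l\in\{1,\dots,d\}$. Let $\mu$ be a stochastic measure on the Borel subsets of $[0,1]^d$. If $l+\alpha>d/2$, then the paths of the random function \[ \tilde\eta(z)=\int_{[0,1]^d}S^{(d)}_1(f(z,\cdot),x)\,d\mu(x)+\sum_{k=1}^\infty\int_{[0,1]^d}\bigl(S^{(d)}_{2^k}(f(z,\cdot),x)-S^{(d)}_{2^{k-1}}(f(z,\cdot),x)\bigr)\,d\mu(x) \] have bounded derivatives on $Z$, and \[ \frac{d\tilde\eta(z)}{dz}=\int_{[0,1]^d}\frac{\partial f(z,x)}{\partial z}\,d\mu(x), \] where the right-hand side is understood as its version given by the analogous series with $f$ replaced by $\partial f/\partial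 z$.
   Context: Let $(\Omega,\mathcal F,\mathsf P)$ be a complete probability space and $L_0$ the set of all real random variables on it, with convergence in probability. A stochastic measure (SM) on a measurable space $(X,\mathcal B)$ is a $\sigma$-additive map $\mu:\mathcal B\to L_0$ (finitely additive, and $\mu(A_n)\to0$ in probability whenever $A_n\downarrow\emptyset$). Every bounded measurable deterministic function is integrable w.r.t. $\mu$, with $\int\sum_ic_i\mathbf 1_{A_i}d\mu=\sum_ic_i\mu(A_i)$ for simple functions. In the series above all integrands are simple functions, and a single fixed version of $\mu$ is used for all values of $\mu$ appearing. One-dimensional Haar functions on $[0,1]$: $\chi_1\equiv1$; for $n=2^j+i$, $1\le i\le2^j$, $j\ge0$, put $\Delta_n^+=((i-1)2^{-j},(2i-1)2^{-j-1})$, $\Delta_n^-=((2i-1)2^{-j-1},i2^{-j})$, $\chi_n=2^{j/2}$ on $\Delta_n^+$, $-2^{j/2}$ on $\Delta_n^-$, $0$ outside $[(i-1)2^{-j},i2^{-j}]$; at discontinuity points in $(0,1)$ $\chi_n$ equals the average of its one-sided limits, $\chi_n(0)=\chi_n(0+)$, $\chi_n(1)=\chi_n(1-)$. Multivariate Haar functions $\chi^{(d)}_{n_1,\dots,n_d}(x)=\prod_{s=1}^d\chi_{n_s}(x_s)$, coefficients $c^{(d)}_{n_1,\dots,n_d}(g)=\int_{[0,1]^d}g\,\chi^{(d)}_{n_1,\dots,n_d}\,dx$, partial sums $S^{(d)}_{2^k}(g,x)=\sum_{(n_1,\dots,n_d)\in\{1,\dots,2^k\}^d}c^{(d)}_{n_1,\dots,n_d}(g)\chi^{(d)}_{n_1,\dots,n_d}(x)$.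 *)

theory Defs
  imports "HOL-Probability.Probability"
begin

definition conv_in_prob :: "'w measure \<Rightarrow> (nat \<Rightarrow> 'w \<Rightarrow> real) \<Rightarrow> ('w \<Rightarrow> real) \<Rightarrow> bool" where
  "conv_in_prob P Xs X \<longleftrightarrow>
     (\<forall>e>0. (\<lambda>n. measure P {\<omega>\<in>space P. \<bar>Xs n \<omega> - X \<omega>\<bar> > e}) \<longlonglongrightarrow> 0)"

text \<open>A stochastic measure on the measurable space X: a map from sets(X) to L0(P)
  (real random variables, equalities understood almost surely), finitely additive,
  and continuous at the empty set in probability.  The function mu is one fixed
  version of the stochastic measure.\<close>
definition stoch_measure :: "'w measure \<Rightarrow> 'x measure \<Rightarrow> ('x set \<Rightarrow> 'w \<Rightarrow> real) \<Rightarrow> bool" where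
  "stoch_measure P X mu \<longleftrightarrow>
     (\<forall>A\<in>sets X. mu A \<in> borel_measurable P) \<and>
     (\<forall>A\<in>sets X. \<forall>B\<in>sets X. A \<inter> B = {} \<longrightarrow> (AE \<omega> in P. mu (A \<union> B) \<omega> = mu A \<omega> + mu B \<omega>)) \<and>
     (\<forall>A::nat \<Rightarrow> 'x set. (\<forall>n. A n \<in> sets X) \<longrightarrow> decseq A \<longrightarrow> (\<Inter>n. A n) = {} \<longrightarrow>
        conv_in_prob P (\<lambda>n. mu (A n)) (\<lambda>_. 0))"

definition simple_int :: "('x set \<Rightarrow> 'w \<Rightarrow> real) \<Rightarrow> 'x set \<Rightarrow> ('x \<Rightarrow> real) \<Rightarrow> 'w \<Rightarrow> real" where
  "simple_int mu D h \<omega> = (\<Sum>c\<in>h ` D. c * mu (D \<inter> h -` {c}) \<omega>)"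

text \<open>For n = 2^j + i with 1 \<le> i \<le> 2^j: j is the least j with n \<le> 2^(j+1).\<close>
definition haar_j :: "nat \<Rightarrow> nat" where
  "haar_j n = (LEAST j. n \<le> 2 ^ Suc j)"

definition haar :: "nat \<Rightarrow> real \<Rightarrow> real" where
  "haar n t =
    (if n = 0 then 0 else if n = 1 then 1 else
     (let j = haar_j n; i = n - 2 ^ j;
          lo = (real i - 1) / 2 ^ j; mid = (2 * real i - 1) / 2 ^ (Suc j); hi = real i / 2 ^ j;
          h = sqrt (2 ^ j)
      in if lo < t \<and> t < mid then h
         else if mid < t \<and> t < hi then - h
         else if t = mid then 0
         else if t = lo then (if lo = 0 then h else h / 2)
         else if t = hi then (if hi = 1 then - h else - h / 2)
         else 0))"

definition haar_multi :: "('n::finite \<Rightarrow> nat) \<Rightarrow> real^'n \<Rightarrow> real" where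
  "haar_multi N x = (\<Prod>s\<in>UNIV. haar (N s) (x $ s))"

definition haar_coeff :: "(real^'n::finite \<Rightarrow> real) \<Rightarrow> ('n \<Rightarrow> nat) \<Rightarrow> real" where
  "haar_coeff g N = integral (cbox 0 1) (\<lambda>x. g x * haar_multi N x)"

definition haar_sum :: "(real^'n::finite \<Rightarrow> real) \<Rightarrow> nat \<Rightarrow> real^'n \<Rightarrow> real" where
  "haar_sum g m x = (\<Sum>N\<in>{N. \<forall>s. N s \<in> {1..m}}. haar_coeff g N * haar_multi N x)"

definition haar_series_term ::
  "((real^'n::finite) set \<Rightarrow> 'w \<Rightarrow> real) \<Rightarrow> (real^'n \<Rightarrow> real) \<Rightarrow> nat \<Rightarrow> 'w \<Rightarrow> real" where
  "haar_series_term mu g k \<omega> =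
     (if k = 0 then simple_int mu (cbox 0 1) (haar_sum g 1) \<omega>
      else simple_int mu (cbox 0 1) (\<lambda>x. haar_sum g (2 ^ k) x - haar_sum g (2 ^ (k - 1)) x) \<omega>)"

definition pdir :: "real \<Rightarrow> real \<Rightarrow> 'n::finite option \<Rightarrow> (real \<Rightarrow> real^'n \<Rightarrow> real) \<Rightarrow> real \<Rightarrow> real^'n \<Rightarrow> real" where
  "pdir a b d g z x = (case d of
      None \<Rightarrow> vector_derivative (\<lambda>t. g t x) (at z within {a..b})
    | Some s \<Rightarrow> vector_derivative (\<lambda>t. g z (\<chi> i. if i = s then t else x $ i)) (at (x $ s) within {0..1}))"

definition pdir_exists :: "real \<Rightarrow> real \<Rightarrow> 'n::finite option \<Rightarrow> (real \<Rightarrow> real^'n \<Rightarrow> real) \<Rightarrow> real \<Rightarrow> real^'n \<Rightarrow> bool" where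
  "pdir_exists a b d g z x = (case d of
      None \<Rightarrow> (\<lambda>t. g t x) differentiable (at z within {a..b})
    | Some s \<Rightarrow> (\<lambda>t. g z (\<chi> i. if i = s then t else x $ i)) differentiable (at (x $ s) within {0..1}))"

fun ipd :: "real \<Rightarrow> real \<Rightarrow> 'n::finite option list \<Rightarrow> (real \<Rightarrow> real^'n \<Rightarrow> real) \<Rightarrow> real \<Rightarrow> real^'n \<Rightarrow> real" where
  "ipd a b [] g = g"
| "ipd a b (d # ds) g = pdir a b d (ipd a b ds g)"

definition C_diff_on :: "nat \<Rightarrow> real \<Rightarrow> real \<Rightarrow> (real \<Rightarrow> real^'n::finite \<Rightarrow> real) \<Rightarrow> bool" where
  "C_diff_on m a b f \<longleftrightarrow>
     (\<forall>ds::'n option list. length ds < m \<longrightarrow>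
        (\<forall>d. \<forall>z\<in>{a..b}. \<forall>x\<in>cbox 0 1. pdir_exists a b d (ipd a b ds f) z x)) \<and>
     (\<forall>ds::'n option list. length ds \<le> m \<longrightarrow>
        continuous_on ({a..b} \<times> cbox 0 1) (\<lambda>(z, x). ipd a b ds f z x))"

end

theory Submission
  imports Defs
begin

text \<open>
  All integrands are constant on the dyadic atoms, the sets on which floor and ceiling of every
  $2^k x_s$ are constant. There are countably many of them, so outside a null set the fixed version
  of the stochastic measure is genuinely additive on the algebra they generate.

  The key probabilistic fact is that an additive set function with values in L0 that tends to 0 along
  disjoint sequences has a range bounded in probability. First, the truncated square sums over
  partitions are bounded in probability: otherwise Paley--Zygmund applied to random unions of atoms
  splits off a piece of mass greater than 1 with a fixed probability, leaving a set of the same kind,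
  and this can be repeated forever. Then large values are excluded by random colourings and a counting
  argument for lacunary values. Averaging over random signs, $\sum_i (\int \phi_i\,d\mu)^2$ is almost
  surely finite as soon as $\sum_i |\phi_i|$ is bounded.

  A dyadic increment of the Haar partial sums is the sum over the cells c of level k + 1 of
  (mass of c) times (mean of g over c minus its mean over the parent of c). Expand g by
  telescoping tensor Lagrange interpolants over the ancestor cells; Cauchy--Schwarz over the cells of each
  level together with the square function bound gives a bound $R (k+1) x^k$ with x < 1, uniform over
  all g with the same approximation constants, as $l + \alpha > d/2$. Applied to
  $\partial_z f(z, \cdot)$ this permits differentiating the series termwise. For the single
  function $f(a, \cdot)$ only summability is needed, and continuous differentiability suffices.
  Mixed derivatives are never interchanged: the interpolation error is estimated for difference quotients in z.
\<close>

text \<open>Values in L0 have no moments, so all bounds for the random measure come from additivity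
  and exhaustion: finite auxiliary randomness (subsets, colourings) is averaged against the given
  probability, and truncated squares replace variances. The second obstacle is that the exceptional
  null set must not depend on z. Feeding the increments of each \<open>g z\<close> into the square
  function bound would give one null set per z. So the bound is applied to countably many fixed
  functions, cell weights and increments of interpolation basis functions, and \<open>g z\<close>
  enters only through real coefficients. The price is Cauchy--Schwarz over the 2^(dk) cells of level
  k: a loss of 2^(dk/2) against an interpolation error of order 2^(-k(l + \<alpha>)), whence the
  condition l + \<alpha> > d/2. The surplus \<sigma>, capped at 1, is shared. With y = 2^(-\<sigma>)
  and x = sqrt y, one factor x^k makes the integrands summable over the levels, the other makes the
  series converge. The cap is there because the increments of coarse basis functions only gain the
  Lipschitz factor 2^(-(k - j)).\<close>

section \<open>Random subsets and random colourings\<close>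

text \<open>Expected value of \<open>F\<close> at a random subset of \<open>A\<close> containing
  each \<open>a\<close> independently with probability \<open>p a\<close>. As a finite sum it needs
  no auxiliary probability space, and its algebraic identities hold for arbitrary real
  \<open>p\<close>.\<close>

definition rsub :: "('a \<Rightarrow> real) \<Rightarrow> 'a set \<Rightarrow> ('a set \<Rightarrow> real) \<Rightarrow> real" where
  "rsub p A F = (\<Sum>H\<in>Pow A. (\<Prod>a\<in>H. p a) * (\<Prod>a\<in>A - H. 1 - p a) * F H)"

lemma rsub_empty [simp]: "rsub p {} F = F {}"
  by (simp add: rsub_def)

text \<open>Conditioning on whether \<open>a\<close> is selected. The moment formulas below are
  inductions along this recursion.\<close>

lemma rsub_insert:
  assumes "finite A" "a \<notin> A"
  shows "rsub p (insert a A) F = p a * rsub p A (\<lambda>H. F (insert a H)) + (1 - p a) * rsub p A F"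
proof -
  have fin: "finite H" "a \<notin> H" if "H \<in> Pow A" for H
    using that assms by (auto intro: finite_subset)
  have inj: "inj_on (insert a) (Pow A)"
    using assms by (intro inj_onI) (metis PowD insert_ident subsetD)
  have "rsub p (insert a A) F =
      (\<Sum>H\<in>Pow A. (\<Prod>a\<in>H. p a) * (\<Prod>a\<in>insert a A - H. 1 - p a) * F H)
    + (\<Sum>H\<in>Pow A. (\<Prod>a\<in>insert a H. p a) * (\<Prod>a\<in>insert a A - insert a H. 1 - p a) * F (insert a H))"
    unfolding rsub_def Pow_insert using assms
    by (subst sum.union_disjoint) (auto simp: sum.reindex[OF inj] o_def)
  also have "(\<Sum>H\<in>Pow A. (\<Prod>a\<in>H. p a) * (\<Prod>a\<in>insert a A - H. 1 - p a) * F H)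
      = (1 - p a) * rsub p A F"
    unfolding rsub_def sum_distrib_left
  proof (rule sum.cong[OF refl])
    fix H assume H: "H \<in> Pow A"
    have "insert a A - H = insert a (A - H)" using fin[OF H] by auto
    then show "(\<Prod>a\<in>H. p a) * (\<Prod>a\<in>insert a A - H. 1 - p a) * F H
        = (1 - p a) * ((\<Prod>a\<in>H. p a) * (\<Prod>a\<in>A - H. 1 - p a) * F H)"
      using assms by (simp add: algebra_simps)
  qed
  also have "(\<Sum>H\<in>Pow A. (\<Prod>a\<in>insert a H. p a) * (\<Prod>a\<in>insert a A - insert a H. 1 - p a) * F (insert a H))
      = p a * rsub p A (\<lambda>H. F (insert a H))"
    unfolding rsub_def sum_distrib_left
  proof (rule sum.cong[OF refl])
    fix H assume H: "H \<in> Pow A"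
    have "insert a A - insert a H = A - H" using assms by auto
    then show "(\<Prod>a\<in>insert a H. p a) * (\<Prod>a\<in>insert a A - insert a H. 1 - p a) * F (insert a H)
        = p a * ((\<Prod>a\<in>H. p a) * (\<Prod>a\<in>A - H. 1 - p a) * F (insert a H))"
      using fin[OF H] by (simp add: algebra_simps)
  qed
  finally show ?thesis by simp
qed

lemma rsub_cong: "(\<And>H. H \<subseteq> A \<Longrightarrow> F H = G H) \<Longrightarrow> rsub p A F = rsub p A G"
  unfolding rsub_def by (intro sum.cong) auto

lemma rsub_add: "rsub p A (\<lambda>H. F H + G H) = rsub p A F + rsub p A G"
  unfolding rsub_def by (simp add: algebra_simps sum.distrib)

lemma rsub_cmult: "rsub p A (\<lambda>H. c * F H) = c * rsub p A F"
  unfolding rsub_def by (simp add: algebra_simps sum_distrib_left)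

lemma rsub_diff: "rsub p A (\<lambda>H. F H - G H) = rsub p A F - rsub p A G"
  unfolding rsub_def by (simp add: algebra_simps sum_subtractf)

lemma rsub_const [simp]: "finite A \<Longrightarrow> rsub p A (\<lambda>H. c) = c"
  by (induction A rule: finite_induct) (auto simp: rsub_insert algebra_simps)

lemma rsub_mono:
  assumes "\<And>a. a \<in> A \<Longrightarrow> 0 \<le> p a \<and> p a \<le> 1" "\<And>H. H \<subseteq> A \<Longrightarrow> F H \<le> G H"
  shows "rsub p A F \<le> rsub p A G"
  unfolding rsub_def using assms
  by (intro sum_mono mult_left_mono mult_nonneg_nonneg prod_nonneg) force+

text \<open>Thinning: an element survives two independent selections with the product of the
  probabilities. A two-stage selection can thus be read as a single one.\<close>

lemma rsub_rsub:
  assumes "finite A"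
  shows "rsub p A (\<lambda>K. rsub r K F) = rsub (\<lambda>a. p a * r a) A F"
  using assms
proof (induction A arbitrary: F rule: finite_induct)
  case (insert a A)
  have *: "rsub r (insert a K) F = r a * rsub r K (\<lambda>H. F (insert a H)) + (1 - r a) * rsub r K F"
    if "K \<subseteq> A" for K
    using that insert.hyps by (intro rsub_insert) (auto intro: finite_subset)
  have "rsub p (insert a A) (\<lambda>K. rsub r K F)
      = p a * rsub p A (\<lambda>K. r a * rsub r K (\<lambda>H. F (insert a H)) + (1 - r a) * rsub r K F)
        + (1 - p a) * rsub p A (\<lambda>K. rsub r K F)"
    using insert.hyps * by (simp add: rsub_insert cong: rsub_cong)
  also have "\<dots> = (p a * r a) * rsub (\<lambda>a. p a * r a) A (\<lambda>H. F (insert a H))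
        + (1 - p a * r a) * rsub (\<lambda>a. p a * r a) A F"
    unfolding rsub_add rsub_cmult insert.IH by (simp add: algebra_simps)
  finally show ?case using insert.hyps by (simp add: rsub_insert)
qed simp

lemma sum_insert_sub:
  fixes x :: "'a \<Rightarrow> real"
  assumes "finite A" "a \<notin> A" "H \<subseteq> A"
  shows "(\<Sum>b\<in>insert a H. x b) = x a + (\<Sum>b\<in>H. x b)"
  using assms by (meson finite_subset in_mono sum.insert)

lemma rsub_mean:
  assumes "finite A"
  shows "rsub p A (\<lambda>H. \<Sum>a\<in>H. x a) = (\<Sum>a\<in>A. p a * x a)"
  using assms
proof (induction A rule: finite_induct)
  case (insert a A)
  have "rsub p A (\<lambda>H. sum x (insert a H)) = rsub p A (\<lambda>H. x a + sum x H)"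
    using insert.hyps by (intro rsub_cong) (simp add: sum_insert_sub)
  then show ?case
    using insert by (simp add: rsub_insert rsub_add algebra_simps)
qed simp

text \<open>Variances of independent selections add up, and a Bernoulli variable has variance p (1 -
  p). In the induction the cross term drops out because the centred sum has mean zero.\<close>

lemma rsub_variance:
  assumes "finite A"
  shows "rsub p A (\<lambda>H. ((\<Sum>a\<in>H. x a) - (\<Sum>a\<in>A. p a * x a))\<^sup>2) = (\<Sum>a\<in>A. p a * (1 - p a) * (x a)\<^sup>2)"
  using assms
proof (induction A rule: finite_induct)
  case (insert a A)
  let ?D = "\<lambda>H. (\<Sum>a\<in>H. x a) - (\<Sum>a\<in>A. p a * x a)"
  have mean: "rsub p A ?D = 0" using insert.hyps by (simp add: rsub_diff rsub_mean)
  have quad: "rsub p A (\<lambda>H. (?D H)\<^sup>2 + b * ?D H + c) = (\<Sum>a\<in>A. p a * (1 - p a) * (x a)\<^sup>2) + c" for b c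
    unfolding rsub_add rsub_cmult mean insert.IH using insert.hyps by simp
  have "rsub p A (\<lambda>H. (sum x (insert a H) - (\<Sum>a\<in>insert a A. p a * x a))\<^sup>2)
      = rsub p A (\<lambda>H. (?D H)\<^sup>2 + (2 * (1 - p a) * x a) * ?D H + ((1 - p a) * x a)\<^sup>2)"
    using insert.hyps
    by (intro rsub_cong) (simp add: sum_insert_sub power2_eq_square algebra_simps)
  moreover have "rsub p A (\<lambda>H. (sum x H - (\<Sum>a\<in>insert a A. p a * x a))\<^sup>2)
      = rsub p A (\<lambda>H. (?D H)\<^sup>2 + (- (2 * p a * x a)) * ?D H + (p a * x a)\<^sup>2)"
    using insert.hyps
    by (intro rsub_cong) (simp add: power2_eq_square algebra_simps)
  ultimately have "rsub p (insert a A) (\<lambda>H. (sum x H - (\<Sum>a\<in>insert a A. p a * x a))\<^sup>2)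
      = p a * ((\<Sum>a\<in>A. p a * (1 - p a) * (x a)\<^sup>2) + ((1 - p a) * x a)\<^sup>2)
        + (1 - p a) * ((\<Sum>a\<in>A. p a * (1 - p a) * (x a)\<^sup>2) + (p a * x a)\<^sup>2)"
    unfolding quad rsub_insert[OF insert.hyps(1,2)] by simp
  then show ?case
    using insert.hyps by (simp add: power2_eq_square algebra_simps)
qed simp

text \<open>\<open>Z A H\<close> is a Rademacher sum of the \<open>x a\<close>: members of
  \<open>H\<close> carry the sign +, the others the sign -. The fourth moment bound is Khinchine's
  inequality with constant 3.\<close>

lemma rsub_sign_moments:
  fixes x :: "'a \<Rightarrow> real"
  assumes "finite A"
  defines "Z \<equiv> \<lambda>A H. 2 * (\<Sum>a\<in>H. x a) - (\<Sum>a\<in>A. x a)"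
  defines "p \<equiv> \<lambda>_::'a. 1/2"
  shows "rsub p A (Z A) = 0 \<and> rsub p A (\<lambda>H. (Z A H)\<^sup>2) = (\<Sum>a\<in>A. (x a)\<^sup>2)
    \<and> rsub p A (\<lambda>H. (Z A H)^4) \<le> 3 * (\<Sum>a\<in>A. (x a)\<^sup>2)\<^sup>2"
  using assms(1)
proof (induction A rule: finite_induct)
  case empty then show ?case by (simp add: Z_def)
next
  case (insert a A)
  let ?S = "\<Sum>a\<in>A. (x a)\<^sup>2"
  have up: "Z (insert a A) (insert a H) = Z A H + x a" if "H \<subseteq> A" for H
    using insert.hyps that by (simp add: Z_def sum_insert_sub)
  have dn: "Z (insert a A) H = Z A H - x a" for H
    using insert.hyps by (simp add: Z_def)
  have rec: "rsub p (insert a A) (\<lambda>H. F (Z (insert a A) H))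
      = rsub p A (\<lambda>H. F (Z A H + x a) / 2 + F (Z A H - x a) / 2)" for F :: "real \<Rightarrow> real"
  proof -
    have "rsub p A (\<lambda>H. F (Z (insert a A) (insert a H))) = rsub p A (\<lambda>H. F (Z A H + x a))"
      by (intro rsub_cong) (simp add: up)
    moreover have "rsub p A (\<lambda>H. F (Z A H + x a) / 2 + F (Z A H - x a) / 2)
        = 1/2 * rsub p A (\<lambda>H. F (Z A H + x a)) + 1/2 * rsub p A (\<lambda>H. F (Z A H - x a))"
      unfolding rsub_cmult[symmetric] rsub_add[symmetric] by simp
    moreover note rsub_insert[OF insert.hyps(1,2), of p "\<lambda>H. F (Z (insert a A) H)"]
    ultimately show ?thesis by (simp add: dn p_def)
  qed
  have 1: "rsub p (insert a A) (Z (insert a A)) = 0"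
    using rec[of "\<lambda>t. t"] insert.IH by (simp add: field_simps)
  have "rsub p (insert a A) (\<lambda>H. (Z (insert a A) H)\<^sup>2) = rsub p A (\<lambda>H. (Z A H)\<^sup>2 + (x a)\<^sup>2)"
    unfolding rec[of "\<lambda>t. t\<^sup>2"] by (intro rsub_cong) (simp add: power2_eq_square field_simps)
  then have 2: "rsub p (insert a A) (\<lambda>H. (Z (insert a A) H)\<^sup>2) = (\<Sum>a\<in>insert a A. (x a)\<^sup>2)"
    using insert by (simp add: rsub_add)
  have "rsub p (insert a A) (\<lambda>H. (Z (insert a A) H)^4)
      = rsub p A (\<lambda>H. (Z A H)^4 + (6 * (x a)\<^sup>2) * (Z A H)\<^sup>2 + (x a)^4)"
    unfolding rec[of "\<lambda>t. t^4"]
    by (intro rsub_cong) (simp add: power4_eq_xxxx power2_eq_square field_simps)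
  also have "\<dots> \<le> 3 * ?S\<^sup>2 + 6 * (x a)\<^sup>2 * ?S + (x a)^4"
    using insert by (simp add: rsub_add rsub_cmult)
  also have "\<dots> \<le> 3 * ((x a)\<^sup>2 + ?S)\<^sup>2"
  proof -
    have "3 * s\<^sup>2 + 6 * u * s + u\<^sup>2 \<le> 3 * (u + s)\<^sup>2" for u s :: real
    proof -
      have "0 \<le> 2 * u\<^sup>2" by simp
      then show ?thesis by (simp add: power2_sum algebra_simps)
    qed
    from this[of ?S "(x a)\<^sup>2"] show ?thesis by (simp flip: power_mult)
  qed
  finally show ?case using 1 2 insert.hyps by simp
qed

text \<open>The subset sum is half the total sum plus half a Rademacher sum, and the shift by a constant only
  helps in the Paley--Zygmund argument.\<close>

lemma rsub_Paley_Zygmund: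
  fixes x :: "'a \<Rightarrow> real"
  assumes "finite A"
  shows "1/36 \<le> rsub (\<lambda>_. 1/2) A (\<lambda>H. of_bool ((\<Sum>a\<in>H. x a)\<^sup>2 \<ge> (\<Sum>a\<in>A. (x a)\<^sup>2) / 8))"
proof -
  define p where "p = (\<lambda>_::'a. 1/2::real)"
  define S where "S = (\<Sum>a\<in>A. (x a)\<^sup>2)"
  define m where "m = (\<Sum>a\<in>A. x a)"
  define Z where "Z = (\<lambda>H. 2 * (\<Sum>a\<in>H. x a) - m)"
  define W where "W = m\<^sup>2 + S"
  have mom: "rsub p A Z = 0" "rsub p A (\<lambda>H. (Z H)\<^sup>2) = S" "rsub p A (\<lambda>H. (Z H)^4) \<le> 3 * S\<^sup>2"
    using rsub_sign_moments[OF assms, of x] by (auto simp: p_def S_def Z_def m_def)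
  have S0: "S \<ge> 0" by (simp add: S_def sum_nonneg)
  let ?G = "\<lambda>H. of_bool ((\<Sum>a\<in>H. x a)\<^sup>2 \<ge> S / 8) :: real"
  show ?thesis
  proof (cases "W = 0")
    case True
    then have "S = 0" using S0 zero_le_power2[of m] unfolding W_def by linarith
    then have "rsub p A ?G = rsub p A (\<lambda>_. 1)" by (intro rsub_cong) simp
    then show ?thesis using assms by (simp add: S_def p_def)
  next
    case False
    then have W: "W > 0" using S0 by (simp add: W_def order_less_le)
    have E2: "rsub p A (\<lambda>H. (m + Z H)\<^sup>2) = W"
    proof -
      have "rsub p A (\<lambda>H. (m + Z H)\<^sup>2) = rsub p A (\<lambda>H. m\<^sup>2 + (2 * m) * Z H + (Z H)\<^sup>2)"
        by (intro rsub_cong) (simp add: power2_eq_square algebra_simps)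
      then show ?thesis using mom assms by (simp add: rsub_add rsub_cmult W_def)
    qed
    have E4: "rsub p A (\<lambda>H. (m + Z H)^4) \<le> 9 * W\<^sup>2"
    proof -
      \<comment> \<open>The cubic term is absorbed by 2 z^2 (m - z)^2, so no third moment of
        \<open>Z\<close> has to be computed.\<close>
      have pt: "(m + z)^4 \<le> m^4 + (4 * m^3) * z + (8 * m\<^sup>2) * z\<^sup>2 + 3 * z^4" for z :: real
      proof -
        have "0 \<le> 2 * z\<^sup>2 * (m - z)\<^sup>2" by simp
        then show ?thesis
          by (simp add: power4_eq_xxxx power3_eq_cube power2_eq_square algebra_simps)
      qed
      have "rsub p A (\<lambda>H. (m + Z H)^4)
          \<le> rsub p A (\<lambda>H. m^4 + (4 * m^3) * Z H + (8 * m\<^sup>2) * (Z H)\<^sup>2 + 3 * (Z H)^4)"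
        by (intro rsub_mono pt) (simp add: p_def)
      also have "\<dots> \<le> m^4 + 8 * m\<^sup>2 * S + 9 * S\<^sup>2"
        using mom assms by (simp add: rsub_add rsub_cmult)
      also have "\<dots> \<le> 9 * W\<^sup>2"
      proof -
        have "0 \<le> 8 * m^4 + 10 * m\<^sup>2 * S" using S0 by simp
        then show ?thesis
          unfolding W_def by (simp add: power4_eq_xxxx power2_eq_square algebra_simps)
      qed
      finally show ?thesis .
    qed
    \<comment> \<open>A pointwise stand-in for Cauchy--Schwarz: y - y^2 / (36 W) is at most 9 W, its
      value at y = 18 W. Taking expectations leaves W - W/2 - W/4 on the left, and (W/4) / (9 W) is
      the constant 1/36.\<close>
    have pt: "(m + Z H)\<^sup>2 - W / 2 - (m + Z H)^4 / (36 * W) \<le> 9 * W * ?G H" for H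
    proof (cases "(m + Z H)\<^sup>2 \<ge> W / 2")
      case True
      have "(\<Sum>a\<in>H. x a)\<^sup>2 = (m + Z H)\<^sup>2 / 4" by (simp add: Z_def power2_eq_square)
      moreover have "(m + Z H)\<^sup>2 / 4 \<ge> S / 8"
      proof -
        have "S / 8 \<le> y / 4" if "(q + S) / 2 \<le> y" "0 \<le> q" for y q :: real
        proof -
          have "S \<le> 2 * y" using that by (simp add: field_simps)
          then show ?thesis by simp
        qed
        from this[OF _ zero_le_power2[of m]] show ?thesis using True unfolding W_def by blast
      qed
      ultimately have G: "?G H = 1" by simp
      define y where "y = (m + Z H)\<^sup>2"
      have "0 \<le> (y - 18 * W)\<^sup>2 / (36 * W)" using W by simp
      also have "\<dots> = y\<^sup>2 / (36 * W) - y + 9 * W"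
        using W by (simp add: power2_eq_square field_simps)
      finally have "y - y\<^sup>2 / (36 * W) \<le> 9 * W" by simp
      moreover have "y\<^sup>2 = (m + Z H)^4" by (simp add: y_def flip: power_mult)
      ultimately show ?thesis using G W by (simp add: y_def)
    next
      case False
      moreover have "0 \<le> (m + Z H)^4 / (36 * W)" "0 \<le> 9 * W * ?G H" using W by simp_all
      ultimately show ?thesis by linarith
    qed
    have "rsub p A (\<lambda>H. (m + Z H)\<^sup>2 - W / 2 - (1 / (36 * W)) * (m + Z H)^4) \<le> rsub p A (\<lambda>H. 9 * W * ?G H)"
      using pt by (intro rsub_mono) (auto simp: p_def)
    then have "W - W / 2 - (1 / (36 * W)) * rsub p A (\<lambda>H. (m + Z H)^4) \<le> 9 * W * rsub p A ?G"
      using assms by (simp add: rsub_diff E2 rsub_cmult del: times_divide_eq_left)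
    moreover have "(1 / (36 * W)) * rsub p A (\<lambda>H. (m + Z H)^4) \<le> (1 / (36 * W)) * (9 * W\<^sup>2)"
      using E4 W by (intro mult_left_mono) auto
    moreover have "(1 / (36 * W)) * (9 * W\<^sup>2) = W / 4" using W by (simp add: power2_eq_square)
    ultimately have "W / 4 \<le> 9 * W * rsub p A ?G" by linarith
    then have "1/36 \<le> rsub p A ?G" using W by (simp add: field_simps)
    then show ?thesis by (simp add: p_def S_def)
  qed
qed

section \<open>Averages over uniform random colourings\<close>

definition rcol :: "nat \<Rightarrow> 'a set \<Rightarrow> (('a \<Rightarrow> nat) \<Rightarrow> real) \<Rightarrow> real" where
  "rcol m A F = (\<Sum>c\<in>A \<rightarrow>\<^sub>E {..<m}. F c / real m ^ card A)"

lemma rcol_empty [simp]: "rcol m {} F = F (\<lambda>_. undefined)"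
  by (simp add: rcol_def)

lemma rcol_insert:
  assumes "finite A" "a \<notin> A"
  shows "rcol m (insert a A) F = (\<Sum>i<m. rcol m A (\<lambda>c. F (c(a := i)))) / real m"
proof -
  have "rcol m (insert a A) F
      = (\<Sum>(i, c)\<in>{..<m} \<times> (A \<rightarrow>\<^sub>E {..<m}). F (c(a := i)) / real m ^ card (insert a A))"
    unfolding rcol_def PiE_insert_eq
    by (subst sum.reindex)
      (use inj_combinator[OF assms(2), of "\<lambda>_. {..<m}"] in \<open>auto simp: case_prod_unfold intro!: sum.cong\<close>)
  then show ?thesis
    using assms by (simp add: sum.cartesian_product[symmetric] rcol_def sum_divide_distrib field_simps)
qed

lemma rcol_mono: "(\<And>c. c \<in> A \<rightarrow>\<^sub>E {..<m} \<Longrightarrow> F c \<le> G c) \<Longrightarrow> rcol m A F \<le> rcol m A G"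
  unfolding rcol_def by (intro sum_mono divide_right_mono) auto

lemma rcol_add: "rcol m A (\<lambda>c. F c + G c) = rcol m A F + rcol m A G"
  unfolding rcol_def by (simp add: add_divide_distrib sum.distrib)

lemma rcol_cmult: "rcol m A (\<lambda>c. b * F c) = b * rcol m A F"
  unfolding rcol_def by (simp add: sum_distrib_left)

lemma rcol_const [simp]: "finite A \<Longrightarrow> m > 0 \<Longrightarrow> rcol m A (\<lambda>_. b) = b"
  by (simp add: rcol_def card_PiE)

lemma rcol_sum: "rcol m A (\<lambda>c. \<Sum>i\<in>I. F i c) = (\<Sum>i\<in>I. rcol m A (F i))"
  unfolding rcol_def sum_divide_distrib by (rule sum.swap)

text \<open>Each colour class receives the share \<open>1 / m\<close> of the total up to a variance
  of Bernoulli type. For a fixed colouring the deviations sum to zero over the colours, so the cross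
  terms cancel when the colour of a new element is averaged out.\<close>

lemma rcol_variance:
  fixes x :: "'a \<Rightarrow> real"
  assumes "finite A" "m > 0"
  shows "rcol m A (\<lambda>c. \<Sum>j<m. ((\<Sum>a\<in>{a\<in>A. c a = j}. x a) - (\<Sum>a\<in>A. x a) / m)\<^sup>2)
    \<le> (\<Sum>a\<in>A. (x a)\<^sup>2)"
  using assms(1)
proof (induction A rule: finite_induct)
  case (insert a A)
  let ?Y = "\<lambda>c j. (\<Sum>a\<in>{a\<in>A. c a = j}. x a) - (\<Sum>a\<in>A. x a) / m"
  let ?Y' = "\<lambda>c j. (\<Sum>b\<in>{b\<in>insert a A. c b = j}. x b) - (\<Sum>b\<in>insert a A. x b) / m"
  have zero: "(\<Sum>j<m. ?Y c j) = 0" if "c \<in> A \<rightarrow>\<^sub>E {..<m}" for c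
  proof -
    have "(\<Sum>j<m. \<Sum>a\<in>{a\<in>A. c a = j}. x a) = (\<Sum>a\<in>A. x a)"
      using insert.hyps that by (intro sum.group) auto
    then show ?thesis using assms by (simp add: sum_subtractf)
  qed
  have step: "?Y' (c(a := i)) j = ?Y c j + (of_bool (i = j) - 1 / m) * x a" for c i j
  proof -
    have "{b\<in>insert a A. (c(a := i)) b = j} = (if i = j then insert a {b\<in>A. c b = j} else {b\<in>A. c b = j})"
      using insert.hyps by auto
    then show ?thesis using insert.hyps by (simp add: add_divide_distrib left_diff_distrib)
  qed
  have "(\<Sum>i<m. \<Sum>j<m. (?Y' (c(a := i)) j)\<^sup>2) \<le> m * (\<Sum>j<m. (?Y c j)\<^sup>2) + m * (x a)\<^sup>2"
    if c: "c \<in> A \<rightarrow>\<^sub>E {..<m}" for c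
  proof -
    have "(\<Sum>j<m. (?Y' (c(a := i)) j)\<^sup>2) \<le> (\<Sum>j<m. (?Y c j)\<^sup>2) + 2 * x a * ?Y c i + (x a)\<^sup>2"
      if i: "i < m" for i
    proof -
      have delta: "(\<Sum>j<m. of_bool (j = i) * g j) = g i" for g :: "nat \<Rightarrow> real"
        using i by (subst sum.cong[OF refl, of _ _ "\<lambda>j. if j = i then g j else 0"]) auto
      have "(\<Sum>j<m. (?Y' (c(a := i)) j)\<^sup>2)
        = (\<Sum>j<m. (?Y c j)\<^sup>2 + (2 * x a) * (of_bool (j = i) * ?Y c j) - (2 * x a / m) * ?Y c j
            + (x a)\<^sup>2 * (of_bool (j = i) * (1 - 2 / m)) + (x a)\<^sup>2 / m\<^sup>2)"
        unfolding step using assms(2)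
        by (intro sum.cong) (auto simp: power2_eq_square of_bool_def divide_simps split: if_splits, auto simp: algebra_simps)
      also have "\<dots> = (\<Sum>j<m. (?Y c j)\<^sup>2) + (2 * x a) * ?Y c i - (2 * x a / m) * (\<Sum>j<m. ?Y c j)
            + (x a)\<^sup>2 * (1 - 2 / m) + m * ((x a)\<^sup>2 / m\<^sup>2)"
        using i by (simp only: sum.distrib sum_subtractf sum_distrib_left[symmetric])
          (simp add: delta del: of_bool_eq)
      also have "\<dots> = (\<Sum>j<m. (?Y c j)\<^sup>2) + (2 * x a) * ?Y c i + (x a)\<^sup>2 * (1 - 1 / m)"
        using zero[OF c] assms(2) by (simp add: power2_eq_square field_simps)
      also have "(x a)\<^sup>2 * (1 - 1 / m) \<le> (x a)\<^sup>2" by (simp add: mult_left_le)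
      finally show ?thesis by simp
    qed
    then have "(\<Sum>i<m. \<Sum>j<m. (?Y' (c(a := i)) j)\<^sup>2)
        \<le> (\<Sum>i<m. (\<Sum>j<m. (?Y c j)\<^sup>2) + 2 * x a * ?Y c i + (x a)\<^sup>2)"
      by (intro sum_mono) auto
    also have "\<dots> = m * (\<Sum>j<m. (?Y c j)\<^sup>2) + m * (x a)\<^sup>2"
      using zero[OF c] by (simp add: sum.distrib flip: sum_distrib_left)
    finally show ?thesis .
  qed
  then have "rcol m A (\<lambda>c. \<Sum>i<m. \<Sum>j<m. (?Y' (c(a := i)) j)\<^sup>2)
      \<le> rcol m A (\<lambda>c. m * (\<Sum>j<m. (?Y c j)\<^sup>2) + m * (x a)\<^sup>2)"
    by (intro rcol_mono)
  also have "\<dots> \<le> m * (\<Sum>a\<in>A. (x a)\<^sup>2) + m * (x a)\<^sup>2"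
    using insert assms(2) by (simp add: rcol_add rcol_cmult)
  finally show ?case
    using insert.hyps assms(2) by (simp add: rcol_insert rcol_sum[symmetric] field_simps)
qed simp

section \<open>From pointwise averages to averaged probabilities\<close>

lemma (in prob_space) integrable_event_indicator:
  "A \<in> events \<Longrightarrow> integrable M (indicat_real A)"
  by (intro integrable_real_indicator) (auto simp: emeasure_eq_measure)

text \<open>Fubini for the finite randomisation and the given probability: a lower bound on the
  weight of the good \<open>s\<close>, valid at every point of \<open>E\<close>, becomes a lower
  bound on the weighted mean of the probabilities. The versions for \<open>rsub\<close> and
  \<open>rcol\<close> follow.\<close>

lemma (in prob_space) weighted_prob_ge:
  fixes w :: "'s \<Rightarrow> real"
  assumes "finite S" "\<And>s. s \<in> S \<Longrightarrow> 0 \<le> w s" "\<And>s. s \<in> S \<Longrightarrow> {\<omega>\<in>space M. P s \<omega>} \<in> events"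
    and E: "E \<in> events" and ge: "\<And>\<omega>. \<omega> \<in> E \<Longrightarrow> c \<le> (\<Sum>s\<in>S. w s * of_bool (P s \<omega>))"
  shows "c * prob E \<le> (\<Sum>s\<in>S. w s * prob {\<omega>\<in>space M. P s \<omega>})"
proof -
  have E': "\<omega> \<in> space M" if "\<omega> \<in> E" for \<omega> using sets.sets_into_space[OF E] that by auto
  have "c * prob E = expectation (\<lambda>\<omega>. c * indicator E \<omega>)" using E by simp
  also have "\<dots> \<le> expectation (\<lambda>\<omega>. \<Sum>s\<in>S. w s * indicator {\<omega>\<in>space M. P s \<omega>} \<omega>)"
  proof (rule integral_mono)
    show "integrable M (\<lambda>\<omega>. c * indicator E \<omega>)"
      using E by (intro integrable_mult_right integrable_event_indicator)
    show "integrable M (\<lambda>\<omega>. \<Sum>s\<in>S. w s * indicator {\<omega>\<in>space M. P s \<omega>} \<omega>)"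
      using assms(3)
      by (intro Bochner_Integration.integrable_sum integrable_mult_right integrable_event_indicator)
    fix \<omega> assume \<omega>: "\<omega> \<in> space M"
    have eq: "(\<Sum>s\<in>S. w s * indicator {\<omega>\<in>space M. P s \<omega>} \<omega>) = (\<Sum>s\<in>S. w s * of_bool (P s \<omega>))"
      using \<omega> by (intro sum.cong) (auto simp: indicator_def)
    show "c * indicator E \<omega> \<le> (\<Sum>s\<in>S. w s * indicator {\<omega>\<in>space M. P s \<omega>} \<omega>)"
      unfolding eq using ge[of \<omega>] assms(2) by (cases "\<omega> \<in> E") (auto intro!: sum_nonneg)
  qed
  also have "\<dots> = (\<Sum>s\<in>S. w s * prob {\<omega>\<in>space M. P s \<omega>})"
    using assms(3)
    by (subst Bochner_Integration.integral_sum) (auto intro: integrable_event_indicator)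
  finally show ?thesis .
qed

lemma (in prob_space) weighted_prob_le:
  fixes w :: "'s \<Rightarrow> real"
  assumes "finite S" "\<And>s. s \<in> S \<Longrightarrow> {\<omega>\<in>space M. P s \<omega>} \<in> events"
    and le: "\<And>\<omega>. \<omega> \<in> space M \<Longrightarrow> (\<Sum>s\<in>S. w s * of_bool (P s \<omega>)) \<le> c"
  shows "(\<Sum>s\<in>S. w s * prob {\<omega>\<in>space M. P s \<omega>}) \<le> c"
proof -
  have "(\<Sum>s\<in>S. w s * prob {\<omega>\<in>space M. P s \<omega>})
      = expectation (\<lambda>\<omega>. \<Sum>s\<in>S. w s * indicator {\<omega>\<in>space M. P s \<omega>} \<omega>)"
    using assms(2)
    by (subst Bochner_Integration.integral_sum) (auto intro: integrable_event_indicator)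
  also have "\<dots> \<le> expectation (\<lambda>\<omega>. c)"
  proof (rule integral_mono)
    show "integrable M (\<lambda>\<omega>. \<Sum>s\<in>S. w s * indicator {\<omega>\<in>space M. P s \<omega>} \<omega>)"
      using assms(2)
      by (intro Bochner_Integration.integrable_sum integrable_mult_right integrable_event_indicator)
    fix \<omega> assume \<omega>: "\<omega> \<in> space M"
    have "(\<Sum>s\<in>S. w s * indicator {\<omega>\<in>space M. P s \<omega>} \<omega>) = (\<Sum>s\<in>S. w s * of_bool (P s \<omega>))"
      using \<omega> by (intro sum.cong) (auto simp: indicator_def)
    then show "(\<Sum>s\<in>S. w s * indicator {\<omega>\<in>space M. P s \<omega>} \<omega>) \<le> c" using le[OF \<omega>] by simp
  qed simp
  finally show ?thesis by (simp add: prob_space)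
qed

lemma (in prob_space) rsub_prob_ge:
  assumes "finite A" "\<And>a. a \<in> A \<Longrightarrow> 0 \<le> p a \<and> p a \<le> 1"
    and "\<And>H. H \<subseteq> A \<Longrightarrow> {\<omega>\<in>space M. P H \<omega>} \<in> events" "E \<in> events"
    and "\<And>\<omega>. \<omega> \<in> E \<Longrightarrow> c \<le> rsub p A (\<lambda>H. of_bool (P H \<omega>))"
  shows "c * prob E \<le> rsub p A (\<lambda>H. prob {\<omega>\<in>space M. P H \<omega>})"
  unfolding rsub_def
proof (rule weighted_prob_ge)
  fix H assume "H \<in> Pow A"
  then show "0 \<le> (\<Prod>a\<in>H. p a) * (\<Prod>a\<in>A - H. 1 - p a)"
    using assms(2) by (intro mult_nonneg_nonneg prod_nonneg) auto
qed (use assms in \<open>auto simp: rsub_def\<close>)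

lemma (in prob_space) rsub_prob_le:
  assumes "finite A" "\<And>H. H \<subseteq> A \<Longrightarrow> {\<omega>\<in>space M. P H \<omega>} \<in> events"
    and "\<And>\<omega>. \<omega> \<in> space M \<Longrightarrow> rsub p A (\<lambda>H. of_bool (P H \<omega>)) \<le> c"
  shows "rsub p A (\<lambda>H. prob {\<omega>\<in>space M. P H \<omega>}) \<le> c"
  unfolding rsub_def by (rule weighted_prob_le) (use assms in \<open>auto simp: rsub_def\<close>)

lemma (in prob_space) rcol_prob_ge:
  assumes "finite A" "\<And>c. c \<in> A \<rightarrow>\<^sub>E {..<m} \<Longrightarrow> {\<omega>\<in>space M. P c \<omega>} \<in> events" "E \<in> events"
    and "\<And>\<omega>. \<omega> \<in> E \<Longrightarrow> b \<le> rcol m A (\<lambda>c. of_bool (P c \<omega>))"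
  shows "b * prob E \<le> rcol m A (\<lambda>c. prob {\<omega>\<in>space M. P c \<omega>})"
proof -
  have "b * prob E \<le> (\<Sum>c\<in>A \<rightarrow>\<^sub>E {..<m}. 1 / real m ^ card A * prob {\<omega>\<in>space M. P c \<omega>})"
    by (rule weighted_prob_ge) (use assms in \<open>auto simp: rcol_def intro: finite_PiE\<close>)
  then show ?thesis by (simp add: rcol_def)
qed

text \<open>Cauchy--Schwarz if all \<open>x i\<close> lie in [-1, 1]. Otherwise one truncated square
  on the right is already 1, and the left side never exceeds 1.\<close>

lemma min_one_square_sum_le:
  fixes x :: "'i \<Rightarrow> real"
  assumes "finite I"
  shows "min 1 ((\<Sum>i\<in>I. x i)\<^sup>2) \<le> card I * (\<Sum>i\<in>I. min 1 ((x i)\<^sup>2))"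
proof (cases "\<forall>i\<in>I. (x i)\<^sup>2 \<le> 1")
  case True
  have "(\<Sum>i\<in>I. x i)\<^sup>2 \<le> (\<Sum>i\<in>I. (x i)\<^sup>2) * card I" using sum_squared_le_sum_of_squares[of x I] by simp
  also have "(\<Sum>i\<in>I. (x i)\<^sup>2) = (\<Sum>i\<in>I. min 1 ((x i)\<^sup>2))" using True by (intro sum.cong) auto
  finally show ?thesis by (simp add: mult.commute)
next
  case False
  then obtain i where i: "i \<in> I" "(x i)\<^sup>2 > 1" by force
  have "1 = min 1 ((x i)\<^sup>2)" using i by simp
  also have "\<dots> \<le> (\<Sum>i\<in>I. min 1 ((x i)\<^sup>2))" using i assms by (intro member_le_sum) auto
  finally have "1 * 1 \<le> card I * (\<Sum>i\<in>I. min 1 ((x i)\<^sup>2))"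
    using i assms by (intro mult_mono) (auto simp: Suc_le_eq card_gt_0_iff)
  then show ?thesis by simp
qed

section \<open>Exhaustive random set functions\<close>

text \<open>\<open>nu_Un\<close> is required at every point and not just almost surely, so that one
  can argue for a fixed \<omega>. The single threshold 1 in \<open>exhaustive\<close> is enough
  because the contradiction in \<open>not_heavy\<close> comes from disjoint pieces with values above
  1.\<close>

locale random_content = prob_space M + algebra D AA
  for M :: "'w measure" and D :: "'x set" and AA :: "'x set set" +
  fixes \<nu> :: "'x set \<Rightarrow> 'w \<Rightarrow> real"
  assumes nu_meas [measurable]: "\<And>A. A \<in> AA \<Longrightarrow> \<nu> A \<in> borel_measurable M"
    and nu_Un: "\<And>A B \<omega>. A \<in> AA \<Longrightarrow> B \<in> AA \<Longrightarrow> A \<inter> B = {} \<Longrightarrow> \<nu> (A \<union> B) \<omega> = \<nu> A \<omega> + \<nu> B \<omega>"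
    and exhaustive: "\<And>R :: nat \<Rightarrow> 'x set. range R \<subseteq> AA \<Longrightarrow> disjoint_family R \<Longrightarrow>
      (\<lambda>n. prob {\<omega>\<in>space M. \<bar>\<nu> (R n) \<omega>\<bar> > 1}) \<longlonglongrightarrow> 0"
begin

lemma nu_empty [simp]: "\<nu> {} \<omega> = 0"
  using nu_Un[of "{}" "{}" \<omega>] by simp

lemma nu_Union:
  assumes "finite Q" "Q \<subseteq> AA" "disjoint Q"
  shows "\<nu> (\<Union>Q) \<omega> = (\<Sum>q\<in>Q. \<nu> q \<omega>)"
  using assms
proof (induction Q rule: finite_induct)
  case (insert q Q)
  then have "q \<inter> \<Union>Q = {}" by (auto simp: disjoint_def)
  moreover have "\<Union>Q \<in> AA" using insert by auto
  ultimately show ?case using insert by (simp add: nu_Un disjoint_def)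
qed simp

lemma nu_UN:
  assumes "finite I" "A ` I \<subseteq> AA" "disjoint_family_on A I"
  shows "\<nu> (\<Union>i\<in>I. A i) \<omega> = (\<Sum>i\<in>I. \<nu> (A i) \<omega>)"
  using assms
proof (induction I rule: finite_induct)
  case (insert i I)
  then have "A i \<inter> \<Union>(A ` I) = {}" by (fastforce simp: disjoint_family_on_def)
  moreover have "\<Union>(A ` I) \<in> AA" using insert by auto
  ultimately show ?case using insert by (simp add: nu_Un disjoint_family_on_def)
qed simp

section \<open>Truncated square sums over partitions\<close>

text \<open>The cut at 1 keeps each summand in [0, 1], so that the variance of a randomly thinned
  energy is at most its mean, however large the values are.\<close>

definition energy :: "'x set set \<Rightarrow> 'w \<Rightarrow> real" where
  "energy Q \<omega> = (\<Sum>q\<in>Q. min 1 ((\<nu> q \<omega>)\<^sup>2))"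

definition parts :: "'x set \<Rightarrow> 'x set set set" where
  "parts Y = {Q. finite Q \<and> Q \<subseteq> AA \<and> disjoint Q \<and> \<Union>Q = Y}"

lemma partsD: "Q \<in> parts Y \<Longrightarrow> finite Q" "Q \<in> parts Y \<Longrightarrow> Q \<subseteq> AA" "Q \<in> parts Y \<Longrightarrow> disjoint Q"
    "Q \<in> parts Y \<Longrightarrow> \<Union>Q = Y" "Q \<in> parts Y \<Longrightarrow> H \<subseteq> Q \<Longrightarrow> \<Union>H \<in> AA"
  by (auto simp: parts_def intro!: finite_Union intro: finite_subset)

lemma energy_measurable [measurable]: "Q \<subseteq> AA \<Longrightarrow> energy Q \<in> borel_measurable M"
  unfolding energy_def by (intro borel_measurable_sum) auto

definition refinement :: "'x set set \<Rightarrow> 'x set set \<Rightarrow> 'x set set" where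
  "refinement Q' Q = (\<lambda>(q', q). q' \<inter> q) ` (Q' \<times> Q)"

text \<open>Different pairs can have the same intersection only if it is empty, and there \<nu>
  vanishes. Summing over the set of intersections therefore loses nothing.\<close>

lemma energy_refinement:
  assumes "finite Q'" "disjoint Q'" "finite Q" "disjoint Q"
  shows "energy (refinement Q' Q) \<omega> = (\<Sum>q\<in>Q. \<Sum>q'\<in>Q'. min 1 ((\<nu> (q' \<inter> q) \<omega>)\<^sup>2))"
proof -
  have "energy (refinement Q' Q) \<omega> = (\<Sum>z\<in>Q' \<times> Q. min 1 ((\<nu> (fst z \<inter> snd z) \<omega>)\<^sup>2))"
    unfolding energy_def refinement_def
  proof (subst sum.reindex_nontrivial)
    fix z1 z2 assume z: "z1 \<in> Q' \<times> Q" "z2 \<in> Q' \<times> Q" "z1 \<noteq> z2"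
      "(case z1 of (q', q) \<Rightarrow> q' \<inter> q) = (case z2 of (q', q) \<Rightarrow> q' \<inter> q)"
    then have "fst z1 \<noteq> fst z2 \<or> snd z1 \<noteq> snd z2" by (simp add: prod_eq_iff)
    then have "fst z1 \<inter> fst z2 = {} \<or> snd z1 \<inter> snd z2 = {}"
      using z disjointD[OF assms(2)] disjointD[OF assms(4)] by (metis mem_Times_iff)
    then have "(case z1 of (q', q) \<Rightarrow> q' \<inter> q) = {}"
      using z(4) by (auto simp: case_prod_unfold)
    then show "min 1 ((\<nu> (case z1 of (q', q) \<Rightarrow> q' \<inter> q) \<omega>)\<^sup>2) = 0" by simp
  qed (use assms in \<open>auto intro!: sum.cong\<close>)
  also have "\<dots> = (\<Sum>q'\<in>Q'. \<Sum>q\<in>Q. min 1 ((\<nu> (q' \<inter> q) \<omega>)\<^sup>2))"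
    by (simp add: sum.cartesian_product case_prod_unfold)
  finally show ?thesis by (simp add: sum.swap[of _ Q])
qed

lemma refinement_parts:
  assumes "Q' \<in> parts Y" "finite Q" "Q \<subseteq> AA" "disjoint Q" "\<Union>Q \<subseteq> Y"
  shows "refinement Q' Q \<in> parts (\<Union>Q)"
proof -
  have "disjoint (refinement Q' Q)"
  proof (rule disjointI)
    fix a b assume "a \<in> refinement Q' Q" "b \<in> refinement Q' Q" "a \<noteq> b"
    then obtain q1 q2 r1 r2 where q: "a = q1 \<inter> r1" "b = q2 \<inter> r2" "q1 \<in> Q'" "q2 \<in> Q'" "r1 \<in> Q" "r2 \<in> Q"
      "q1 \<noteq> q2 \<or> r1 \<noteq> r2" by (auto simp: refinement_def)
    then have "q1 \<inter> q2 = {} \<or> r1 \<inter> r2 = {}"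
      using disjointD[OF partsD(3)[OF assms(1)]] disjointD[OF assms(4)] by metis
    then show "a \<inter> b = {}" using q(1,2) by auto
  qed
  moreover have "\<Union>(refinement Q' Q) = \<Union>Q"
  proof
    show "\<Union>Q \<subseteq> \<Union>(refinement Q' Q)"
    proof
      fix x assume x: "x \<in> \<Union>Q"
      then have "x \<in> \<Union>Q'" using assms(1,5) by (auto simp: parts_def)
      then show "x \<in> \<Union>(refinement Q' Q)" using x unfolding refinement_def by blast
    qed
  qed (auto simp: refinement_def)
  ultimately show ?thesis using assms by (auto simp: parts_def refinement_def)
qed

text \<open>Each piece of \<open>Q'\<close> is cut into at most \<open>card Q\<close> pieces, to
  which \<open>min_one_square_sum_le\<close> applies. As the factor depends on \<open>Q\<close>
  only, a partition of huge energy may be assumed to refine a given \<open>Q\<close>.\<close>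

lemma energy_le_refinement:
  assumes Q': "Q' \<in> parts Y" and Q: "Q \<in> parts Y"
  shows "energy Q' \<omega> \<le> card Q * energy (refinement Q' Q) \<omega>"
proof -
  have "min 1 ((\<nu> q' \<omega>)\<^sup>2) \<le> card Q * (\<Sum>q\<in>Q. min 1 ((\<nu> (q' \<inter> q) \<omega>)\<^sup>2))" if q': "q' \<in> Q'" for q'
  proof -
    have "q' = (\<Union>q\<in>Q. q' \<inter> q)" using q' partsD(4)[OF Q'] partsD(4)[OF Q] by blast
    then have "\<nu> q' \<omega> = \<nu> (\<Union>q\<in>Q. q' \<inter> q) \<omega>" by simp
    also have "\<dots> = (\<Sum>q\<in>Q. \<nu> (q' \<inter> q) \<omega>)"
    proof (rule nu_UN)
      show "disjoint_family_on (\<lambda>q. q' \<inter> q) Q"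
        unfolding disjoint_family_on_def using disjointD[OF partsD(3)[OF Q]] by fastforce
    qed (use q' partsD[OF Q] partsD[OF Q'] in auto)
    finally show ?thesis using min_one_square_sum_le[OF partsD(1)[OF Q]] by simp
  qed
  then have "energy Q' \<omega> \<le> (\<Sum>q'\<in>Q'. card Q * (\<Sum>q\<in>Q. min 1 ((\<nu> (q' \<inter> q) \<omega>)\<^sup>2)))"
    unfolding energy_def by (intro sum_mono)
  also have "\<dots> = card Q * energy (refinement Q' Q) \<omega>"
    using partsD[OF Q] partsD[OF Q'] by (simp add: energy_refinement sum_distrib_left[symmetric] sum.swap[of _ Q])
  finally show ?thesis .
qed

section \<open>Energies are bounded in probability\<close>

text \<open>The failure of boundedness in probability. That \<eta> is the same for all
  \<open>L\<close> allows the property to be handed on to a remainder of \<open>Y\<close> with a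
  slightly smaller \<eta>.\<close>

definition heavy :: "'x set \<Rightarrow> real \<Rightarrow> bool" where
  "heavy Y \<eta> \<longleftrightarrow> Y \<in> AA \<and> (\<forall>L::nat. \<exists>Q\<in>parts Y. \<eta> \<le> prob {\<omega>\<in>space M. L \<le> energy Q \<omega>})"

text \<open>Selecting with probability \<open>p / 2\<close> is selecting with \<open>p\<close> and
  then with 1/2. By Chebyshev the first stage keeps at least half of the mean
  \<open>p * energy Q \<omega>\<close> with probability 1/2; the second is
  \<open>rsub_Paley_Zygmund\<close>, hence 1/72. The constant 17 makes the retained square sum
  exceed 8, and so the selected value exceeds 1.\<close>

lemma random_union_large:
  assumes Q: "Q \<in> parts Y" and p: "0 < p" "p \<le> 1" and energy: "17 / p \<le> energy Q \<omega>"
  shows "1/72 \<le> rsub (\<lambda>_. p / 2) Q (\<lambda>H. of_bool (\<bar>\<nu> (\<Union>H) \<omega>\<bar> > 1))"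
proof -
  let ?w = "\<lambda>q. min 1 ((\<nu> q \<omega>)\<^sup>2)"
  let ?G = "\<lambda>K. of_bool ((\<Sum>q\<in>K. ?w q) \<ge> p * energy Q \<omega> / 2) :: real"
  note Qf = partsD[OF Q]
  have pN: "p * energy Q \<omega> \<ge> 17" using energy p by (simp add: field_simps)
  have "1/2 \<le> rsub (\<lambda>_. p) Q ?G"
  proof -
    have mean: "(\<Sum>q\<in>Q. p * ?w q) = p * energy Q \<omega>" by (simp add: energy_def sum_distrib_left)
    have pt: "1 - (4 / (p * energy Q \<omega>)\<^sup>2) * ((\<Sum>q\<in>K. ?w q) - (\<Sum>q\<in>Q. p * ?w q))\<^sup>2 \<le> ?G K" for K
    proof (cases "(\<Sum>q\<in>K. ?w q) \<ge> p * energy Q \<omega> / 2")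
      case False
      then have "(p * energy Q \<omega> / 2)\<^sup>2 \<le> (p * energy Q \<omega> - (\<Sum>q\<in>K. ?w q))\<^sup>2"
        using pN by (intro power_mono) auto
      moreover have "1 \<le> (4 / n\<^sup>2) * y" if "(n / 2)\<^sup>2 \<le> y" "17 \<le> n" for n y :: real
        using that by (simp add: power_divide field_simps)
      ultimately have "1 \<le> (4 / (p * energy Q \<omega>)\<^sup>2) * (p * energy Q \<omega> - (\<Sum>q\<in>K. ?w q))\<^sup>2"
        using pN by blast
      then show ?thesis unfolding mean by (simp add: power2_commute)
    qed simp
    have var: "rsub (\<lambda>_. p) Q (\<lambda>K. ((\<Sum>q\<in>K. ?w q) - (\<Sum>q\<in>Q. p * ?w q))\<^sup>2) \<le> p * energy Q \<omega>"
    proof -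
      have "(\<Sum>q\<in>Q. p * (1 - p) * (?w q)\<^sup>2) \<le> (\<Sum>q\<in>Q. p * ?w q)"
      proof (rule sum_mono)
        fix q
        have "(1 - p) * (?w q * ?w q) \<le> 1 * (1 * ?w q)"
          using p by (intro mult_mono mult_right_mono) auto
        then show "p * (1 - p) * (?w q)\<^sup>2 \<le> p * ?w q"
          using p by (simp add: power2_eq_square mult.assoc)
      qed
      then show ?thesis unfolding rsub_variance[OF Qf(1)] using mean by linarith
    qed
    have "1 / 2 \<le> 1 - (4 / (p * energy Q \<omega>)\<^sup>2) * (p * energy Q \<omega>)"
      using pN by (simp add: power2_eq_square field_simps)
    also have "\<dots> \<le> 1 - (4 / (p * energy Q \<omega>)\<^sup>2) * rsub (\<lambda>_. p) Q (\<lambda>K. ((\<Sum>q\<in>K. ?w q) - (\<Sum>q\<in>Q. p * ?w q))\<^sup>2)"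
      using var by (intro diff_left_mono mult_left_mono) auto
    also have "\<dots> = rsub (\<lambda>_. p) Q (\<lambda>K. 1 - (4 / (p * energy Q \<omega>)\<^sup>2) * ((\<Sum>q\<in>K. ?w q) - (\<Sum>q\<in>Q. p * ?w q))\<^sup>2)"
      using Qf(1) by (simp only: rsub_diff rsub_cmult rsub_const)
    also have "\<dots> \<le> rsub (\<lambda>_. p) Q ?G" using p pt by (intro rsub_mono) auto
    finally show ?thesis .
  qed
  then have "1/72 \<le> 1/36 * rsub (\<lambda>_. p) Q ?G" by simp
  also have "\<dots> = rsub (\<lambda>_. p) Q (\<lambda>K. 1/36 * ?G K)" by (simp only: rsub_cmult)
  also have "\<dots> \<le> rsub (\<lambda>_. p) Q (\<lambda>K. rsub (\<lambda>_. 1/2) K (\<lambda>H. of_bool (\<bar>\<nu> (\<Union>H) \<omega>\<bar> > 1)))"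
  proof (rule rsub_mono)
    fix K assume K: "K \<subseteq> Q"
    have finK: "finite K" using K Qf(1) finite_subset by auto
    show "1/36 * ?G K \<le> rsub (\<lambda>_. 1/2) K (\<lambda>H. of_bool (\<bar>\<nu> (\<Union>H) \<omega>\<bar> > 1))"
    proof (cases "(\<Sum>q\<in>K. ?w q) \<ge> p * energy Q \<omega> / 2")
      case True
      have "(\<Sum>q\<in>K. ?w q) \<le> (\<Sum>q\<in>K. (\<nu> q \<omega>)\<^sup>2)" by (intro sum_mono) auto
      then have big: "(\<Sum>q\<in>K. (\<nu> q \<omega>)\<^sup>2) / 8 > 1" using True pN by simp
      have "1/36 \<le> rsub (\<lambda>_. 1/2) K (\<lambda>H. of_bool ((\<Sum>q\<in>H. \<nu> q \<omega>)\<^sup>2 \<ge> (\<Sum>q\<in>K. (\<nu> q \<omega>)\<^sup>2) / 8))"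
        by (rule rsub_Paley_Zygmund[OF finK])
      also have "\<dots> \<le> rsub (\<lambda>_. 1/2) K (\<lambda>H. of_bool (\<bar>\<nu> (\<Union>H) \<omega>\<bar> > 1))"
      proof (rule rsub_mono)
        fix H assume H: "H \<subseteq> K"
        have "\<nu> (\<Union>H) \<omega> = (\<Sum>q\<in>H. \<nu> q \<omega>)"
          using H K finK Qf pairwise_subset[OF Qf(3), of H]
          by (intro nu_Union) (auto intro: finite_subset)
        then have "\<bar>\<nu> (\<Union>H) \<omega>\<bar> > 1" if "(\<Sum>q\<in>H. \<nu> q \<omega>)\<^sup>2 \<ge> (\<Sum>q\<in>K. (\<nu> q \<omega>)\<^sup>2) / 8"
        proof -
          have "1 < (\<nu> (\<Union>H) \<omega>)\<^sup>2" using that big \<open>\<nu> (\<Union>H) \<omega> = _\<close> by simp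
          then show ?thesis using abs_square_le_1[of "\<nu> (\<Union>H) \<omega>"] by linarith
        qed
        then show "of_bool ((\<Sum>q\<in>H. \<nu> q \<omega>)\<^sup>2 \<ge> (\<Sum>q\<in>K. (\<nu> q \<omega>)\<^sup>2) / 8) \<le> (of_bool (\<bar>\<nu> (\<Union>H) \<omega>\<bar> > 1) :: real)"
          by simp
      qed simp
      finally show ?thesis using True by simp
    next
      case False
      have "0 \<le> rsub (\<lambda>_. 1/2) K (\<lambda>H. of_bool (\<bar>\<nu> (\<Union>H) \<omega>\<bar> > 1))"
        unfolding rsub_def by (intro sum_nonneg) auto
      then show ?thesis using False by simp
    qed
  qed (use p in auto)
  also have "\<dots> = rsub (\<lambda>_. p / 2) Q (\<lambda>H. of_bool (\<bar>\<nu> (\<Union>H) \<omega>\<bar> > 1))"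
    using rsub_rsub[OF Qf(1), of "\<lambda>_. p" "\<lambda>_. 1/2"] by simp
  finally show ?thesis .
qed

lemma heavy_antimono:
  assumes Q: "Q \<in> parts Y" and le: "L' \<le> L" and p: "\<eta> \<le> prob {\<omega>\<in>space M. real L \<le> energy Q \<omega>}"
  shows "\<eta> \<le> prob {\<omega>\<in>space M. real L' \<le> energy Q \<omega>}"
proof -
  have [measurable]: "energy Q \<in> borel_measurable M" using partsD(2)[OF Q] by measurable
  have "prob {\<omega>\<in>space M. real L \<le> energy Q \<omega>} \<le> prob {\<omega>\<in>space M. real L' \<le> energy Q \<omega>}"
    using le by (intro finite_measure_mono) auto
  then show ?thesis using p by linarith
qed

text \<open>A sparse random union of atoms of one high-energy partition exceeds 1 with a definite
  probability, yet takes on average only the fraction \<open>p / 2\<close> of the energy of any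
  finer partition. Some union does the first without usually taking more than half of the energy, so
  its complement stays heavy.\<close>

lemma heavy_split:
  assumes hv: "heavy Y \<eta>" and \<eta>': "0 < \<eta>'" "\<eta>' < \<eta>"
  shows "\<exists>R\<in>AA. R \<subseteq> Y \<and> \<eta> / 144 \<le> prob {\<omega>\<in>space M. \<bar>\<nu> R \<omega>\<bar> > 1} \<and> heavy (Y - R) \<eta>'"
proof -
  have ex: "\<exists>Q\<in>parts Y. \<eta> \<le> prob {\<omega>\<in>space M. real L \<le> energy Q \<omega>}" for L :: nat
    using hv unfolding heavy_def by blast
  have \<eta>1: "\<eta> \<le> 1" using ex[of 0] by (meson order_trans prob_le_1)
  \<comment> \<open>This choice makes \<open>p / (\<eta> - \<eta>')\<close> equal to
    \<open>\<eta> / 288\<close>, less than the gap between the mean \<open>\<eta> / 72\<close> of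
    \<open>g\<close> and the target \<open>\<eta> / 144\<close>.\<close>
  define p where "p = (\<eta> - \<eta>') * \<eta> / 288"
  have p: "0 < p" "p \<le> 1"
  proof -
    have "(\<eta> - \<eta>') * \<eta> \<le> 1 * 1" using \<eta>' \<eta>1 by (intro mult_mono) auto
    then show "0 < p" "p \<le> 1" using \<eta>' by (auto simp: p_def)
  qed
  obtain L :: nat where L: "17 / p \<le> L" using real_arch_simple by blast
  obtain Q where Q: "Q \<in> parts Y" and QL: "\<eta> \<le> prob {\<omega>\<in>space M. real L \<le> energy Q \<omega>}" using ex by blast
  note Qf = partsD[OF Q]
  have [measurable]: "energy Q \<in> borel_measurable M" using Qf by measurable
  have card: "card Q > 0"
  proof (rule ccontr)
    assume "\<not> card Q > 0"
    then have "Q = {}" using Qf by simp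
    moreover have "0 < real L" using L p by (smt (verit) divide_pos_pos)
    ultimately have "{\<omega>\<in>space M. real L \<le> energy Q \<omega>} = {}" by (auto simp: energy_def)
    then have "\<eta> \<le> prob {}" using QL by (simp only:)
    then show False using \<eta>' by simp
  qed
  define g where "g H = prob {\<omega>\<in>space M. \<bar>\<nu> (\<Union>H) \<omega>\<bar> > 1}" for H
  have nuH [measurable]: "\<nu> (\<Union>H) \<in> borel_measurable M" if "H \<subseteq> Q" for H
    using Qf(5)[OF that] by measurable
  have g: "\<eta> / 72 \<le> rsub (\<lambda>_. p / 2) Q g"
  proof -
    have "1/72 * prob {\<omega>\<in>space M. real L \<le> energy Q \<omega>} \<le> rsub (\<lambda>_. p / 2) Q g"
      unfolding g_def
    proof (rule rsub_prob_ge)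
      fix \<omega> assume "\<omega> \<in> {\<omega>\<in>space M. real L \<le> energy Q \<omega>}"
      then show "1/72 \<le> rsub (\<lambda>_. p / 2) Q (\<lambda>H. of_bool (1 < \<bar>\<nu> (\<Union>H) \<omega>\<bar>))"
        using L by (intro random_union_large[OF Q p]) auto
    next
      fix H assume "H \<subseteq> Q"
      note [measurable] = nuH[OF this]
      show "{\<omega>\<in>space M. 1 < \<bar>\<nu> (\<Union>H) \<omega>\<bar>} \<in> events" by measurable
    next
      show "{\<omega>\<in>space M. real L \<le> energy Q \<omega>} \<in> events" by measurable
    qed (use Qf p in auto)
    then show ?thesis using QL by linarith
  qed
  define C where "C = {H \<in> Pow Q. \<eta> / 144 \<le> g H}"
  have step: "\<exists>H\<in>C. \<exists>Q''\<in>parts (Y - \<Union>H). \<eta>' \<le> prob {\<omega>\<in>space M. real K \<le> energy Q'' \<omega>}" for K :: nat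
  proof -
    \<comment> \<open>The factor \<open>card Q\<close> pays for refining by \<open>Q\<close>, the
      factor 2 lets \<open>H\<close> take half of the energy, and the \<open>+ 1\<close> keeps the
      refined energy positive when \<open>K\<close> is 0.\<close>
    define K' where "K' = 2 * card Q * (K + 1)"
    obtain Q' where Q': "Q' \<in> parts Y" and QK: "\<eta> \<le> prob {\<omega>\<in>space M. real K' \<le> energy Q' \<omega>}" using ex by blast
    define n where "n \<omega> q = (\<Sum>q'\<in>Q'. min 1 ((\<nu> (q' \<inter> q) \<omega>)\<^sup>2))" for \<omega> q
    have n0: "0 \<le> n \<omega> q" for \<omega> q unfolding n_def by (intro sum_nonneg) auto
    have refp: "refinement Q' H \<in> parts (\<Union>H)" if "H \<subseteq> Q" for H
      using that Qf pairwise_subset[OF Qf(3) that]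
      by (intro refinement_parts[OF Q']) (auto intro: finite_subset)
    have energy_ref: "energy (refinement Q' H) \<omega> = (\<Sum>q\<in>H. n \<omega> q)" if "H \<subseteq> Q" for H \<omega>
      unfolding n_def using that Qf partsD[OF Q'] pairwise_subset[OF Qf(3) that]
      by (intro energy_refinement) (auto intro: finite_subset)
    have [measurable]: "energy Q' \<in> borel_measurable M" "energy (refinement Q' Q) \<in> borel_measurable M"
      using partsD(2)[OF Q'] partsD(2)[OF refp[of Q]] by measurable
    have mref [measurable]: "energy (refinement Q' H) \<in> borel_measurable M" if "H \<subseteq> Q" for H
      using partsD(2)[OF refp[OF that]] by measurable
    have Nge: "2 * (K + 1) \<le> energy (refinement Q' Q) \<omega>" if "real K' \<le> energy Q' \<omega>" for \<omega>
    proof -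
      have "real (card Q) * (2 * (K + 1)) \<le> real (card Q) * energy (refinement Q' Q) \<omega>"
        using that energy_le_refinement[OF Q' Q, of \<omega>] by (simp add: K'_def algebra_simps)
      then show ?thesis using card by simp
    qed
    define bad where "bad H = prob {\<omega>\<in>space M. real K' \<le> energy Q' \<omega> \<and> energy (refinement Q' Q) \<omega> < 2 * energy (refinement Q' H) \<omega>}" for H
    \<comment> \<open>Markov's inequality: \<open>H\<close> carries on average the fraction
      \<open>p / 2\<close> of the refined energy, hence more than half of it with mean probability
      at most \<open>p\<close>.\<close>
    have bad: "rsub (\<lambda>_. p / 2) Q bad \<le> p"
      unfolding bad_def
    proof (rule rsub_prob_le)
      fix H assume "H \<subseteq> Q"
      note [measurable] = mref[OF this]
      show "{\<omega>\<in>space M. real K' \<le> energy Q' \<omega> \<and> energy (refinement Q' Q) \<omega> < 2 * energy (refinement Q' H) \<omega>} \<in> events"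
        by measurable
    next
      fix \<omega>
      show "rsub (\<lambda>_. p / 2) Q (\<lambda>H. of_bool (real K' \<le> energy Q' \<omega> \<and> energy (refinement Q' Q) \<omega> < 2 * energy (refinement Q' H) \<omega>)) \<le> p"
      proof (cases "real K' \<le> energy Q' \<omega>")
        case True
        define T where "T = energy (refinement Q' Q) \<omega>"
        have T: "T > 0" using Nge[OF True] by (simp add: T_def)
        have "rsub (\<lambda>_. p / 2) Q (\<lambda>H. of_bool (real K' \<le> energy Q' \<omega> \<and> energy (refinement Q' Q) \<omega> < 2 * energy (refinement Q' H) \<omega>))
          \<le> rsub (\<lambda>_. p / 2) Q (\<lambda>H. (2 / T) * (\<Sum>q\<in>H. n \<omega> q))"
        proof (rule rsub_mono)
          fix H assume H: "H \<subseteq> Q"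
          have "0 \<le> (2 / T) * (\<Sum>q\<in>H. n \<omega> q)" using T n0 by (simp add: sum_nonneg)
          moreover have "1 \<le> (2 / T) * (\<Sum>q\<in>H. n \<omega> q)" if "T < 2 * (\<Sum>q\<in>H. n \<omega> q)"
            using that T by (simp add: field_simps)
          ultimately show "of_bool (real K' \<le> energy Q' \<omega> \<and> energy (refinement Q' Q) \<omega> < 2 * energy (refinement Q' H) \<omega>)
              \<le> (2 / T) * (\<Sum>q\<in>H. n \<omega> q)"
            using energy_ref[OF H] by (auto simp: T_def)
        qed (use p in auto)
        also have "\<dots> = (2 / T) * ((p / 2) * T)"
          unfolding rsub_cmult rsub_mean[OF Qf(1)] T_def energy_ref[OF order_refl] by (simp add: sum_distrib_left)
        also have "\<dots> = p" using T by simp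
        finally show ?thesis .
      qed (use p Qf in simp)
    qed (use Qf in auto)
    have "\<exists>H\<subseteq>Q. \<eta> / 144 \<le> g H \<and> bad H \<le> \<eta> - \<eta>'"
    proof (rule ccontr)
      assume "\<not> ?thesis"
      then have no: "g H < \<eta> / 144 \<or> \<eta> - \<eta>' < bad H" if "H \<subseteq> Q" for H using that by (meson not_le)
      have "rsub (\<lambda>_. p / 2) Q g \<le> rsub (\<lambda>_. p / 2) Q (\<lambda>H. \<eta> / 144 + (1 / (\<eta> - \<eta>')) * bad H)"
      proof (rule rsub_mono)
        fix H assume H: "H \<subseteq> Q"
        have b0: "0 \<le> (1 / (\<eta> - \<eta>')) * bad H" using \<eta>' by (simp add: bad_def)
        from no[OF H] show "g H \<le> \<eta> / 144 + (1 / (\<eta> - \<eta>')) * bad H"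
        proof
          assume "\<eta> - \<eta>' < bad H"
          then have "1 \<le> (1 / (\<eta> - \<eta>')) * bad H" using \<eta>' by (simp add: field_simps)
          moreover have "g H \<le> 1" by (simp add: g_def)
          ultimately show ?thesis using \<eta>' by linarith
        qed (use b0 in linarith)
      qed (use p in auto)
      also have "\<dots> = \<eta> / 144 + (1 / (\<eta> - \<eta>')) * rsub (\<lambda>_. p / 2) Q bad"
        unfolding rsub_add rsub_cmult using Qf by simp
      also have "\<dots> \<le> \<eta> / 144 + (1 / (\<eta> - \<eta>')) * p"
        using bad \<eta>' by (intro add_left_mono mult_left_mono) auto
      also have "\<dots> = \<eta> / 144 + \<eta> / 288" using \<eta>' by (simp add: p_def)
      finally show False using g \<eta>' by simp
    qed
    then obtain H where H: "H \<subseteq> Q" "\<eta> / 144 \<le> g H" "bad H \<le> \<eta> - \<eta>'" by blast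
    have QH: "Q - H \<subseteq> Q" by auto
    note [measurable] = mref[OF H(1)] mref[OF QH]
    have "q \<inter> h = {}" if "q \<in> Q - H" "h \<in> H" for q h
      using that H(1) by (intro disjointD[OF Qf(3)]) auto
    then have "\<Union>(Q - H) = Y - \<Union>H" using Qf(4) by blast
    then have p1: "refinement Q' (Q - H) \<in> parts (Y - \<Union>H)" using refp[OF QH] by simp
    have "\<eta> \<le> prob {\<omega>\<in>space M. real K' \<le> energy Q' \<omega>}" by (rule QK)
    also have "\<dots> \<le> prob ({\<omega>\<in>space M. real K \<le> energy (refinement Q' (Q - H)) \<omega>}
        \<union> {\<omega>\<in>space M. real K' \<le> energy Q' \<omega> \<and> energy (refinement Q' Q) \<omega> < 2 * energy (refinement Q' H) \<omega>})"
    proof (rule finite_measure_mono)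
      show "{\<omega>\<in>space M. real K' \<le> energy Q' \<omega>} \<subseteq> {\<omega>\<in>space M. real K \<le> energy (refinement Q' (Q - H)) \<omega>}
        \<union> {\<omega>\<in>space M. real K' \<le> energy Q' \<omega> \<and> energy (refinement Q' Q) \<omega> < 2 * energy (refinement Q' H) \<omega>}"
      proof
        fix \<omega> assume \<omega>: "\<omega> \<in> {\<omega>\<in>space M. real K' \<le> energy Q' \<omega>}"
        have "energy (refinement Q' (Q - H)) \<omega> = energy (refinement Q' Q) \<omega> - energy (refinement Q' H) \<omega>"
          using H(1) Qf(1) by (simp add: energy_ref sum_diff)
        then have "real K \<le> energy (refinement Q' (Q - H)) \<omega>" if "\<not> energy (refinement Q' Q) \<omega> < 2 * energy (refinement Q' H) \<omega>"
          using that \<omega> Nge[of \<omega>] by auto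
        then show "\<omega> \<in> {\<omega>\<in>space M. real K \<le> energy (refinement Q' (Q - H)) \<omega>}
          \<union> {\<omega>\<in>space M. real K' \<le> energy Q' \<omega> \<and> energy (refinement Q' Q) \<omega> < 2 * energy (refinement Q' H) \<omega>}"
          using \<omega> by blast
      qed
    qed measurable
    also have "\<dots> \<le> prob {\<omega>\<in>space M. real K \<le> energy (refinement Q' (Q - H)) \<omega>} + bad H"
      unfolding bad_def by (intro measure_Un_le) measurable
    finally have "\<eta>' \<le> prob {\<omega>\<in>space M. real K \<le> energy (refinement Q' (Q - H)) \<omega>}" using H(3) by linarith
    then show ?thesis using H(1,2) p1 by (auto simp: C_def)
  qed
  \<comment> \<open>The \<open>H\<close> found so far depends on \<open>K\<close>. But
    \<open>C\<close> is finite and the condition weakens as \<open>K\<close> decreases, so one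
    \<open>H\<close> serves all \<open>K\<close>.\<close>
  have "\<exists>H\<in>C. \<forall>K::nat. \<exists>Q''\<in>parts (Y - \<Union>H). \<eta>' \<le> prob {\<omega>\<in>space M. real K \<le> energy Q'' \<omega>}"
  proof (rule ccontr)
    assume "\<not> ?thesis"
    then obtain k :: "_ \<Rightarrow> nat" where k: "\<And>H. H \<in> C \<Longrightarrow>
        \<not> (\<exists>Q''\<in>parts (Y - \<Union>H). \<eta>' \<le> prob {\<omega>\<in>space M. real (k H) \<le> energy Q'' \<omega>})"
      by metis
    obtain H Q'' where H: "H \<in> C" "Q'' \<in> parts (Y - \<Union>H)"
      "\<eta>' \<le> prob {\<omega>\<in>space M. real (Max (k ` C)) \<le> energy Q'' \<omega>}" using step by blast
    have "finite C" using Qf(1) by (simp add: C_def)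
    then have "k H \<le> Max (k ` C)" using H by simp
    then show False using heavy_antimono[OF H(2) _ H(3)] k H by blast
  qed
  then obtain H where H: "H \<in> C" "\<And>K::nat. \<exists>Q''\<in>parts (Y - \<Union>H). \<eta>' \<le> prob {\<omega>\<in>space M. real K \<le> energy Q'' \<omega>}"
    by blast
  have "\<Union>H \<in> AA" "\<Union>H \<subseteq> Y" "Y \<in> AA"
    using H(1) Qf hv by (auto simp: C_def heavy_def)
  then show ?thesis using H by (intro bexI[of _ "\<Union>H"]) (auto simp: heavy_def C_def g_def)
qed

text \<open>Splitting off large pieces over and over would contradict exhaustivity.\<close>

lemma not_heavy:
  assumes "\<eta> > 0"
  shows "\<not> heavy D \<eta>"
proof
  assume hv: "heavy D \<eta>"
  \<comment> \<open>Strictly decreasing, so that \<open>heavy_split\<close> applies at every stage,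
    but above \<open>\<eta> / 2\<close>, so that every piece split off exceeds 1 with probability at
    least \<open>\<eta> / 288\<close>.\<close>
  define e where "e n = \<eta> / 2 * (1 + (1/2)^n)" for n :: nat
  have e: "\<eta> / 2 < e n" "e (Suc n) < e n" "0 < e n" for n
    using assms by (auto simp: e_def add_pos_pos)
  have "\<exists>Y. \<forall>n. heavy (Y n) (e n) \<and> (Y (Suc n) \<subseteq> Y n \<and> Y n - Y (Suc n) \<in> AA
      \<and> \<eta> / 288 \<le> prob {\<omega>\<in>space M. \<bar>\<nu> (Y n - Y (Suc n)) \<omega>\<bar> > 1})"
  proof (rule dependent_nat_choice)
    show "\<exists>Y. heavy Y (e 0)" using hv by (auto simp: e_def)
    fix Y n assume "heavy Y (e n)"
    from heavy_split[OF this e(3,2)] obtain R where R: "R \<in> AA" "R \<subseteq> Y"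
      "e n / 144 \<le> prob {\<omega>\<in>space M. \<bar>\<nu> R \<omega>\<bar> > 1}" "heavy (Y - R) (e (Suc n))" by blast
    have "Y - (Y - R) = R" using R by auto
    moreover have "\<eta> / 288 \<le> e n / 144" using e(1)[of n] by simp
    ultimately show "\<exists>Y'. heavy Y' (e (Suc n)) \<and> (Y' \<subseteq> Y \<and> Y - Y' \<in> AA
      \<and> \<eta> / 288 \<le> prob {\<omega>\<in>space M. \<bar>\<nu> (Y - Y') \<omega>\<bar> > 1})"
      using R by (intro exI[of _ "Y - R"]) auto
  qed
  then obtain Y where Y: "\<And>n. Y (Suc n) \<subseteq> Y n" "\<And>n. Y n - Y (Suc n) \<in> AA"
    "\<And>n. \<eta> / 288 \<le> prob {\<omega>\<in>space M. \<bar>\<nu> (Y n - Y (Suc n)) \<omega>\<bar> > 1}" by blast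
  have anti: "Y n \<subseteq> Y m" if "m \<le> n" for m n using that Y(1) by (rule lift_Suc_antimono_le[rotated])
  have "disjoint_family (\<lambda>n. Y n - Y (Suc n))"
  proof -
    have "(Y m - Y (Suc m)) \<inter> (Y n - Y (Suc n)) = {}" if "m < n" for m n
      using anti[of "Suc m" n] that by auto
    then show ?thesis unfolding disjoint_family_on_def by (metis Int_commute linorder_neqE_nat)
  qed
  then have "(\<lambda>n. prob {\<omega>\<in>space M. \<bar>\<nu> (Y n - Y (Suc n)) \<omega>\<bar> > 1}) \<longlonglongrightarrow> 0"
    using Y(2) by (intro exhaustive) auto
  then have "\<eta> / 288 \<le> 0" using Y(3) by (intro LIMSEQ_le_const) auto
  then show False using assms by simp
qed

text \<open>Adding the complement of its union turns a disjoint family into a partition of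
  \<open>D\<close> and can only raise the energy.\<close>

lemma energy_bounded_in_prob:
  assumes "\<eta> > 0"
  shows "\<exists>L::nat. L > 0 \<and> (\<forall>Q. finite Q \<longrightarrow> Q \<subseteq> AA \<longrightarrow> disjoint Q \<longrightarrow> prob {\<omega>\<in>space M. L \<le> energy Q \<omega>} < \<eta>)"
proof -
  obtain L :: nat where L: "\<And>Q. Q \<in> parts D \<Longrightarrow> prob {\<omega>\<in>space M. L \<le> energy Q \<omega>} < \<eta>"
    using not_heavy[OF assms] unfolding heavy_def by (metis not_le top)
  have "prob {\<omega>\<in>space M. real (Suc L) \<le> energy Q \<omega>} < \<eta>" if Q: "finite Q" "Q \<subseteq> AA" "disjoint Q" for Q
  proof -
    define Q' where "Q' = insert (D - \<Union>Q) Q"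
    have "\<Union>Q \<subseteq> D" using Q(2) sets_into_space by blast
    then have "Q' \<in> parts D"
      using Q unfolding parts_def Q'_def by (auto simp: disjoint_def)
    moreover have [measurable]: "energy Q \<in> borel_measurable M" using Q by measurable
    moreover note [measurable] = energy_measurable[OF partsD(2)[OF calculation(1)]]
    moreover have "{\<omega>\<in>space M. real (Suc L) \<le> energy Q \<omega>} \<subseteq> {\<omega>\<in>space M. real L \<le> energy Q' \<omega>}"
    proof safe
      fix \<omega> assume "real (Suc L) \<le> energy Q \<omega>"
      moreover have "energy Q \<omega> \<le> energy Q' \<omega>"
        unfolding energy_def Q'_def using Q by (intro sum_mono2) auto
      ultimately show "real L \<le> energy Q' \<omega>" by simp
    qed
    ultimately have "prob {\<omega>\<in>space M. real (Suc L) \<le> energy Q \<omega>} \<le> prob {\<omega>\<in>space M. real L \<le> energy Q' \<omega>}"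
      by (intro finite_measure_mono) auto
    then show ?thesis using L[OF \<open>Q' \<in> parts D\<close>] by linarith
  qed
  then show ?thesis by (intro exI[of _ "Suc L"]) auto
qed

section \<open>Boundedness in probability of the values of the set function\<close>

lemma nu_family:
  assumes "finite Q" "Q \<subseteq> AA" "disjoint Q" "H \<subseteq> Q"
  shows "\<nu> (\<Union>H) \<omega> = (\<Sum>q\<in>H. \<nu> q \<omega>)" "\<Union>H \<in> AA"
  using assms pairwise_subset[OF assms(3,4)]
  by (auto intro!: nu_Union finite_Union intro: finite_subset)

lemma common_atoms:
  assumes "finite F" "F \<subseteq> AA"
  shows "\<exists>Q\<in>parts D. \<forall>A\<in>F. \<forall>q\<in>Q. q \<subseteq> A \<or> q \<inter> A = {}"
  using assms
proof (induction F rule: finite_induct)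
  case empty
  have "{D} \<in> parts D" by (auto simp: parts_def disjoint_def)
  then show ?case by blast
next
  case (insert A F)
  then obtain Q where Q: "Q \<in> parts D" "\<forall>A\<in>F. \<forall>q\<in>Q. q \<subseteq> A \<or> q \<inter> A = {}" by auto
  have A: "A \<in> AA" "A \<subseteq> D" using insert.prems sets_into_space by auto
  have 1: "refinement Q {A, D - A} \<in> parts (\<Union>{A, D - A})"
    using A by (intro refinement_parts[OF Q(1)]) (auto simp: disjoint_def)
  have 2: "\<Union>{A, D - A} = D" using A by auto
  have "q \<subseteq> B \<or> q \<inter> B = {}" if q: "q \<in> refinement Q {A, D - A}" and B: "B \<in> insert A F" for q B
  proof -
    obtain p r where "q = p \<inter> r" "p \<in> Q" "r = A \<or> r = D - A" using q by (auto simp: refinement_def)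
    moreover from this have "p \<subseteq> B \<or> p \<inter> B = {}" if "B \<in> F" using that Q(2) by simp
    ultimately show ?thesis using B by blast
  qed
  then show ?case using 1 unfolding 2 by (intro bexI[of _ "refinement Q {A, D - A}"]) simp_all
qed

lemma parts_atoms:
  assumes Q: "Q \<in> parts D" and A: "A \<in> AA" "\<And>q. q \<in> Q \<Longrightarrow> q \<subseteq> A \<or> q \<inter> A = {}"
  shows "\<nu> A \<omega> = (\<Sum>q\<in>{q\<in>Q. q \<subseteq> A}. \<nu> q \<omega>)"
proof -
  have "A \<subseteq> \<Union>Q" using partsD(4)[OF Q] sets_into_space[OF A(1)] by simp
  then have "A = \<Union>{q\<in>Q. q \<subseteq> A}" using A(2) by blast
  moreover have "\<nu> (\<Union>{q\<in>Q. q \<subseteq> A}) \<omega> = (\<Sum>q\<in>{q\<in>Q. q \<subseteq> A}. \<nu> q \<omega>)"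
    using partsD[OF Q] by (intro nu_family(1)) auto
  ultimately show ?thesis by simp
qed

definition colour_classes :: "nat \<Rightarrow> 'x set set \<Rightarrow> ('x set \<Rightarrow> nat) \<Rightarrow> 'x set set" where
  "colour_classes m Q c = (\<lambda>j. \<Union>{q\<in>Q. c q = j}) ` {..<m}"

lemma colour_classes:
  assumes "finite Q" "Q \<subseteq> AA" "disjoint Q"
  shows "finite (colour_classes m Q c)" "colour_classes m Q c \<subseteq> AA" "disjoint (colour_classes m Q c)"
    "energy (colour_classes m Q c) \<omega> = (\<Sum>j<m. min 1 ((\<Sum>q\<in>{q\<in>Q. c q = j}. \<nu> q \<omega>)\<^sup>2))"
proof -
  have dis: "\<Union>{q\<in>Q. c q = i} \<inter> \<Union>{q\<in>Q. c q = j} = {}" if "i \<noteq> j" for i j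
  proof -
    have "p \<inter> q = {}" if "p \<in> Q" "q \<in> Q" "c p = i" "c q = j" for p q
      using that \<open>i \<noteq> j\<close> by (intro disjointD[OF assms(3)]) auto
    then show ?thesis by blast
  qed
  show "finite (colour_classes m Q c)" by (simp add: colour_classes_def)
  show "colour_classes m Q c \<subseteq> AA"
    using nu_family(2)[OF assms] by (auto simp: colour_classes_def)
  show "disjoint (colour_classes m Q c)"
    unfolding colour_classes_def using dis by (intro disjointI) auto
  have "energy (colour_classes m Q c) \<omega> = (\<Sum>j<m. min 1 ((\<nu> (\<Union>{q\<in>Q. c q = j}) \<omega>)\<^sup>2))"
    unfolding energy_def colour_classes_def
  proof (subst sum.reindex_nontrivial)
    fix i j assume "i \<noteq> j" "\<Union>{q\<in>Q. c q = i} = \<Union>{q\<in>Q. c q = j}"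
    then have "\<Union>{q\<in>Q. c q = i} = {}" using dis[of i j] by (metis (lifting) Int_absorb)
    then show "min 1 ((\<nu> (\<Union>{q\<in>Q. c q = i}) \<omega>)\<^sup>2) = 0" by (simp only:) simp
  qed auto
  also have "\<dots> = (\<Sum>j<m. min 1 ((\<Sum>q\<in>{q\<in>Q. c q = j}. \<nu> q \<omega>)\<^sup>2))"
    using nu_family(1)[OF assms] by (intro sum.cong) auto
  finally show "energy (colour_classes m Q c) \<omega> = (\<Sum>j<m. min 1 ((\<Sum>q\<in>{q\<in>Q. c q = j}. \<nu> q \<omega>)\<^sup>2))" .
qed

lemma card_heavy_atoms:
  assumes "finite Q"
  shows "card {q\<in>Q. \<bar>\<nu> q \<omega>\<bar> > 1} \<le> energy Q \<omega>"
proof -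
  have "card {q\<in>Q. \<bar>\<nu> q \<omega>\<bar> > 1} = (\<Sum>q\<in>{q\<in>Q. \<bar>\<nu> q \<omega>\<bar> > 1}. min 1 ((\<nu> q \<omega>)\<^sup>2))"
  proof -
    have "min 1 ((\<nu> q \<omega>)\<^sup>2) = 1" if "\<bar>\<nu> q \<omega>\<bar> > 1" for q
      using that abs_square_le_1[of "\<nu> q \<omega>"] by linarith
    then show ?thesis by simp
  qed
  also have "\<dots> \<le> energy Q \<omega>" unfolding energy_def using assms by (intro sum_mono2) auto
  finally show ?thesis .
qed

text \<open>If the light atoms have a huge total but bounded square sum, a random colouring spreads the
  total evenly, and few colours are spoilt by the heavy atoms.\<close>

lemma random_colouring_large:
  fixes L :: nat
  assumes Q: "finite Q" "Q \<subseteq> AA" "disjoint Q" and L: "L > 0" "energy Q \<omega> < L"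
    and s: "8 * L < \<bar>\<Sum>q\<in>{q\<in>Q. \<bar>\<nu> q \<omega>\<bar> \<le> 1}. \<nu> q \<omega>\<bar>"
  shows "1/2 \<le> rcol (4 * L) Q (\<lambda>c. of_bool (L \<le> energy (colour_classes (4 * L) Q c) \<omega>))"
proof -
  define x where "x q = (if \<bar>\<nu> q \<omega>\<bar> \<le> 1 then \<nu> q \<omega> else 0)" for q
  \<comment> \<open>With 4 L colours the fair share of the light total exceeds 2 in absolute value.
    Fewer than \<open>L\<close> heavy atoms spoil fewer than \<open>L\<close> colours, so at least 3
    L remain. If the energy stayed below \<open>L\<close>, at least 2 L of these would miss the fair
    share by 1 or more, so \<open>V c\<close> would be at least 2 L, while its mean is at most
    \<open>L\<close>.\<close>
  define m where "m = 4 * L"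
  define s' where "s' = (\<Sum>q\<in>Q. x q)"
  define X where "X c j = (\<Sum>q\<in>{q\<in>Q. c q = j}. x q)" for c and j :: nat
  define V where "V c = (\<Sum>j<m. (X c j - s' / m)\<^sup>2)" for c
  have s': "8 * L < \<bar>s'\<bar>"
    using s Q(1) unfolding s'_def x_def by (simp add: sum.If_cases Int_def)
  have "(\<Sum>q\<in>Q. (x q)\<^sup>2) \<le> energy Q \<omega>"
    unfolding energy_def x_def by (intro sum_mono) (auto simp: abs_square_le_1)
  then have V: "rcol m Q V \<le> L"
    using rcol_variance[OF Q(1), of m x] L unfolding V_def X_def s'_def m_def by auto
  define F where "F = {q\<in>Q. \<bar>\<nu> q \<omega>\<bar> > 1}"
  have F: "finite F" "card F < L" using card_heavy_atoms[OF Q(1), of \<omega>] L Q(1) by (auto simp: F_def)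
  have pt: "1 - (1 / (2 * L)) * V c \<le> of_bool (L \<le> energy (colour_classes m Q c) \<omega>)" for c
  proof (cases "L \<le> energy (colour_classes m Q c) \<omega>")
    case False
    define G where "G = {..<m} - c ` F"
    define B where "B = {j\<in>G. 1 \<le> (X c j - s' / m)\<^sup>2}"
    have fin: "finite G" "finite B" by (auto simp: G_def B_def)
    have G: "3 * L \<le> card G"
    proof -
      have "m - card (c ` F) \<le> card G" unfolding G_def using F by (metis card_lessThan diff_card_le_card_Diff finite_imageI)
      moreover have "card (c ` F) < L" using F card_image_le[of F c] by linarith
      ultimately show ?thesis by (simp add: m_def)
    qed
    have good: "min 1 ((\<Sum>q\<in>{q\<in>Q. c q = j}. \<nu> q \<omega>)\<^sup>2) = 1" if j: "j \<in> G - B" for j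
    proof -
      have "(\<Sum>q\<in>{q\<in>Q. c q = j}. \<nu> q \<omega>) = X c j"
        unfolding X_def x_def using j by (intro sum.cong) (auto simp: G_def F_def not_le)
      moreover have "\<bar>X c j - s' / m\<bar> < 1"
        using j by (simp add: B_def not_le abs_square_less_1)
      moreover have "2 < \<bar>s' / m\<bar>" using s' L by (simp add: m_def field_simps)
      ultimately have "1 < \<bar>\<Sum>q\<in>{q\<in>Q. c q = j}. \<nu> q \<omega>\<bar>" by linarith
      then show ?thesis using abs_square_le_1[of "\<Sum>q\<in>{q\<in>Q. c q = j}. \<nu> q \<omega>"] by linarith
    qed
    have "card (G - B) = (\<Sum>j\<in>G - B. min 1 ((\<Sum>q\<in>{q\<in>Q. c q = j}. \<nu> q \<omega>)\<^sup>2))"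
      using good by simp
    also have "\<dots> \<le> energy (colour_classes m Q c) \<omega>"
      unfolding colour_classes(4)[OF Q] by (intro sum_mono2) (auto simp: G_def)
    finally have "card (G - B) < L" using False by simp
    moreover have "card G = card (G - B) + card B"
    proof -
      have "B \<subseteq> G" by (auto simp: B_def)
      then show ?thesis using fin by (metis card_Diff_subset card_mono le_add_diff_inverse2)
    qed
    ultimately have "2 * L \<le> card B" using G by linarith
    also have "real (card B) = (\<Sum>j\<in>B. 1)" by simp
    also have "\<dots> \<le> (\<Sum>j\<in>B. (X c j - s' / m)\<^sup>2)" by (intro sum_mono) (auto simp: B_def)
    also have "\<dots> \<le> V c" unfolding V_def by (intro sum_mono2) (auto simp: B_def G_def)
    finally show ?thesis using False L by (simp add: field_simps)
  next
    case True
    have "0 \<le> V c" unfolding V_def by (intro sum_nonneg) auto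
    then show ?thesis using True L by simp
  qed
  have "1/2 \<le> 1 + (- (1 / (2 * L))) * rcol m Q V" using V L by (simp add: field_simps)
  also have "\<dots> = rcol m Q (\<lambda>c. 1 + (- (1 / (2 * L))) * V c)"
    using Q(1) L by (simp only: rcol_add rcol_cmult) (simp add: m_def)
  also have "\<dots> \<le> rcol m Q (\<lambda>c. of_bool (L \<le> energy (colour_classes m Q c) \<omega>))"
    using pt by (intro rcol_mono) auto
  finally show ?thesis by (simp add: m_def)
qed

lemma tight:
  assumes "A \<in> AA" "\<eta> > 0"
  shows "\<exists>T. prob {\<omega>\<in>space M. \<bar>\<nu> A \<omega>\<bar> > T} \<le> \<eta>"
proof -
  note [measurable] = nu_meas[OF assms(1)]
  have "(\<lambda>n. prob {\<omega>\<in>space M. \<bar>\<nu> A \<omega>\<bar> > real n}) \<longlonglongrightarrow> prob (\<Inter>n. {\<omega>\<in>space M. \<bar>\<nu> A \<omega>\<bar> > real n})"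
    by (intro finite_Lim_measure_decseq) (auto simp: decseq_def)
  also have "(\<Inter>n. {\<omega>\<in>space M. \<bar>\<nu> A \<omega>\<bar> > real n}) = {}"
  proof -
    have "\<exists>n. \<not> \<bar>\<nu> A \<omega>\<bar> > real n" for \<omega> using real_arch_simple[of "\<bar>\<nu> A \<omega>\<bar>"] by (auto simp: not_less)
    then show ?thesis by blast
  qed
  finally have "eventually (\<lambda>n. prob {\<omega>\<in>space M. \<bar>\<nu> A \<omega>\<bar> > real n} < \<eta>) sequentially"
    using assms(2) by (intro order_tendstoD(2)) auto
  then obtain n :: nat where "prob {\<omega>\<in>space M. \<bar>\<nu> A \<omega>\<bar> > real n} < \<eta>"
    by (auto simp: eventually_sequentially)
  then show ?thesis by (intro exI[of _ "real n"]) simp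
qed

text \<open>A subset sum over fewer than L heavy atoms takes at most 2 to the L values, so of many sets
  with well separated values most have large light parts.\<close>

lemma card_light_values:
  fixes L K :: nat and A :: "nat \<Rightarrow> 'x set" and T :: "nat \<Rightarrow> real"
  assumes Q: "Q \<in> parts D" and A: "\<And>i. i < K \<Longrightarrow> A i \<in> AA"
      "\<And>i q. i < K \<Longrightarrow> q \<in> Q \<Longrightarrow> q \<subseteq> A i \<or> q \<inter> A i = {}"
    and T: "mono T" and energy: "energy Q \<omega> < L"
  shows "card {i\<in>{..<K}. T i < \<bar>\<nu> (A i) \<omega>\<bar> \<and> \<bar>\<nu> (A i) \<omega>\<bar> \<le> T (Suc i) - 16 * L
    \<and> \<bar>\<Sum>q\<in>{q\<in>{q\<in>Q. q \<subseteq> A i}. \<bar>\<nu> q \<omega>\<bar> \<le> 1}. \<nu> q \<omega>\<bar> \<le> 8 * L} \<le> 2 ^ L"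
    (is "card ?J \<le> _")
proof -
  define F where "F = {q\<in>Q. \<bar>\<nu> q \<omega>\<bar> > 1}"
  define s where "s i = (\<Sum>q\<in>{q\<in>{q\<in>Q. q \<subseteq> A i}. \<bar>\<nu> q \<omega>\<bar> \<le> 1}. \<nu> q \<omega>)" for i
  note Qf = partsD[OF Q]
  have F: "finite F" "card F < L"
    using card_heavy_atoms[OF Qf(1), of \<omega>] energy Qf(1) by (auto simp: F_def)
  have split: "\<nu> (A i) \<omega> = (\<Sum>q\<in>{q\<in>F. q \<subseteq> A i}. \<nu> q \<omega>) + s i" if "i < K" for i
  proof -
    have "\<nu> (A i) \<omega> = (\<Sum>q\<in>{q\<in>Q. q \<subseteq> A i}. \<nu> q \<omega>)"
      by (rule parts_atoms[OF Q A(1)[OF that] A(2)[OF that]])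
    also have "\<dots> = (\<Sum>q\<in>{q\<in>F. q \<subseteq> A i} \<union> {q\<in>{q\<in>Q. q \<subseteq> A i}. \<bar>\<nu> q \<omega>\<bar> \<le> 1}. \<nu> q \<omega>)"
      by (intro sum.cong) (auto simp: F_def)
    also have "\<dots> = (\<Sum>q\<in>{q\<in>F. q \<subseteq> A i}. \<nu> q \<omega>) + s i"
      unfolding s_def using Qf(1) F by (intro sum.union_disjoint) (auto simp: F_def)
    finally show ?thesis .
  qed
  \<comment> \<open>With equal heavy parts the two values differ by at most 16 L. But the absolute
    value at \<open>i\<close> is at least 16 L below \<open>T (Suc i)\<close>, hence below
    \<open>T j\<close>, which the absolute value at \<open>j\<close> exceeds.\<close>
  have less: False if ij: "i \<in> ?J" "j \<in> ?J" "i < j" "{q\<in>F. q \<subseteq> A i} = {q\<in>F. q \<subseteq> A j}" for i j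
  proof -
    have "\<nu> (A j) \<omega> = \<nu> (A i) \<omega> - s i + s j" using split[of i] split[of j] ij by simp
    moreover have "\<bar>s i\<bar> \<le> 8 * L" "\<bar>s j\<bar> \<le> 8 * L" using ij(1,2) by (auto simp: s_def)
    moreover have "T (Suc i) \<le> T j" using T ij(3) by (intro monoD[OF T]) auto
    moreover have "\<bar>\<nu> (A i) \<omega>\<bar> \<le> T (Suc i) - 16 * L" "T j < \<bar>\<nu> (A j) \<omega>\<bar>" using ij(1,2) by auto
    ultimately show False by linarith
  qed
  have "inj_on (\<lambda>i. {q\<in>F. q \<subseteq> A i}) ?J"
    using less by (intro inj_onI) (metis (lifting) linorder_neqE_nat)
  then have "card ?J \<le> card (Pow F)"
    using F by (intro card_inj_on_le[of "\<lambda>i. {q\<in>F. q \<subseteq> A i}"]) auto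
  also have "\<dots> \<le> 2 ^ L" using F by (simp add: card_Pow power_increasing)
  finally show ?thesis .
qed

text \<open>If this failed, there would be sets whose values lie in higher and higher, well
  separated windows. In a common partition of bounded energy the heavy atoms account for only
  \<open>2 ^ L\<close> of the windows. So some set has a large light part with a fixed probability,
  and a random colouring of it has energy at least \<open>L\<close> too often.\<close>

lemma range_bounded_in_prob:
  assumes \<eta>: "\<eta> > 0"
  shows "\<exists>T. \<forall>A\<in>AA. prob {\<omega>\<in>space M. \<bar>\<nu> A \<omega>\<bar> > T} \<le> \<eta>"
proof (rule ccontr)
  assume "\<not> ?thesis"
  then have unb: "\<exists>A\<in>AA. \<eta> < prob {\<omega>\<in>space M. \<bar>\<nu> A \<omega>\<bar> > T}" for T by (meson not_le)
  obtain L :: nat where L: "L > 0"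
    "\<And>Q. finite Q \<Longrightarrow> Q \<subseteq> AA \<Longrightarrow> disjoint Q \<Longrightarrow> prob {\<omega>\<in>space M. L \<le> energy Q \<omega>} < \<eta> / 16"
    using energy_bounded_in_prob[of "\<eta> / 16"] \<eta> by auto
  \<comment> \<open>\<open>3 * \<eta> / 16\<close> is what remains of the probability
    \<open>\<eta> / 2\<close> of a window after subtracting \<open>\<eta> / 4\<close> for a large
    light part and \<open>\<eta> / 16\<close> for a large energy.\<close>
  obtain K :: nat where K: "2 ^ L * 16 / (3 * \<eta>) < K" using reals_Archimedean2 by blast
  have "\<exists>f. \<forall>n. (fst (f n) \<in> AA \<and> \<eta> < prob {\<omega>\<in>space M. \<bar>\<nu> (fst (f n)) \<omega>\<bar> > snd (f n)})
    \<and> (snd (f n) \<le> snd (f (Suc n)) \<and>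
      prob {\<omega>\<in>space M. \<bar>\<nu> (fst (f n)) \<omega>\<bar> > snd (f (Suc n)) - 16 * L} \<le> \<eta> / 2)"
  proof (rule dependent_nat_choice)
    show "\<exists>x. fst x \<in> AA \<and> \<eta> < prob {\<omega>\<in>space M. \<bar>\<nu> (fst x) \<omega>\<bar> > snd x}"
    proof -
      obtain A where "A \<in> AA" "\<eta> < prob {\<omega>\<in>space M. \<bar>\<nu> A \<omega>\<bar> > 0}" using unb by blast
      then show ?thesis by (intro exI[of _ "(A, 0)"]) simp
    qed
    fix x :: "'x set \<times> real" and n :: nat
    assume x: "fst x \<in> AA \<and> \<eta> < prob {\<omega>\<in>space M. \<bar>\<nu> (fst x) \<omega>\<bar> > snd x}"
    note [measurable] = nu_meas[OF conjunct1[OF x]]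
    obtain T where T: "prob {\<omega>\<in>space M. \<bar>\<nu> (fst x) \<omega>\<bar> > T} \<le> \<eta> / 2"
      using tight[of "fst x" "\<eta> / 2"] x \<eta> by auto
    \<comment> \<open>The gap 16 L between windows is twice the bound 8 L on the light parts, as
      \<open>card_light_values\<close> requires.\<close>
    define T' where "T' = max (snd x) (T + 16 * L)"
    have "prob {\<omega>\<in>space M. \<bar>\<nu> (fst x) \<omega>\<bar> > T' - 16 * L} \<le> prob {\<omega>\<in>space M. \<bar>\<nu> (fst x) \<omega>\<bar> > T}"
      by (intro finite_measure_mono) (auto simp: T'_def)
    moreover obtain A where "A \<in> AA" "\<eta> < prob {\<omega>\<in>space M. \<bar>\<nu> A \<omega>\<bar> > T'}" using unb by blast
    ultimately show "\<exists>y. (fst y \<in> AA \<and> \<eta> < prob {\<omega>\<in>space M. \<bar>\<nu> (fst y) \<omega>\<bar> > snd y}) \<and>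
       (snd x \<le> snd y \<and> prob {\<omega>\<in>space M. \<bar>\<nu> (fst x) \<omega>\<bar> > snd y - 16 * L} \<le> \<eta> / 2)"
      using T by (intro exI[of _ "(A, T')"]) (auto simp: T'_def)
  qed
  then obtain f where f: "\<And>n. fst (f n) \<in> AA" "\<And>n. \<eta> < prob {\<omega>\<in>space M. \<bar>\<nu> (fst (f n)) \<omega>\<bar> > snd (f n)}"
    "\<And>n. snd (f n) \<le> snd (f (Suc n))"
    "\<And>n. prob {\<omega>\<in>space M. \<bar>\<nu> (fst (f n)) \<omega>\<bar> > snd (f (Suc n)) - 16 * L} \<le> \<eta> / 2" by blast
  define A where "A n = fst (f n)" for n
  define T where "T n = snd (f n)" for n
  have A [measurable]: "A n \<in> AA" for n using f(1) by (simp add: A_def)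
  have T: "mono T" using f(3) by (intro incseq_SucI) (simp add: T_def)
  obtain Q where Q: "Q \<in> parts D" "\<forall>B\<in>A ` {..<K}. \<forall>q\<in>Q. q \<subseteq> B \<or> q \<inter> B = {}"
  proof -
    have "A ` {..<K} \<subseteq> AA" using A by blast
    from common_atoms[OF finite_imageI[OF finite_lessThan] this] show ?thesis using that by blast
  qed
  note Qf = partsD[OF Q(1)]
  note [measurable] = nu_meas[OF A] energy_measurable[OF Qf(2)]
  have nuq [measurable]: "\<nu> q \<in> borel_measurable M" if "q \<in> Q" for q using that Qf(2) by (intro nu_meas) auto
  define act where "act i \<omega> \<longleftrightarrow> T i < \<bar>\<nu> (A i) \<omega>\<bar> \<and> \<bar>\<nu> (A i) \<omega>\<bar> \<le> T (Suc i) - 16 * L" for i \<omega>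
  define s where "s i \<omega> = (\<Sum>q\<in>{q\<in>{q\<in>Q. q \<subseteq> A i}. \<bar>\<nu> q \<omega>\<bar> \<le> 1}. \<nu> q \<omega>)" for i \<omega>
  have s_alt: "s i = (\<lambda>\<omega>. \<Sum>q\<in>{q\<in>Q. q \<subseteq> A i}. if \<bar>\<nu> q \<omega>\<bar> \<le> 1 then \<nu> q \<omega> else 0)" for i
    unfolding s_def using Qf(1) by (intro ext sum.inter_filter) auto
  have [measurable]: "s i \<in> borel_measurable M" for i
    unfolding s_alt by (intro borel_measurable_sum measurable_If) (use nuq in auto)
  have [measurable]: "Measurable.pred M (act i)" for i unfolding act_def by measurable
  have pact: "\<eta> / 2 \<le> prob {\<omega>\<in>space M. act i \<omega>}" for i
  proof -
    have "\<eta> < prob {\<omega>\<in>space M. \<bar>\<nu> (A i) \<omega>\<bar> > T i}" using f(2) by (simp add: A_def T_def)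
    also have "\<dots> \<le> prob ({\<omega>\<in>space M. act i \<omega>} \<union> {\<omega>\<in>space M. \<bar>\<nu> (A i) \<omega>\<bar> > T (Suc i) - 16 * L})"
      by (intro finite_measure_mono) (auto simp: act_def)
    also have "\<dots> \<le> prob {\<omega>\<in>space M. act i \<omega>} + prob {\<omega>\<in>space M. \<bar>\<nu> (A i) \<omega>\<bar> > T (Suc i) - 16 * L}"
      by (intro measure_Un_le) auto
    also have "prob {\<omega>\<in>space M. \<bar>\<nu> (A i) \<omega>\<bar> > T (Suc i) - 16 * L} \<le> \<eta> / 2"
      using f(4) by (simp add: A_def T_def)
    finally show ?thesis by simp
  qed
  define g where "g i = prob {\<omega>\<in>space M. act i \<omega> \<and> 8 * L < \<bar>s i \<omega>\<bar> \<and> energy Q \<omega> < L}" for i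
  have "\<exists>i<K. \<eta> / 4 \<le> g i"
  proof (rule ccontr)
    assume "\<not> ?thesis"
    then have small: "g i < \<eta> / 4" if "i < K" for i using that by (meson not_le)
    have "(\<Sum>i<K. 1 * prob {\<omega>\<in>space M. act i \<omega> \<and> \<bar>s i \<omega>\<bar> \<le> 8 * L \<and> energy Q \<omega> < L}) \<le> 2 ^ L"
    proof (rule weighted_prob_le)
      fix \<omega>
      show "(\<Sum>i<K. 1 * of_bool (act i \<omega> \<and> \<bar>s i \<omega>\<bar> \<le> 8 * L \<and> energy Q \<omega> < L)) \<le> (2 ^ L :: real)"
      proof (cases "energy Q \<omega> < L")
        case True
        have "(\<Sum>i<K. 1 * of_bool (act i \<omega> \<and> \<bar>s i \<omega>\<bar> \<le> 8 * L \<and> energy Q \<omega> < L))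
            = real (card {i\<in>{..<K}. act i \<omega> \<and> \<bar>s i \<omega>\<bar> \<le> 8 * L})"
          using True by (simp add: Int_def)
        also have "\<dots> \<le> real (2 ^ L)"
          unfolding act_def s_def of_nat_le_iff conj_assoc
          using card_light_values[OF Q(1) _ _ T True, of K A] A Q(2) by simp
        finally show ?thesis by simp
      qed simp
    qed auto
    moreover have "\<eta> / 2 - \<eta> / 4 - \<eta> / 16 \<le> prob {\<omega>\<in>space M. act i \<omega> \<and> \<bar>s i \<omega>\<bar> \<le> 8 * L \<and> energy Q \<omega> < L}"
      if i: "i < K" for i
    proof -
      let ?G = "{\<omega>\<in>space M. act i \<omega> \<and> 8 * L < \<bar>s i \<omega>\<bar> \<and> energy Q \<omega> < L}"
      let ?P = "{\<omega>\<in>space M. act i \<omega> \<and> \<bar>s i \<omega>\<bar> \<le> 8 * L \<and> energy Q \<omega> < L}"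
      let ?B = "{\<omega>\<in>space M. L \<le> energy Q \<omega>}"
      have "\<eta> / 2 \<le> prob {\<omega>\<in>space M. act i \<omega>}" by (rule pact)
      also have "\<dots> \<le> prob (?P \<union> (?G \<union> ?B))" by (intro finite_measure_mono) auto
      also have "\<dots> \<le> prob ?P + prob (?G \<union> ?B)" by (intro measure_Un_le) auto
      also have "prob (?G \<union> ?B) \<le> prob ?G + prob ?B" by (intro measure_Un_le) auto
      finally show ?thesis using small[OF i] L(2)[OF Qf(1-3)] by (simp add: g_def)
    qed
    then have "(\<Sum>i<K. \<eta> / 2 - \<eta> / 4 - \<eta> / 16)
        \<le> (\<Sum>i<K. 1 * prob {\<omega>\<in>space M. act i \<omega> \<and> \<bar>s i \<omega>\<bar> \<le> 8 * L \<and> energy Q \<omega> < L})"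
      by (intro sum_mono) auto
    ultimately have "K * (3 * \<eta> / 16) \<le> 2 ^ L" by (simp add: field_simps)
    then show False using K \<eta> by (simp add: field_simps)
  qed
  then obtain i where i: "i < K" "\<eta> / 4 \<le> g i" by blast
  define R where "R = {q\<in>Q. q \<subseteq> A i}"
  have R: "finite R" "R \<subseteq> AA" "disjoint R"
    using Qf pairwise_subset[OF Qf(3), of R] by (auto simp: R_def)
  have "1/2 * g i \<le> rcol (4 * L) R (\<lambda>c. prob {\<omega>\<in>space M. L \<le> energy (colour_classes (4 * L) R c) \<omega>})"
    unfolding g_def
  proof (rule rcol_prob_ge[OF R(1)])
    fix c
    note [measurable] = energy_measurable[OF colour_classes(2)[OF R, of "4 * L" c]]
    show "{\<omega>\<in>space M. L \<le> energy (colour_classes (4 * L) R c) \<omega>} \<in> events" by measurable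
  next
    show "{\<omega>\<in>space M. act i \<omega> \<and> 8 * L < \<bar>s i \<omega>\<bar> \<and> energy Q \<omega> < L} \<in> events" by measurable
  next
    fix \<omega> assume \<omega>: "\<omega> \<in> {\<omega>\<in>space M. act i \<omega> \<and> 8 * L < \<bar>s i \<omega>\<bar> \<and> energy Q \<omega> < L}"
    have "energy R \<omega> \<le> energy Q \<omega>" unfolding energy_def R_def using Qf(1) by (intro sum_mono2) auto
    then show "1/2 \<le> rcol (4 * L) R (\<lambda>c. of_bool (L \<le> energy (colour_classes (4 * L) R c) \<omega>))"
      using \<omega> by (intro random_colouring_large[OF R L(1)]) (auto simp: s_def R_def)
  qed
  also have "\<dots> \<le> rcol (4 * L) R (\<lambda>_. \<eta> / 16)"
    using L(2)[OF colour_classes(1-3)[OF R]] by (intro rcol_mono) (auto intro: less_imp_le)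
  also have "\<dots> = \<eta> / 16" using R L(1) by simp
  finally show False using i \<eta> by simp
qed

section \<open>Square sums, integrals and square functions\<close>

text \<open>Paley--Zygmund read backwards: where the square sum exceeds 8 T0^2, a random union
  exceeds \<open>T0\<close> in absolute value with chance at least 1/36, whereas each fixed union
  does so with probability at most \<open>\<eta> / 36\<close>.\<close>

lemma sum_squares_bounded_in_prob:
  assumes \<eta>: "\<eta> > 0"
  shows "\<exists>T>0. \<forall>Q. finite Q \<longrightarrow> Q \<subseteq> AA \<longrightarrow> disjoint Q \<longrightarrow>
    prob {\<omega>\<in>space M. (\<Sum>q\<in>Q. (\<nu> q \<omega>)\<^sup>2) > T} \<le> \<eta>"
proof -
  obtain T0 where T0: "\<And>A. A \<in> AA \<Longrightarrow> prob {\<omega>\<in>space M. \<bar>\<nu> A \<omega>\<bar> > T0} \<le> \<eta> / 36"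
    using range_bounded_in_prob[of "\<eta> / 36"] \<eta> by auto
  have "prob {\<omega>\<in>space M. (\<Sum>q\<in>Q. (\<nu> q \<omega>)\<^sup>2) > 8 * T0\<^sup>2 + 1} \<le> \<eta>"
    if Q: "finite Q" "Q \<subseteq> AA" "disjoint Q" for Q
  proof -
    have nuq [measurable]: "\<nu> q \<in> borel_measurable M" if "q \<in> Q" for q using that Q(2) by (intro nu_meas) auto
    have "1/36 * prob {\<omega>\<in>space M. (\<Sum>q\<in>Q. (\<nu> q \<omega>)\<^sup>2) > 8 * T0\<^sup>2 + 1}
      \<le> rsub (\<lambda>_. 1/2) Q (\<lambda>H. prob {\<omega>\<in>space M. \<bar>\<nu> (\<Union>H) \<omega>\<bar> > T0})"
    proof (rule rsub_prob_ge[OF Q(1)])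
      fix H assume "H \<subseteq> Q"
      note [measurable] = nu_meas[OF nu_family(2)[OF Q this]]
      show "{\<omega>\<in>space M. \<bar>\<nu> (\<Union>H) \<omega>\<bar> > T0} \<in> events" by measurable
    next
      show "{\<omega>\<in>space M. (\<Sum>q\<in>Q. (\<nu> q \<omega>)\<^sup>2) > 8 * T0\<^sup>2 + 1} \<in> events" by measurable
    next
      fix \<omega> assume \<omega>: "\<omega> \<in> {\<omega>\<in>space M. (\<Sum>q\<in>Q. (\<nu> q \<omega>)\<^sup>2) > 8 * T0\<^sup>2 + 1}"
      have "1/36 \<le> rsub (\<lambda>_. 1/2) Q (\<lambda>H. of_bool ((\<Sum>q\<in>H. \<nu> q \<omega>)\<^sup>2 \<ge> (\<Sum>q\<in>Q. (\<nu> q \<omega>)\<^sup>2) / 8))"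
        by (rule rsub_Paley_Zygmund[OF Q(1)])
      also have "\<dots> \<le> rsub (\<lambda>_. 1/2) Q (\<lambda>H. of_bool (\<bar>\<nu> (\<Union>H) \<omega>\<bar> > T0))"
      proof (rule rsub_mono)
        fix H assume H: "H \<subseteq> Q"
        have "T0 < \<bar>\<nu> (\<Union>H) \<omega>\<bar>" if "(\<Sum>q\<in>H. \<nu> q \<omega>)\<^sup>2 \<ge> (\<Sum>q\<in>Q. (\<nu> q \<omega>)\<^sup>2) / 8"
        proof -
          have "T0\<^sup>2 < \<bar>\<nu> (\<Union>H) \<omega>\<bar>\<^sup>2" using that \<omega> nu_family(1)[OF Q H, of \<omega>] by simp
          then show ?thesis by (rule power_less_imp_less_base) simp
        qed
        then show "of_bool ((\<Sum>q\<in>H. \<nu> q \<omega>)\<^sup>2 \<ge> (\<Sum>q\<in>Q. (\<nu> q \<omega>)\<^sup>2) / 8) \<le> (of_bool (\<bar>\<nu> (\<Union>H) \<omega>\<bar> > T0) :: real)"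
          by simp
      qed simp
      finally show "1/36 \<le> rsub (\<lambda>_. 1/2) Q (\<lambda>H. of_bool (\<bar>\<nu> (\<Union>H) \<omega>\<bar> > T0))" .
    qed simp
    also have "\<dots> \<le> rsub (\<lambda>_. 1/2) Q (\<lambda>_. \<eta> / 36)"
      using T0 nu_family(2)[OF Q] by (intro rsub_mono) auto
    finally show ?thesis using Q by simp
  qed
  moreover have "0 < 8 * T0\<^sup>2 + 1" by (simp add: add_nonneg_pos)
  ultimately show ?thesis by blast
qed

text \<open>Independent rounding of the values of a function to 0 and 1 turns integrals into measures of
  sets, up to an error controlled by the square sum.\<close>

lemma integral_bounded_in_prob_nonneg:
  assumes \<eta>: "\<eta> > 0"
  shows "\<exists>T. \<forall>Q \<phi>. finite Q \<longrightarrow> Q \<subseteq> AA \<longrightarrow> disjoint Q \<longrightarrow> (\<forall>q\<in>Q. 0 \<le> \<phi> q \<and> \<phi> q \<le> 1) \<longrightarrow>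
    prob {\<omega>\<in>space M. \<bar>\<Sum>q\<in>Q. \<phi> q * \<nu> q \<omega>\<bar> > T} \<le> \<eta>"
proof -
  obtain T where T: "\<And>A. A \<in> AA \<Longrightarrow> prob {\<omega>\<in>space M. \<bar>\<nu> A \<omega>\<bar> > T} \<le> \<eta> / 4"
    using range_bounded_in_prob[of "\<eta> / 4"] \<eta> by auto
  obtain s where s: "s > 0" "\<And>Q. finite Q \<Longrightarrow> Q \<subseteq> AA \<Longrightarrow> disjoint Q \<Longrightarrow>
    prob {\<omega>\<in>space M. (\<Sum>q\<in>Q. (\<nu> q \<omega>)\<^sup>2) > s} \<le> \<eta> / 4"
    using sum_squares_bounded_in_prob[of "\<eta> / 4"] \<eta> by auto
  have "prob {\<omega>\<in>space M. \<bar>\<Sum>q\<in>Q. \<phi> q * \<nu> q \<omega>\<bar> > T + 2 * sqrt s} \<le> \<eta>"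
    if Q: "finite Q" "Q \<subseteq> AA" "disjoint Q" and \<phi>: "\<forall>q\<in>Q. 0 \<le> \<phi> q \<and> \<phi> q \<le> 1" for Q \<phi>
  proof -
    have nuq [measurable]: "\<nu> q \<in> borel_measurable M" if "q \<in> Q" for q using that Q(2) by (intro nu_meas) auto
    define I where "I \<omega> = (\<Sum>q\<in>Q. \<phi> q * \<nu> q \<omega>)" for \<omega>
    have [measurable]: "I \<in> borel_measurable M" unfolding I_def by measurable
    let ?E = "{\<omega>\<in>space M. \<bar>I \<omega>\<bar> > T + 2 * sqrt s \<and> (\<Sum>q\<in>Q. (\<nu> q \<omega>)\<^sup>2) \<le> s}"
    have "3/4 * prob ?E \<le> rsub \<phi> Q (\<lambda>H. prob {\<omega>\<in>space M. \<bar>\<nu> (\<Union>H) \<omega>\<bar> > T})"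
    proof (rule rsub_prob_ge[OF Q(1)])
      fix H assume "H \<subseteq> Q"
      note [measurable] = nu_meas[OF nu_family(2)[OF Q this]]
      show "{\<omega>\<in>space M. \<bar>\<nu> (\<Union>H) \<omega>\<bar> > T} \<in> events" by measurable
    next
      show "?E \<in> events" by measurable
    next
      fix \<omega> assume \<omega>: "\<omega> \<in> ?E"
      have "(\<Sum>q\<in>Q. \<phi> q * (1 - \<phi> q) * (\<nu> q \<omega>)\<^sup>2) \<le> (\<Sum>q\<in>Q. (\<nu> q \<omega>)\<^sup>2)"
      proof (rule sum_mono)
        fix q assume "q \<in> Q"
        then have "\<phi> q * (1 - \<phi> q) \<le> 1 * 1" using \<phi> by (intro mult_mono) auto
        then show "\<phi> q * (1 - \<phi> q) * (\<nu> q \<omega>)\<^sup>2 \<le> (\<nu> q \<omega>)\<^sup>2" by (intro mult_left_le_one_le) (use \<phi> \<open>q \<in> Q\<close> in auto)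
      qed
      then have var: "rsub \<phi> Q (\<lambda>H. ((\<Sum>q\<in>H. \<nu> q \<omega>) - I \<omega>)\<^sup>2) \<le> s"
        using \<omega> unfolding I_def rsub_variance[OF Q(1)] by simp
      \<comment> \<open>Chebyshev: a deviation of at least 2 sqrt s costs probability at most s / (4
        s) = 1/4.\<close>
      have "3/4 \<le> 1 + (- 1 / (4 * s)) * rsub \<phi> Q (\<lambda>H. ((\<Sum>q\<in>H. \<nu> q \<omega>) - I \<omega>)\<^sup>2)"
        using var s(1) by (simp add: field_simps)
      also have "\<dots> = rsub \<phi> Q (\<lambda>H. 1 + (- 1 / (4 * s)) * ((\<Sum>q\<in>H. \<nu> q \<omega>) - I \<omega>)\<^sup>2)"
        unfolding rsub_add rsub_cmult using Q(1) by simp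
      also have "\<dots> \<le> rsub \<phi> Q (\<lambda>H. of_bool (\<bar>\<nu> (\<Union>H) \<omega>\<bar> > T))"
      proof (rule rsub_mono)
        fix H assume H: "H \<subseteq> Q"
        have eq: "\<nu> (\<Union>H) \<omega> = (\<Sum>q\<in>H. \<nu> q \<omega>)" by (rule nu_family(1)[OF Q H])
        show "1 + (- 1 / (4 * s)) * ((\<Sum>q\<in>H. \<nu> q \<omega>) - I \<omega>)\<^sup>2 \<le> of_bool (\<bar>\<nu> (\<Union>H) \<omega>\<bar> > T)"
        proof (cases "\<bar>\<nu> (\<Union>H) \<omega>\<bar> > T")
          case False
          then have "2 * sqrt s \<le> \<bar>(\<Sum>q\<in>H. \<nu> q \<omega>) - I \<omega>\<bar>" using \<omega> eq by auto
          then have "(2 * sqrt s)\<^sup>2 \<le> \<bar>(\<Sum>q\<in>H. \<nu> q \<omega>) - I \<omega>\<bar>\<^sup>2" using s(1) by (intro power_mono) auto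
          then have "4 * s \<le> ((\<Sum>q\<in>H. \<nu> q \<omega>) - I \<omega>)\<^sup>2" using s(1) by (simp add: power_mult_distrib)
          then show ?thesis using False s(1) by (simp add: field_simps)
        qed (use s(1) in auto)
      qed (use \<phi> in auto)
      finally show "3/4 \<le> rsub \<phi> Q (\<lambda>H. of_bool (\<bar>\<nu> (\<Union>H) \<omega>\<bar> > T))" .
    qed (use \<phi> in auto)
    also have "\<dots> \<le> rsub \<phi> Q (\<lambda>_. \<eta> / 4)"
      using T nu_family(2)[OF Q] \<phi> by (intro rsub_mono) auto
    finally have E: "3/4 * prob ?E \<le> \<eta> / 4" using Q by simp
    have "prob {\<omega>\<in>space M. \<bar>I \<omega>\<bar> > T + 2 * sqrt s} \<le> prob (?E \<union> {\<omega>\<in>space M. (\<Sum>q\<in>Q. (\<nu> q \<omega>)\<^sup>2) > s})"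
      by (intro finite_measure_mono) auto
    also have "\<dots> \<le> prob ?E + prob {\<omega>\<in>space M. (\<Sum>q\<in>Q. (\<nu> q \<omega>)\<^sup>2) > s}"
      by (intro measure_Un_le) auto
    finally show ?thesis using E s(2)[OF Q] \<eta> unfolding I_def by linarith
  qed
  then show ?thesis by (intro exI[of _ "T + 2 * sqrt s"]) blast
qed

lemma integral_bounded_in_prob:
  assumes \<eta>: "\<eta> > 0"
  shows "\<exists>T. \<forall>Q \<phi>. finite Q \<longrightarrow> Q \<subseteq> AA \<longrightarrow> disjoint Q \<longrightarrow> (\<forall>q\<in>Q. \<bar>\<phi> q\<bar> \<le> 1) \<longrightarrow>
    prob {\<omega>\<in>space M. \<bar>\<Sum>q\<in>Q. \<phi> q * \<nu> q \<omega>\<bar> > T} \<le> \<eta>"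
proof -
  have "\<eta> / 2 > 0" using \<eta> by simp
  from integral_bounded_in_prob_nonneg[OF this] obtain T where
    T: "\<forall>Q \<phi>. finite Q \<longrightarrow> Q \<subseteq> AA \<longrightarrow> disjoint Q \<longrightarrow> (\<forall>q\<in>Q. 0 \<le> \<phi> q \<and> \<phi> q \<le> 1) \<longrightarrow>
      prob {\<omega>\<in>space M. \<bar>\<Sum>q\<in>Q. \<phi> q * \<nu> q \<omega>\<bar> > T} \<le> \<eta> / 2" ..
  note T = T[rule_format]
  have "prob {\<omega>\<in>space M. \<bar>\<Sum>q\<in>Q. \<phi> q * \<nu> q \<omega>\<bar> > 2 * T} \<le> \<eta>"
    if Q: "finite Q" "Q \<subseteq> AA" "disjoint Q" and \<phi>: "\<forall>q\<in>Q. \<bar>\<phi> q\<bar> \<le> 1" for Q \<phi>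
  proof -
    have nuq [measurable]: "\<nu> q \<in> borel_measurable M" if "q \<in> Q" for q using that Q(2) by (intro nu_meas) auto
    let ?I = "\<lambda>\<phi> \<omega>. \<Sum>q\<in>Q. \<phi> q * \<nu> q \<omega>"
    let ?p = "\<lambda>q. max 0 (\<phi> q)" and ?n = "\<lambda>q. max 0 (- \<phi> q)"
    have split: "?I \<phi> \<omega> = ?I ?p \<omega> - ?I ?n \<omega>" for \<omega>
      unfolding sum_subtractf[symmetric] left_diff_distrib[symmetric] by (intro sum.cong) auto
    have "prob {\<omega>\<in>space M. \<bar>?I \<phi> \<omega>\<bar> > 2 * T}
      \<le> prob ({\<omega>\<in>space M. \<bar>?I ?p \<omega>\<bar> > T} \<union> {\<omega>\<in>space M. \<bar>?I ?n \<omega>\<bar> > T})"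
      unfolding split by (intro finite_measure_mono) auto
    also have "\<dots> \<le> prob {\<omega>\<in>space M. \<bar>?I ?p \<omega>\<bar> > T} + prob {\<omega>\<in>space M. \<bar>?I ?n \<omega>\<bar> > T}"
      by (intro measure_Un_le) auto
    also have "\<dots> \<le> \<eta> / 2 + \<eta> / 2"
      using \<phi> by (intro add_mono T[OF Q]) (auto simp: abs_le_iff)
    finally show ?thesis by simp
  qed
  then show ?thesis by blast
qed

text \<open>Now the index set is randomised instead of the atoms. For each \<open>J\<close> the
  function \<Sum>i\<in>J. \<phi> i is still bounded by 1, so its integral obeys the previous bound
  uniformly in \<open>J\<close>, and Paley--Zygmund converts this into a bound for the square
  sum.\<close>

lemma square_function_bounded_in_prob:
  assumes \<eta>: "\<eta> > 0"
  shows "\<exists>T. \<forall>Q (I :: 'i set) \<phi>. finite Q \<longrightarrow> Q \<subseteq> AA \<longrightarrow> disjoint Q \<longrightarrow> finite I \<longrightarrow>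
    (\<forall>q\<in>Q. (\<Sum>i\<in>I. \<bar>\<phi> i q\<bar>) \<le> 1) \<longrightarrow>
    prob {\<omega>\<in>space M. (\<Sum>i\<in>I. (\<Sum>q\<in>Q. \<phi> i q * \<nu> q \<omega>)\<^sup>2) > T} \<le> \<eta>"
proof -
  have "\<eta> / 36 > 0" using \<eta> by simp
  from integral_bounded_in_prob[OF this] obtain T where
    T: "\<forall>Q \<phi>. finite Q \<longrightarrow> Q \<subseteq> AA \<longrightarrow> disjoint Q \<longrightarrow> (\<forall>q\<in>Q. \<bar>\<phi> q\<bar> \<le> 1) \<longrightarrow>
      prob {\<omega>\<in>space M. \<bar>\<Sum>q\<in>Q. \<phi> q * \<nu> q \<omega>\<bar> > T} \<le> \<eta> / 36" ..
  note T = T[rule_format]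
  have "prob {\<omega>\<in>space M. (\<Sum>i\<in>I. (\<Sum>q\<in>Q. \<phi> i q * \<nu> q \<omega>)\<^sup>2) > 8 * T\<^sup>2} \<le> \<eta>"
    if Q: "finite Q" "Q \<subseteq> AA" "disjoint Q" and I: "finite I" and \<phi>: "\<forall>q\<in>Q. (\<Sum>i\<in>I. \<bar>\<phi> i q\<bar>) \<le> 1"
    for Q \<phi> and I :: "'i set"
  proof -
    have nuq [measurable]: "\<nu> q \<in> borel_measurable M" if "q \<in> Q" for q using that Q(2) by (intro nu_meas) auto
    define x where "x \<omega> i = (\<Sum>q\<in>Q. \<phi> i q * \<nu> q \<omega>)" for \<omega> i
    have [measurable]: "(\<lambda>\<omega>. x \<omega> i) \<in> borel_measurable M" for i unfolding x_def by measurable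
    have "1/36 * prob {\<omega>\<in>space M. (\<Sum>i\<in>I. (x \<omega> i)\<^sup>2) > 8 * T\<^sup>2}
      \<le> rsub (\<lambda>_. 1/2) I (\<lambda>J. prob {\<omega>\<in>space M. \<bar>\<Sum>i\<in>J. x \<omega> i\<bar> > T})"
    proof (rule rsub_prob_ge[OF I])
      fix \<omega> assume \<omega>: "\<omega> \<in> {\<omega>\<in>space M. (\<Sum>i\<in>I. (x \<omega> i)\<^sup>2) > 8 * T\<^sup>2}"
      have "1/36 \<le> rsub (\<lambda>_. 1/2) I (\<lambda>J. of_bool ((\<Sum>i\<in>J. x \<omega> i)\<^sup>2 \<ge> (\<Sum>i\<in>I. (x \<omega> i)\<^sup>2) / 8))"
        by (rule rsub_Paley_Zygmund[OF I])
      also have "\<dots> \<le> rsub (\<lambda>_. 1/2) I (\<lambda>J. of_bool (\<bar>\<Sum>i\<in>J. x \<omega> i\<bar> > T))"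
      proof (rule rsub_mono)
        fix J assume J: "J \<subseteq> I"
        have "T < \<bar>\<Sum>i\<in>J. x \<omega> i\<bar>" if "(\<Sum>i\<in>J. x \<omega> i)\<^sup>2 \<ge> (\<Sum>i\<in>I. (x \<omega> i)\<^sup>2) / 8"
        proof -
          have "T\<^sup>2 < \<bar>\<Sum>i\<in>J. x \<omega> i\<bar>\<^sup>2" using that \<omega> by simp
          then show ?thesis by (rule power_less_imp_less_base) simp
        qed
        then show "of_bool ((\<Sum>i\<in>J. x \<omega> i)\<^sup>2 \<ge> (\<Sum>i\<in>I. (x \<omega> i)\<^sup>2) / 8) \<le> (of_bool (\<bar>\<Sum>i\<in>J. x \<omega> i\<bar> > T) :: real)"
          by simp
      qed simp
      finally show "1/36 \<le> rsub (\<lambda>_. 1/2) I (\<lambda>J. of_bool (\<bar>\<Sum>i\<in>J. x \<omega> i\<bar> > T))" .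
    qed measurable
    also have "\<dots> \<le> rsub (\<lambda>_. 1/2) I (\<lambda>_. \<eta> / 36)"
    proof (rule rsub_mono)
      fix J assume J: "J \<subseteq> I"
      have eq: "(\<Sum>i\<in>J. x \<omega> i) = (\<Sum>q\<in>Q. (\<Sum>i\<in>J. \<phi> i q) * \<nu> q \<omega>)" for \<omega>
        unfolding x_def by (subst sum.swap) (simp add: sum_distrib_right)
      have "\<bar>\<Sum>i\<in>J. \<phi> i q\<bar> \<le> 1" if "q \<in> Q" for q
      proof -
        have "\<bar>\<Sum>i\<in>J. \<phi> i q\<bar> \<le> (\<Sum>i\<in>J. \<bar>\<phi> i q\<bar>)" by (rule sum_abs)
        also have "\<dots> \<le> (\<Sum>i\<in>I. \<bar>\<phi> i q\<bar>)" using I J by (intro sum_mono2) auto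
        finally show ?thesis using \<phi> that by force
      qed
      then show "prob {\<omega>\<in>space M. \<bar>\<Sum>i\<in>J. x \<omega> i\<bar> > T} \<le> \<eta> / 36"
        unfolding eq by (intro T[OF Q]) auto
    qed simp
    finally show ?thesis using I by (simp add: x_def)
  qed
  then show ?thesis by blast
qed

end

section \<open>Dyadic atoms\<close>

text \<open>Floor and ceiling agree exactly at grid points, so the code separates the grid from the
  open cells. This is necessary because the Haar functions take averaged values at their
  jumps.\<close>

definition dyadic_code :: "nat \<Rightarrow> real^'n \<Rightarrow> 'n \<Rightarrow> int \<times> int" where
  "dyadic_code k x = (\<lambda>s. (\<lfloor>2^k * x $ s\<rfloor>, \<lceil>2^k * x $ s\<rceil>))"

definition level_fun :: "nat \<Rightarrow> (real^'n::finite \<Rightarrow> 'b) \<Rightarrow> bool" where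
  "level_fun k h \<longleftrightarrow> (\<forall>x\<in>cbox 0 1. \<forall>y\<in>cbox 0 1. dyadic_code k x = dyadic_code k y \<longrightarrow> h x = h y)"

definition dyadic_sets :: "(real^'n::finite) set set" where
  "dyadic_sets = {A. A \<subseteq> cbox 0 1 \<and> (\<exists>k. level_fun k (\<lambda>x. x \<in> A))}"

definition atom :: "nat \<Rightarrow> real^'n::finite \<Rightarrow> (real^'n) set" where
  "atom k x = {y\<in>cbox 0 1. dyadic_code k y = dyadic_code k x}"

definition atoms :: "nat \<Rightarrow> (real^'n::finite) set set" where
  "atoms k = atom k ` cbox 0 1"

definition pt :: "'x set \<Rightarrow> 'x" where "pt q = (SOME x. x \<in> q)"

lemma floor_half: "\<lfloor>t\<rfloor> = \<lfloor>2 * t\<rfloor> div 2" for t :: real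
  using floor_divide_of_nat_eq by (simp add: floor_divide_real_eq_div[of 2 "2 * t", symmetric])

text \<open>By \<open>floor_half\<close> the finer floor determines the coarser one; the ceilings
  follow by passing from t to -t.\<close>

lemma dyadic_code_Suc:
  assumes "dyadic_code (Suc k) x = dyadic_code (Suc k) y"
  shows "dyadic_code k x = dyadic_code k y"
proof
  fix s
  have *: "\<lfloor>2 * (2^k * x $ s)\<rfloor> = \<lfloor>2 * (2^k * y $ s)\<rfloor>" "\<lceil>2 * (2^k * x $ s)\<rceil> = \<lceil>2 * (2^k * y $ s)\<rceil>"
    using fun_cong[OF assms, of s] by (auto simp: dyadic_code_def mult.assoc)
  have "\<lfloor>- (2 * (2^k * x $ s))\<rfloor> = \<lfloor>- (2 * (2^k * y $ s))\<rfloor>"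
    using *(2) by (simp add: ceiling_def)
  then have "\<lceil>2^k * x $ s\<rceil> = \<lceil>2^k * y $ s\<rceil>"
    using floor_half[of "- (2^k * x $ s)"] floor_half[of "- (2^k * y $ s)"] by (simp add: ceiling_def)
  then show "dyadic_code k x s = dyadic_code k y s"
    using *(1) floor_half[of "2^k * x $ s"] floor_half[of "2^k * y $ s"] by (simp add: dyadic_code_def)
qed

lemma dyadic_code_mono:
  assumes "j \<le> k" "dyadic_code k x = dyadic_code k y"
  shows "dyadic_code j x = dyadic_code j y"
  using assms by (induction k rule: dec_induct) (auto dest: dyadic_code_Suc)

lemma level_fun_mono: "level_fun j h \<Longrightarrow> j \<le> k \<Longrightarrow> level_fun k h"
  unfolding level_fun_def using dyadic_code_mono by blast

lemma level_fun_compose: "level_fun k h \<Longrightarrow> level_fun k (\<lambda>x. g (h x))"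
  unfolding level_fun_def by metis

lemma finite_dyadic_code: "finite (dyadic_code k ` cbox 0 (1::real^'n::finite))"
proof (rule finite_subset)
  show "dyadic_code k ` cbox 0 (1::real^'n) \<subseteq> UNIV \<rightarrow>\<^sub>E {0..2^k} \<times> {0..2^k}"
  proof
    fix v assume "v \<in> dyadic_code k ` cbox 0 (1::real^'n)"
    then obtain x :: "real^'n" where x: "x \<in> cbox 0 1" "v = dyadic_code k x" by auto
    have "0 \<le> x $ s" "x $ s \<le> 1" for s using x by (auto simp: mem_box_cart)
    then have "0 \<le> 2^k * x $ s" "2^k * x $ s \<le> 2^k" for s by (auto simp: mult_left_le)
    moreover have "(2::real)^k = real_of_int (2^k)" by simp
    ultimately have "0 \<le> \<lfloor>2^k * x $ s\<rfloor>" "\<lceil>2^k * x $ s\<rceil> \<le> 2^k" for s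
      by (metis zero_le_floor, metis ceiling_le)
    then have "v s \<in> {0..2^k} \<times> {0..2^k}" for s
      using floor_le_ceiling[of "2^k * x $ s"] order_trans[OF floor_le_ceiling[of "2^k * x $ s"]]
        order_trans[OF _ floor_le_ceiling[of "2^k * x $ s"]]
      by (simp add: x dyadic_code_def del: zero_le_floor ceiling_le_iff floor_le_iff zero_le_ceiling)
    then show "v \<in> UNIV \<rightarrow>\<^sub>E {0..2^k} \<times> {0..2^k}" by auto
  qed
qed (intro finite_PiE; simp)

lemma atom_measurable: "atom k x \<in> sets borel"
proof -
  have "atom k x = cbox 0 1 \<inter> (\<Inter>s. {y. \<lfloor>2^k * y $ s\<rfloor> = \<lfloor>2^k * x $ s\<rfloor>} \<inter> {y. \<lceil>2^k * y $ s\<rceil> = \<lceil>2^k * x $ s\<rceil>})"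
    by (auto simp: atom_def dyadic_code_def fun_eq_iff)
  moreover have "{y::real^'a. \<lfloor>2^k * y $ s\<rfloor> = i} \<in> sets borel" for s i
  proof -
    have "{y::real^'a. \<lfloor>2^k * y $ s\<rfloor> = i} = {y. of_int i \<le> 2^k * y $ s \<and> 2^k * y $ s < of_int i + 1}"
      by (auto simp: floor_eq_iff)
    then show ?thesis by simp
  qed
  moreover have "{y::real^'a. \<lceil>2^k * y $ s\<rceil> = i} \<in> sets borel" for s i
  proof -
    have "{y::real^'a. \<lceil>2^k * y $ s\<rceil> = i} = {y. of_int i - 1 < 2^k * y $ s \<and> 2^k * y $ s \<le> of_int i}"
      by (auto simp: ceiling_eq_iff)
    then show ?thesis by simp
  qed
  ultimately show ?thesis by (auto intro!: sets.Int sets.finite_INT)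
qed

lemma atom_self: "x \<in> cbox 0 1 \<Longrightarrow> x \<in> atom k x"
  by (simp add: atom_def)

lemma atom_dyadic: "atom k x \<in> dyadic_sets"
  unfolding dyadic_sets_def level_fun_def atom_def by (auto intro!: exI[of _ k])

lemma atoms_props:
  fixes k
  defines "A \<equiv> atoms k :: (real^'n::finite) set set"
  shows "finite A" "A \<subseteq> dyadic_sets" "disjoint A" "\<Union>A = cbox 0 1"
proof -
  have "A = (\<lambda>v. {y\<in>cbox 0 1. dyadic_code k y = v}) ` (dyadic_code k ` cbox 0 1)"
    by (auto simp: A_def atoms_def atom_def)
  then show "finite A" using finite_imageI[OF finite_dyadic_code] by simp
  show "A \<subseteq> dyadic_sets" by (auto simp: A_def atoms_def atom_dyadic)
  show "disjoint A" by (rule disjointI) (auto simp: A_def atoms_def atom_def)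
  show "\<Union>A = cbox 0 1" by (auto simp: A_def atoms_def atom_def)
qed

lemma pt_atom:
  assumes "q \<in> atoms k"
  shows "pt q \<in> q" "pt q \<in> cbox 0 1" "x \<in> q \<Longrightarrow> dyadic_code k x = dyadic_code k (pt q)"
proof -
  obtain y where y: "y \<in> cbox 0 1" "q = atom k y" using assms by (auto simp: atoms_def)
  then show "pt q \<in> q" using atom_self[OF y(1)] unfolding pt_def by (metis someI)
  then show "pt q \<in> cbox 0 1" "x \<in> q \<Longrightarrow> dyadic_code k x = dyadic_code k (pt q)"
    using y by (auto simp: atom_def)
qed

lemma level_fun_union_atoms:
  assumes "level_fun k (\<lambda>x. x \<in> A)" "A \<subseteq> cbox 0 1"
  shows "A = \<Union>{q\<in>atoms k. q \<subseteq> A}"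
proof
  show "A \<subseteq> \<Union>{q\<in>atoms k. q \<subseteq> A}"
  proof
    fix x assume x: "x \<in> A"
    then have "x \<in> cbox 0 1" using assms by auto
    moreover have "atom k x \<subseteq> A"
      using assms x calculation unfolding level_fun_def atom_def by blast
    ultimately show "x \<in> \<Union>{q\<in>atoms k. q \<subseteq> A}"
      using atom_self by (auto simp: atoms_def)
  qed
qed auto

lemma dyadic_sets_borel:
  assumes "A \<in> dyadic_sets"
  shows "A \<in> sets (restrict_space borel (cbox 0 1))"
proof -
  obtain k where "level_fun k (\<lambda>x. x \<in> A)" "A \<subseteq> cbox 0 1" using assms by (auto simp: dyadic_sets_def)
  then have *: "A = \<Union>{q\<in>atoms k. q \<subseteq> A}" by (rule level_fun_union_atoms)
  have "\<Union>{q\<in>atoms k. q \<subseteq> A} \<in> sets borel"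
    using atoms_props(1)[of k] atom_measurable by (intro sets.finite_Union) (auto simp: atoms_def)
  then show ?thesis using * \<open>A \<subseteq> cbox 0 1\<close> by (simp add: sets_restrict_space_iff)
qed

lemma countable_dyadic_sets: "countable (dyadic_sets :: (real^'n::finite) set set)"
proof -
  have "dyadic_sets \<subseteq> (\<Union>k. Union ` Pow (atoms k :: (real^'n) set set))"
    unfolding dyadic_sets_def using level_fun_union_atoms by blast
  moreover have "countable (Union ` Pow (atoms k :: (real^'n) set set))" for k
    by (rule countable_finite) (simp add: atoms_props(1))
  then have "countable (\<Union>k. Union ` Pow (atoms k :: (real^'n) set set))" by simp
  ultimately show ?thesis by (rule countable_subset)
qed

lemma algebra_dyadic_sets: "algebra (cbox 0 1) (dyadic_sets :: (real^'n::finite) set set)"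
  unfolding algebra_iff_Un
proof (intro conjI ballI)
  show "{} \<in> (dyadic_sets :: (real^'n) set set)" by (auto simp: dyadic_sets_def level_fun_def)
  fix A :: "(real^'n) set" assume A: "A \<in> dyadic_sets"
  then obtain k where k: "level_fun k (\<lambda>x. x \<in> A)" "A \<subseteq> cbox 0 1" by (auto simp: dyadic_sets_def)
  then have "level_fun k (\<lambda>x. x \<in> cbox 0 1 - A)" unfolding level_fun_def by blast
  then show "cbox 0 1 - A \<in> dyadic_sets" by (auto simp: dyadic_sets_def)
  fix B :: "(real^'n) set" assume B: "B \<in> dyadic_sets"
  then obtain l where l: "level_fun l (\<lambda>x. x \<in> B)" "B \<subseteq> cbox 0 1" by (auto simp: dyadic_sets_def)
  have "level_fun (max k l) (\<lambda>x. x \<in> A)" "level_fun (max k l) (\<lambda>x. x \<in> B)"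
    using k(1) l(1) by (auto elim!: level_fun_mono)
  then have "level_fun (max k l) (\<lambda>x. x \<in> A \<union> B)" unfolding level_fun_def by blast
  then show "A \<union> B \<in> dyadic_sets" using k l by (auto simp: dyadic_sets_def)
qed (auto simp: dyadic_sets_def)

section \<open>From the stochastic measure to an everywhere additive version\<close>

lemma stoch_measureD:
  assumes "stoch_measure M X mu"
  shows "A \<in> sets X \<Longrightarrow> mu A \<in> borel_measurable M"
    and "A \<in> sets X \<Longrightarrow> B \<in> sets X \<Longrightarrow> A \<inter> B = {} \<Longrightarrow> AE \<omega> in M. mu (A \<union> B) \<omega> = mu A \<omega> + mu B \<omega>"
  using assms unfolding stoch_measure_def by simp_all

text \<open>The tails \<open>C n\<close> of a disjoint sequence decrease to the empty set, and
  \<open>R n\<close> is the difference of two consecutive tails. This is why the threshold 1 is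
  split into 1/2 and 1/2.\<close>

lemma stoch_measure_disjoint:
  fixes mu :: "(real^'n::finite) set \<Rightarrow> 'w \<Rightarrow> real"
  assumes P: "prob_space M" and mu: "stoch_measure M X mu"
    and R: "\<And>n::nat. R n \<in> sets X" "disjoint_family R"
  shows "(\<lambda>n. measure M {\<omega>\<in>space M. \<bar>mu (R n) \<omega>\<bar> > 1}) \<longlonglongrightarrow> 0"
proof -
  interpret prob_space M by (rule P)
  define C where "C n = (\<Union>m\<in>{n..}. R m)" for n
  have C: "C n \<in> sets X" for n unfolding C_def using R(1) by auto
  have CS: "C n = R n \<union> C (Suc n)" for n
  proof -
    have "{n..} = insert n {Suc n..}" by auto
    then show ?thesis unfolding C_def by simp
  qed
  have dis: "R n \<inter> C (Suc n) = {}" for n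
  proof -
    have "R n \<inter> R m = {}" if "m \<in> {Suc n..}" for m
      using R(2) that unfolding disjoint_family_on_def by (metis UNIV_I atLeast_iff not_less_eq_eq order_refl)
    then show ?thesis unfolding C_def by blast
  qed
  have "(\<Inter>n. C n) = {}"
  proof -
    have False if x: "x \<in> (\<Inter>n. C n)" for x
    proof -
      obtain m where m: "x \<in> R m" using x by (auto simp: C_def)
      have "x \<in> C (Suc m)" using x by auto
      then show False using dis[of m] m by auto
    qed
    then show ?thesis by blast
  qed
  moreover have "decseq C" unfolding C_def decseq_def by fastforce
  ultimately have "conv_in_prob M (\<lambda>n. mu (C n)) (\<lambda>_. 0)"
    using mu C unfolding stoch_measure_def by blast
  then have "(\<lambda>n. prob {\<omega>\<in>space M. \<bar>mu (C n) \<omega> - 0\<bar> > 1/2}) \<longlonglongrightarrow> 0"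
    unfolding conv_in_prob_def by (meson half_gt_zero zero_less_one)
  then have lim: "(\<lambda>n. prob {\<omega>\<in>space M. \<bar>mu (C n) \<omega>\<bar> > 1/2}) \<longlonglongrightarrow> 0" by simp
  have [measurable]: "mu (R n) \<in> borel_measurable M" "mu (C n) \<in> borel_measurable M" for n
    using stoch_measureD(1)[OF mu] R(1) C by simp_all
  have le: "prob {\<omega>\<in>space M. \<bar>mu (R n) \<omega>\<bar> > 1}
    \<le> prob {\<omega>\<in>space M. \<bar>mu (C n) \<omega>\<bar> > 1/2} + prob {\<omega>\<in>space M. \<bar>mu (C (Suc n)) \<omega>\<bar> > 1/2}" for n
  proof -
    have "AE \<omega> in M. mu (R n \<union> C (Suc n)) \<omega> = mu (R n) \<omega> + mu (C (Suc n)) \<omega>"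
      by (rule stoch_measureD(2)[OF mu R(1) C dis])
    then have "AE \<omega> in M. \<omega> \<in> {\<omega>\<in>space M. \<bar>mu (R n) \<omega>\<bar> > 1} \<longrightarrow>
        \<omega> \<in> {\<omega>\<in>space M. \<bar>mu (C n) \<omega>\<bar> > 1/2} \<union> {\<omega>\<in>space M. \<bar>mu (C (Suc n)) \<omega>\<bar> > 1/2}"
    proof eventually_elim
      case (elim \<omega>)
      have "1/2 < \<bar>a + b\<bar> \<or> 1/2 < \<bar>b\<bar>" if "1 < \<bar>a\<bar>" for a b :: real using that by linarith
      then show ?case using elim CS[of n] by auto
    qed
    then have "prob {\<omega>\<in>space M. \<bar>mu (R n) \<omega>\<bar> > 1}
      \<le> prob ({\<omega>\<in>space M. \<bar>mu (C n) \<omega>\<bar> > 1/2} \<union> {\<omega>\<in>space M. \<bar>mu (C (Suc n)) \<omega>\<bar> > 1/2})"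
      by (intro finite_measure_mono_AE) auto
    also have "\<dots> \<le> prob {\<omega>\<in>space M. \<bar>mu (C n) \<omega>\<bar> > 1/2} + prob {\<omega>\<in>space M. \<bar>mu (C (Suc n)) \<omega>\<bar> > 1/2}"
      by (intro measure_Un_le) auto
    finally show ?thesis .
  qed
  have "(\<lambda>n. prob {\<omega>\<in>space M. \<bar>mu (C n) \<omega>\<bar> > 1/2} + prob {\<omega>\<in>space M. \<bar>mu (C (Suc n)) \<omega>\<bar> > 1/2}) \<longlonglongrightarrow> 0 + 0"
    using lim LIMSEQ_Suc[OF lim] by (rule tendsto_add)
  then have lim2: "(\<lambda>n. prob {\<omega>\<in>space M. \<bar>mu (C n) \<omega>\<bar> > 1/2} + prob {\<omega>\<in>space M. \<bar>mu (C (Suc n)) \<omega>\<bar> > 1/2}) \<longlonglongrightarrow> 0"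
    by simp
  show ?thesis
    by (rule tendsto_sandwich[OF _ _ tendsto_const lim2]; intro always_eventually allI le measure_nonneg)
qed

text \<open>Additivity holds almost surely for each pair, and there are countably many pairs of
  dyadic sets, so a single null set covers them all. Putting \<nu> to 0 there gives additivity at
  every point.\<close>

lemma stoch_measure_content:
  fixes mu :: "(real^'n::finite) set \<Rightarrow> 'w \<Rightarrow> real"
  assumes P: "prob_space M" and mu: "stoch_measure M (restrict_space borel (cbox 0 1)) mu"
  shows "\<exists>\<nu>. random_content M (cbox 0 1) dyadic_sets \<nu> \<and> (AE \<omega> in M. \<forall>A\<in>dyadic_sets. \<nu> A \<omega> = mu A \<omega>)"
proof -
  interpret prob_space M by (rule P)
  let ?X = "restrict_space borel (cbox 0 (1::real^'n))"
  have "AE \<omega> in M. A \<inter> B = {} \<longrightarrow> mu (A \<union> B) \<omega> = mu A \<omega> + mu B \<omega>"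
    if "A \<in> dyadic_sets" "B \<in> dyadic_sets" for A B
  proof (cases "A \<inter> B = {}")
    case True
    have "AE \<omega> in M. mu (A \<union> B) \<omega> = mu A \<omega> + mu B \<omega>"
      by (rule stoch_measureD(2)[OF mu dyadic_sets_borel[OF that(1)] dyadic_sets_borel[OF that(2)] True])
    then show ?thesis by eventually_elim simp
  qed simp
  then have "AE \<omega> in M. \<forall>A\<in>dyadic_sets. \<forall>B\<in>dyadic_sets. A \<inter> B = {} \<longrightarrow> mu (A \<union> B) \<omega> = mu A \<omega> + mu B \<omega>"
    by (simp add: AE_ball_countable countable_dyadic_sets)
  then obtain Z where Z: "Z \<in> null_sets M"
    "{\<omega>\<in>space M. \<not> (\<forall>A\<in>dyadic_sets. \<forall>B\<in>dyadic_sets. A \<inter> B = {} \<longrightarrow> mu (A \<union> B) \<omega> = mu A \<omega> + mu B \<omega>)} \<subseteq> Z"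
    unfolding eventually_ae_filter by auto
  define G where "G = space M - Z"
  have G [measurable]: "G \<in> sets M" using Z(1) by (auto simp: G_def)
  have AEG: "AE \<omega> in M. \<omega> \<in> G"
    using AE_not_in[OF Z(1)] AE_space by eventually_elim (simp add: G_def)
  define \<nu> where "\<nu> A \<omega> = (if \<omega> \<in> G then mu A \<omega> else 0)" for A \<omega>
  have meas: "mu A \<in> borel_measurable M" if "A \<in> dyadic_sets" for A
    by (rule stoch_measureD(1)[OF mu dyadic_sets_borel[OF that]])
  have "random_content M (cbox 0 1) dyadic_sets \<nu>"
  proof (intro random_content.intro random_content_axioms.intro P algebra_dyadic_sets)
    fix A :: "(real^'n) set" assume "A \<in> dyadic_sets"
    note [measurable] = meas[OF this]
    show "\<nu> A \<in> borel_measurable M" unfolding \<nu>_def by measurable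
  next
    fix A B :: "(real^'n) set" and \<omega>
    assume "A \<in> dyadic_sets" "B \<in> dyadic_sets" "A \<inter> B = {}"
    then show "\<nu> (A \<union> B) \<omega> = \<nu> A \<omega> + \<nu> B \<omega>" using Z(2) by (auto simp: \<nu>_def G_def)
  next
    fix R :: "nat \<Rightarrow> (real^'n) set" assume R: "range R \<subseteq> dyadic_sets" "disjoint_family R"
    have Rn: "R n \<in> dyadic_sets" for n using R(1) by auto
    have "prob {\<omega>\<in>space M. \<bar>\<nu> (R n) \<omega>\<bar> > 1} = prob {\<omega>\<in>space M. \<bar>mu (R n) \<omega>\<bar> > 1}" for n
    proof (rule measure_eq_AE)
      note [measurable] = meas[OF Rn]
      show "AE \<omega> in M. (\<omega> \<in> {\<omega>\<in>space M. \<bar>\<nu> (R n) \<omega>\<bar> > 1}) = (\<omega> \<in> {\<omega>\<in>space M. \<bar>mu (R n) \<omega>\<bar> > 1})"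
        using AEG by eventually_elim (simp add: \<nu>_def)
      show "{\<omega>\<in>space M. \<bar>\<nu> (R n) \<omega>\<bar> > 1} \<in> events" unfolding \<nu>_def by measurable
    qed (use meas[OF Rn] in measurable)
    then show "(\<lambda>n. prob {\<omega>\<in>space M. \<bar>\<nu> (R n) \<omega>\<bar> > 1}) \<longlonglongrightarrow> 0"
      using stoch_measure_disjoint[OF P mu dyadic_sets_borel[OF Rn] R(2)] by simp
  qed
  moreover have "AE \<omega> in M. \<forall>A\<in>dyadic_sets. \<nu> A \<omega> = mu A \<omega>"
    using AEG by eventually_elim (simp add: \<nu>_def)
  ultimately show ?thesis by blast
qed

section \<open>Integrals of functions that are constant on atoms\<close>

lemma level_fun_vimage:
  assumes "level_fun k h"
  shows "cbox 0 1 \<inter> h -` {c} \<in> dyadic_sets"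
proof -
  have "level_fun k (\<lambda>x. x \<in> cbox 0 1 \<inter> h -` {c})"
    using assms unfolding level_fun_def by (metis IntI IntE vimage_singleton_eq)
  then show ?thesis by (auto simp: dyadic_sets_def)
qed

lemma simple_int_eq_content:
  assumes "level_fun k h" "\<forall>A\<in>dyadic_sets. \<nu> A \<omega> = mu A \<omega>"
  shows "simple_int mu (cbox 0 1) h \<omega> = simple_int \<nu> (cbox 0 1) h \<omega>"
  unfolding simple_int_def using assms(2) level_fun_vimage[OF assms(1)] by (intro sum.cong) auto

lemma simple_int_cong:
  assumes "\<And>x. x \<in> D \<Longrightarrow> h x = h' x"
  shows "simple_int \<nu> D h \<omega> = simple_int \<nu> D h' \<omega>"
proof -
  have "h ` D = h' ` D" "D \<inter> h -` {c} = D \<inter> h' -` {c}" for c using assms by auto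
  then show ?thesis by (simp add: simple_int_def)
qed

locale dyadic_content = random_content M "cbox 0 1" dyadic_sets \<nu>
  for M :: "'w measure" and \<nu> :: "(real^'n::finite) set \<Rightarrow> 'w \<Rightarrow> real"
begin

abbreviation "ival h \<omega> \<equiv> simple_int \<nu> (cbox 0 1) h \<omega>"

text \<open>\<open>simple_int\<close> runs over the values of the function, which is awkward for
  linear combinations. Grouping the atoms by value replaces it by a sum over a partition that does
  not depend on \<open>h\<close>, from which linearity is immediate.\<close>

lemma ival_atoms:
  assumes h: "level_fun k h"
  shows "ival h \<omega> = (\<Sum>q\<in>atoms k. h (pt q) * \<nu> q \<omega>)"
proof -
  have hx: "h x = h (pt q)" if "q \<in> atoms k" "x \<in> q" for q x
    using h pt_atom[OF that(1)] that atoms_props(4)[of k] unfolding level_fun_def by blast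
  have lev: "\<nu> (cbox 0 1 \<inter> h -` {c}) \<omega> = (\<Sum>q\<in>{q\<in>atoms k. h (pt q) = c}. \<nu> q \<omega>)" for c
  proof -
    have "cbox 0 1 \<inter> h -` {c} = \<Union>{q\<in>atoms k. h (pt q) = c}"
      unfolding atoms_props(4)[of k, symmetric] using hx by auto
    then show ?thesis using nu_family(1)[OF atoms_props(1-3), of "{q\<in>atoms k. h (pt q) = c}" k] by simp
  qed
  have "ival h \<omega> = (\<Sum>c\<in>h ` cbox 0 1. \<Sum>q\<in>{q\<in>atoms k. h (pt q) = c}. h (pt q) * \<nu> q \<omega>)"
    unfolding simple_int_def lev sum_distrib_left by (intro sum.cong) auto
  also have "\<dots> = (\<Sum>q\<in>atoms k. h (pt q) * \<nu> q \<omega>)"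
  proof (rule sum.group)
    have "h x = h (pt (atom k x))" "atom k x \<in> atoms k" if "x \<in> cbox 0 1" for x
      using hx[of "atom k x" x] that atom_self[OF that] by (auto simp: atoms_def)
    then have "h ` cbox 0 1 \<subseteq> (\<lambda>q. h (pt q)) ` atoms k" by blast
    then show "finite (h ` cbox 0 1)" using atoms_props(1)[of k] finite_subset by blast
    show "(\<lambda>q. h (pt q)) ` atoms k \<subseteq> h ` cbox 0 1" using pt_atom(2) by blast
  qed (rule atoms_props)
  finally show ?thesis .
qed

lemma ival_measurable [measurable]:
  assumes "level_fun k h"
  shows "ival h \<in> borel_measurable M"
proof -
  have "ival h = (\<lambda>\<omega>. \<Sum>q\<in>atoms k. h (pt q) * \<nu> q \<omega>)" using ival_atoms[OF assms] by auto
  moreover have "\<dots> \<in> borel_measurable M"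
    using atoms_props(2) by (intro borel_measurable_sum borel_measurable_times nu_meas) auto
  ultimately show ?thesis by simp
qed

lemma ival_sum:
  assumes "\<And>i. i \<in> I \<Longrightarrow> level_fun k (h i)"
  shows "ival (\<lambda>x. \<Sum>i\<in>I. a i * h i x) \<omega> = (\<Sum>i\<in>I. a i * ival (h i) \<omega>)"
proof -
  have lf: "level_fun k (\<lambda>x. \<Sum>i\<in>I. a i * h i x)"
    unfolding level_fun_def
  proof (intro ballI impI sum.cong refl)
    fix x y :: "real^'n" and i assume "x \<in> cbox 0 1" "y \<in> cbox 0 1" "dyadic_code k x = dyadic_code k y" "i \<in> I"
    then have "h i x = h i y" using assms[of i] unfolding level_fun_def by blast
    then show "a i * h i x = a i * h i y" by simp
  qed
  have "(\<Sum>i\<in>I. a i * ival (h i) \<omega>) = (\<Sum>i\<in>I. \<Sum>q\<in>atoms k. a i * (h i (pt q) * \<nu> q \<omega>))"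
    by (intro sum.cong refl) (simp add: ival_atoms[OF assms] sum_distrib_left)
  also have "\<dots> = (\<Sum>q\<in>atoms k. \<Sum>i\<in>I. a i * (h i (pt q) * \<nu> q \<omega>))" by (rule sum.swap)
  also have "\<dots> = ival (\<lambda>x. \<Sum>i\<in>I. a i * h i x) \<omega>"
    unfolding ival_atoms[OF lf] by (simp add: sum_distrib_right mult.assoc)
  finally show ?thesis ..
qed

text \<open>Pooling all levels up to \<open>K\<close> into one index set yields a bound in
  probability that is uniform in \<open>K\<close>. The pooled sums increase with \<open>K\<close>,
  so their supremum is almost surely finite, and it dominates each single level.\<close>

lemma square_function_AE_bounded:
  fixes I :: "nat \<Rightarrow> 'i set" and \<phi> :: "nat \<Rightarrow> 'i \<Rightarrow> real^'n \<Rightarrow> real"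
  assumes I: "\<And>k. finite (I k)" and lev: "\<And>k i. i \<in> I k \<Longrightarrow> level_fun k (\<phi> k i)"
    and bd: "\<And>K x. x \<in> cbox 0 1 \<Longrightarrow> (\<Sum>k\<le>K. \<Sum>i\<in>I k. \<bar>\<phi> k i x\<bar>) \<le> C"
  shows "AE \<omega> in M. \<exists>B. \<forall>k. (\<Sum>i\<in>I k. (ival (\<phi> k i) \<omega>)\<^sup>2) \<le> B"
proof -
  \<comment> \<open>The maximum with 1 makes the normalising divisor positive whatever
    \<open>C\<close> is.\<close>
  define C' where "C' = max C 1"
  have C': "C' > 0" by (simp add: C'_def)
  define W where "W K \<omega> = (\<Sum>k\<le>K. \<Sum>i\<in>I k. (ival (\<phi> k i) \<omega>)\<^sup>2)" for K \<omega>
  have [measurable]: "W K \<in> borel_measurable M" for K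
    unfolding W_def by (intro borel_measurable_sum borel_measurable_power ival_measurable[OF lev])
  have Wmono: "W K \<omega> \<le> W K' \<omega>" if "K \<le> K'" for K K' \<omega>
    unfolding W_def using that by (intro sum_mono2) (auto intro: sum_nonneg)
  have bound: "\<exists>T. \<forall>K. prob {\<omega>\<in>space M. W K \<omega> > T} \<le> \<eta>" if \<eta>: "\<eta> > 0" for \<eta>
  proof -
    from square_function_bounded_in_prob[OF \<eta>, where 'i = "nat \<times> 'i"]
    obtain T where T: "\<forall>Q (I :: (nat \<times> 'i) set) \<phi>. finite Q \<longrightarrow> Q \<subseteq> dyadic_sets \<longrightarrow> disjoint Q \<longrightarrow> finite I \<longrightarrow>
      (\<forall>q\<in>Q. (\<Sum>i\<in>I. \<bar>\<phi> i q\<bar>) \<le> 1) \<longrightarrow>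
      prob {\<omega>\<in>space M. (\<Sum>i\<in>I. (\<Sum>q\<in>Q. \<phi> i q * \<nu> q \<omega>)\<^sup>2) > T} \<le> \<eta>" ..
    have "prob {\<omega>\<in>space M. W K \<omega> > C'\<^sup>2 * T} \<le> \<eta>" for K
    proof -
      define J where "J = Sigma {..K} I"
      define \<psi> where "\<psi> z q = \<phi> (fst z) (snd z) (pt q) / C'" for z and q :: "(real^'n) set"
      have J: "finite J" unfolding J_def using I by auto
      have sumJ: "(\<Sum>z\<in>J. F (fst z) (snd z)) = (\<Sum>k\<le>K. \<Sum>i\<in>I k. F k i)" for F :: "nat \<Rightarrow> 'i \<Rightarrow> real"
        unfolding J_def using I by (subst sum.Sigma) (auto simp: case_prod_unfold)
      have "(\<Sum>z\<in>J. \<bar>\<psi> z q\<bar>) \<le> 1" if q: "q \<in> atoms K" for q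
      proof -
        have "(\<Sum>z\<in>J. \<bar>\<psi> z q\<bar>) = (\<Sum>k\<le>K. \<Sum>i\<in>I k. \<bar>\<phi> k i (pt q)\<bar>) / C'"
          unfolding \<psi>_def sumJ[of "\<lambda>k i. \<bar>\<phi> k i (pt q) / C'\<bar>"] using C' by (simp add: sum_divide_distrib)
        also have "\<dots> \<le> C / C'" using bd[OF pt_atom(2)[OF q]] C' by (intro divide_right_mono) auto
        also have "\<dots> \<le> 1" using C' by (simp add: C'_def)
        finally show ?thesis .
      qed
      then have "prob {\<omega>\<in>space M. (\<Sum>z\<in>J. (\<Sum>q\<in>atoms K. \<psi> z q * \<nu> q \<omega>)\<^sup>2) > T} \<le> \<eta>"
        using T[rule_format, OF atoms_props(1-3) J] by blast
      moreover have "(\<Sum>z\<in>J. (\<Sum>q\<in>atoms K. \<psi> z q * \<nu> q \<omega>)\<^sup>2) = W K \<omega> / C'\<^sup>2" for \<omega>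
      proof -
        have "(\<Sum>q\<in>atoms K. \<psi> z q * \<nu> q \<omega>)\<^sup>2 = (ival (\<phi> (fst z) (snd z)) \<omega>)\<^sup>2 / C'\<^sup>2" if "z \<in> J" for z
        proof -
          have "level_fun K (\<phi> (fst z) (snd z))"
            using that lev level_fun_mono unfolding J_def by fastforce
          then show ?thesis
            by (simp add: ival_atoms \<psi>_def flip: power_divide sum_divide_distrib)
        qed
        then have "(\<Sum>z\<in>J. (\<Sum>q\<in>atoms K. \<psi> z q * \<nu> q \<omega>)\<^sup>2) = (\<Sum>z\<in>J. (ival (\<phi> (fst z) (snd z)) \<omega>)\<^sup>2 / C'\<^sup>2)"
          by (intro sum.cong) auto
        then show ?thesis
          unfolding sumJ[of "\<lambda>k i. (ival (\<phi> k i) \<omega>)\<^sup>2 / C'\<^sup>2"] W_def by (simp add: sum_divide_distrib)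
      qed
      then have "C'\<^sup>2 * T < W K \<omega> \<longleftrightarrow> T < (\<Sum>z\<in>J. (\<Sum>q\<in>atoms K. \<psi> z q * \<nu> q \<omega>)\<^sup>2)" for \<omega>
        using C' by (simp add: pos_less_divide_eq mult.commute)
      ultimately show ?thesis by simp
    qed
    then show ?thesis by blast
  qed
  have "prob {\<omega>\<in>space M. \<forall>n::nat. \<exists>K. W K \<omega> > n} \<le> \<eta>" if \<eta>: "\<eta> > 0" for \<eta>
  proof -
    obtain T where T: "\<And>K. prob {\<omega>\<in>space M. W K \<omega> > T} \<le> \<eta>" using bound[OF \<eta>] by blast
    obtain n :: nat where n: "T \<le> n" using real_arch_simple by blast
    have "(\<lambda>K. prob {\<omega>\<in>space M. W K \<omega> > T}) \<longlonglongrightarrow> prob (\<Union>K. {\<omega>\<in>space M. W K \<omega> > T})"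
      using Wmono by (intro finite_Lim_measure_incseq) (auto simp: incseq_def intro: less_le_trans)
    then have "prob (\<Union>K. {\<omega>\<in>space M. W K \<omega> > T}) \<le> \<eta>" using T by (intro LIMSEQ_le_const2) auto
    moreover have "prob {\<omega>\<in>space M. \<forall>n::nat. \<exists>K. W K \<omega> > n} \<le> prob (\<Union>K. {\<omega>\<in>space M. W K \<omega> > T})"
    proof (rule finite_measure_mono)
      show "{\<omega>\<in>space M. \<forall>n::nat. \<exists>K. W K \<omega> > n} \<subseteq> (\<Union>K. {\<omega>\<in>space M. W K \<omega> > T})"
      proof
        fix \<omega> assume \<omega>: "\<omega> \<in> {\<omega>\<in>space M. \<forall>n::nat. \<exists>K. W K \<omega> > n}"
        then obtain K where "W K \<omega> > n" by blast
        then have "W K \<omega> > T" using n by linarith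
        then show "\<omega> \<in> (\<Union>K. {\<omega>\<in>space M. W K \<omega> > T})" using \<omega> by blast
      qed
    qed measurable
    ultimately show ?thesis by linarith
  qed
  then have "prob {\<omega>\<in>space M. \<forall>n::nat. \<exists>K. W K \<omega> > n} \<le> 0"
    using field_le_epsilon[of "prob {\<omega>\<in>space M. \<forall>n::nat. \<exists>K. W K \<omega> > n}" 0] by (simp only: add_0)
  then have "prob {\<omega>\<in>space M. \<forall>n::nat. \<exists>K. W K \<omega> > n} = 0" by (simp add: measure_le_0_iff)
  then have "AE \<omega> in M. \<not> (\<forall>n::nat. \<exists>K. W K \<omega> > n)"
    by (intro AE_I[of _ _ "{\<omega>\<in>space M. \<forall>n::nat. \<exists>K. W K \<omega> > n}"]) (auto simp: emeasure_eq_measure)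
  then show ?thesis
  proof eventually_elim
    case (elim \<omega>)
    then obtain n :: nat where n: "\<And>K. W K \<omega> \<le> n" by (auto simp: not_less)
    have "(\<Sum>i\<in>I k. (ival (\<phi> k i) \<omega>)\<^sup>2) \<le> n" for k
    proof -
      have "(\<Sum>i\<in>I k. (ival (\<phi> k i) \<omega>)\<^sup>2) \<le> W k \<omega>"
        unfolding W_def by (rule member_le_sum[of k "{..k}" "\<lambda>k. \<Sum>i\<in>I k. (ival (\<phi> k i) \<omega>)\<^sup>2"]) (auto intro: sum_nonneg)
      then show ?thesis using n[of k] by linarith
    qed
    then show ?case by blast
  qed
qed

end

section \<open>Haar partial sums as sums over cells\<close>

text \<open>The Haar function without its normalising factor, in the variable
  \<open>w = 2^Suc j * t\<close>, in which its breakpoints are the integers 2i, 2i + 1 and 2i + 2;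
  here \<open>i\<close> counts from 0. The cases \<open>i = 0\<close> and \<open>Suc i = 2^j\<close>
  belong to the ends of [0, 1], where no average is taken.\<close>

definition haar_shape :: "nat \<Rightarrow> nat \<Rightarrow> real \<Rightarrow> real" where
  "haar_shape j i w = (if 2 * real i < w \<and> w < 2 * real i + 1 then 1
     else if 2 * real i + 1 < w \<and> w < 2 * real i + 2 then -1
     else if w = 2 * real i + 1 then 0
     else if w = 2 * real i then (if i = 0 then 1 else 1/2)
     else if w = 2 * real i + 2 then (if Suc i = 2^j then -1 else -1/2) else 0)"

lemma haar_one [simp]: "haar 1 t = 1" "haar (Suc 0) t = 1"
  by (auto simp: haar_def)

lemma haar_j_eq:
  assumes "i < 2^j"
  shows "haar_j (2^j + Suc i) = j"
  unfolding haar_j_def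
proof (rule Least_equality)
  show "2 ^ j + Suc i \<le> 2 ^ Suc j" using assms by simp
  fix l assume *: "2 ^ j + Suc i \<le> (2::nat) ^ Suc l"
  show "j \<le> l"
  proof (rule ccontr)
    assume "\<not> j \<le> l"
    then have "(2::nat) ^ Suc l \<le> 2 ^ j" by (intro power_increasing) auto
    then show False using * by simp
  qed
qed

lemma haar_eq_shape:
  assumes "i < 2^j"
  shows "haar (2^j + Suc i) t = sqrt (2^j) * haar_shape j i (2^Suc j * t)"
proof -
  define w where "w = 2^Suc j * t"
  have p: "(2::real)^j > 0" by simp
  have n: "2^j + Suc i \<noteq> 0" "2^j + Suc i \<noteq> (1::nat)" by simp_all
  define P where "P = (2::real)^Suc j"
  have P: "P > 0" and t: "t = w / P" by (simp_all add: w_def P_def)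
  have eqs: "(real (Suc i) - 1) / 2^j = (2 * real i) / P" "(2 * real (Suc i) - 1) / 2^Suc j = (2 * real i + 1) / P"
      "real (Suc i) / 2^j = (2 * real i + 2) / P"
    by (simp_all add: P_def field_simps)
  have lo: "(real (Suc i) - 1) / 2^j < t \<longleftrightarrow> 2 * real i < w" "t = (real (Suc i) - 1) / 2^j \<longleftrightarrow> w = 2 * real i"
      "(real (Suc i) - 1) / 2^j = (0::real) \<longleftrightarrow> i = 0"
    unfolding t eqs using P by (simp_all add: divide_less_cancel)
  have mid: "t < (2 * real (Suc i) - 1) / 2^Suc j \<longleftrightarrow> w < 2 * real i + 1"
      "(2 * real (Suc i) - 1) / 2^Suc j < t \<longleftrightarrow> 2 * real i + 1 < w"
      "t = (2 * real (Suc i) - 1) / 2^Suc j \<longleftrightarrow> w = 2 * real i + 1"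
    unfolding t eqs using P by (simp_all add: divide_less_cancel)
  have hi: "t < real (Suc i) / 2^j \<longleftrightarrow> w < 2 * real i + 2" "t = real (Suc i) / 2^j \<longleftrightarrow> w = 2 * real i + 2"
    unfolding t eqs using P by (simp_all add: divide_less_cancel)
  have "real (Suc i) / 2^j = 1 \<longleftrightarrow> real (Suc i) = real (2^j)" by auto
  then have hi1: "real (Suc i) / 2^j = (1::real) \<longleftrightarrow> Suc i = 2^j" by (simp only: of_nat_eq_iff)
  have sub: "2^j + Suc i - 2^j = Suc i" by simp
  show ?thesis
    unfolding haar_def haar_j_eq[OF assms] Let_def sub lo mid hi hi1 w_def[symmetric] haar_shape_def
    using n by simp
qed

lemma haar_index_cases:
  assumes "n \<in> {1..2^k}"
  obtains "n = 1" | j i where "j < k" "i < 2^j" "n = 2^j + Suc i"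
  using assms
proof (induction k)
  case (Suc k)
  show ?case
  proof (cases "n \<le> 2^k")
    case True
    then show ?thesis using Suc by (metis atLeastAtMost_iff less_Suc_eq)
  next
    case False
    then have "n = 2^k + Suc (n - 2^k - 1)" "n - 2^k - 1 < 2^k" using Suc.prems by auto
    then show ?thesis using Suc.prems(2)[of k] by blast
  qed
qed auto

text \<open>An open interval of a grid at least as fine contains no breakpoint, so only the integer
  quotient \<open>i div 2^m\<close> matters.\<close>

lemma haar_shape_open:
  assumes "real i < 2^m * w" "2^m * w < real i + 1"
  shows "haar_shape j c w = (if i div 2^m = 2 * c then 1 else if i div 2^m = 2 * c + 1 then -1 else 0)"
proof -
  have less: "real b < w \<longleftrightarrow> b \<le> i div 2^m" for b
  proof -
    have e: "real (2^m * b) = 2^m * real b" by simp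
    have "real b < w \<longleftrightarrow> 2^m * real b < 2^m * w" by simp
    also have "\<dots> \<longleftrightarrow> 2^m * b \<le> i"
    proof
      assume "2^m * real b < 2^m * w"
      then have "real (2^m * b) < real (i + 1)" using assms(2) e by linarith
      then show "2^m * b \<le> i" by (simp only: of_nat_less_iff)
    next
      assume "2^m * b \<le> i"
      then have "real (2^m * b) \<le> real i" by (simp only: of_nat_le_iff)
      then show "2^m * real b < 2^m * w" using assms(1) e by linarith
    qed
    also have "\<dots> \<longleftrightarrow> b \<le> i div 2^m" by (simp add: less_eq_div_iff_mult_less_eq mult.commute)
    finally show ?thesis .
  qed
  have greater: "w < real b \<longleftrightarrow> i div 2^m < b" for b
  proof -
    have e: "real (2^m * b) = 2^m * real b" by simp
    have "w < real b \<longleftrightarrow> 2^m * w < 2^m * real b" by simp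
    also have "\<dots> \<longleftrightarrow> i < 2^m * b"
    proof
      assume "2^m * w < 2^m * real b"
      then have "real i < real (2^m * b)" using assms(1) e by linarith
      then show "i < 2^m * b" by (simp only: of_nat_less_iff)
    next
      assume "i < 2^m * b"
      then have "real (i + 1) \<le> real (2^m * b)" by (simp only: of_nat_le_iff)
      then show "2^m * w < 2^m * real b" using assms(2) e by linarith
    qed
    also have "\<dots> \<longleftrightarrow> i div 2^m < b" by (simp add: div_less_iff_less_mult mult.commute)
    finally show ?thesis .
  qed
  have ne: "w \<noteq> real b" for b using less[of b] greater[of b] by auto
  show ?thesis
    using less[of "2 * c"] less[of "2 * c + 1"] greater[of "2 * c + 1"] greater[of "2 * c + 2"]
      ne[of "2 * c"] ne[of "2 * c + 1"] ne[of "2 * c + 2"]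
    by (auto simp: haar_shape_def)
qed

lemma haar_open:
  assumes "j < k" "c < 2^j" "real i < 2^k * t" "2^k * t < real i + 1"
  shows "haar (2^j + Suc c) t = sqrt (2^j) *
    (if i div 2^(k - Suc j) = 2 * c then 1 else if i div 2^(k - Suc j) = 2 * c + 1 then -1 else 0)"
proof -
  have "(2::real)^(k - Suc j) * (2^Suc j * t) = 2^k * t"
    using assms(1) by (simp flip: mult.assoc power_add power_Suc)
  then show ?thesis using assms by (simp only: haar_eq_shape[OF assms(2)] haar_shape_open[of i "k - Suc j" "2^Suc j * t"])
qed

section \<open>The kernel of the one-dimensional Haar partial sums\<close>

definition midpoint1 :: "nat \<Rightarrow> nat \<Rightarrow> real" where
  "midpoint1 k i = (real i + 1/2) / 2^k"

lemma midpoint1: "real i < 2^k * midpoint1 k i" "2^k * midpoint1 k i < real i + 1"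
  by (simp_all add: midpoint1_def)

lemma haar_const:
  assumes "n \<in> {1..2^k}" "real i < 2^k * t" "2^k * t < real i + 1"
  shows "haar n t = haar n (midpoint1 k i)"
  using assms(1)
proof (cases rule: haar_index_cases)
  case (2 j c)
  then show ?thesis using haar_open[OF 2(1,2) assms(2,3)] haar_open[OF 2(1,2) midpoint1] by simp
qed simp

text \<open>Indicator of a dyadic interval with the value 1/2 at endpoints inside (0, 1), the same
  averaging convention as for the Haar functions. Up to the factor \<open>2^k\<close> these are the
  kernels of the partial sums, see \<open>haar_kernel\<close>.\<close>

definition cell_weight :: "nat \<Rightarrow> nat \<Rightarrow> real \<Rightarrow> real" where
  "cell_weight k i t = (if real i < 2^k * t \<and> 2^k * t < real i + 1 then 1
     else if 2^k * t = real i then (if i = 0 then 1 else 1/2)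
     else if 2^k * t = real i + 1 then (if Suc i = 2^k then 1 else 1/2) else 0)"

lemma cell_weight_range: "0 \<le> cell_weight k i t" "cell_weight k i t \<le> 1"
  by (auto simp: cell_weight_def)

text \<open>Half the sum and half the difference of the weight of an interval and the Haar function
  on it are the weights of its two halves, boundary values included. This drives the induction for
  the kernel.\<close>

lemma cell_weight_Suc:
  "2 * cell_weight (Suc k) (2 * c) t = cell_weight k c t + haar_shape k c (2^Suc k * t)"
  "2 * cell_weight (Suc k) (2 * c + 1) t = cell_weight k c t - haar_shape k c (2^Suc k * t)"
proof -
  define w where "w = 2^Suc k * t"
  have v: "2^k * t = w / 2" by (simp add: w_def)
  have e: "Suc (Suc (2 * c)) = 2 * Suc c" by simp
  have par2: "Suc (Suc (2 * c)) = 2^Suc k \<longleftrightarrow> Suc c = 2^k" by (metis e mult_cancel_left power_Suc zero_neq_numeral)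
  \<comment> \<open>A left half never ends at 1, as an odd number is not
    \<open>2^Suc k\<close>.\<close>
  have par1: "Suc (2 * c) \<noteq> 2^Suc k" by (metis Suc_double_not_eq_double power_Suc)
  note parent = par1 par2
  have a: "real c < w / 2 \<longleftrightarrow> 2 * real c < w" "w / 2 < real c + 1 \<longleftrightarrow> w < 2 * real c + 2"
    "w / 2 = real c \<longleftrightarrow> w = 2 * real c" "w / 2 = real c + 1 \<longleftrightarrow> w = 2 * real c + 2" by auto
  show "2 * cell_weight (Suc k) (2 * c) t = cell_weight k c t + haar_shape k c (2^Suc k * t)"
    unfolding cell_weight_def haar_shape_def w_def[symmetric] v a using parent by auto
  show "2 * cell_weight (Suc k) (2 * c + 1) t = cell_weight k c t - haar_shape k c (2^Suc k * t)"
    unfolding cell_weight_def haar_shape_def w_def[symmetric] v a using parent by auto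
qed

lemma cell_weight_split: "cell_weight (Suc k) (2 * c) t + cell_weight (Suc k) (2 * c + 1) t = cell_weight k c t"
  using cell_weight_Suc[of k c t] by linarith

lemma sum_lessThan_double: "(\<Sum>i<2 * n. f i) = (\<Sum>c<n. f (2 * c) + f (2 * c + 1 :: nat))"
  for f :: "nat \<Rightarrow> 'a::comm_monoid_add"
  by (induction n) (auto simp: algebra_simps)

lemma sum_cell_weight:
  assumes "0 \<le> t" "t \<le> 1"
  shows "(\<Sum>i<2^k. cell_weight k i t) = 1"
proof (induction k)
  case 0
  then show ?case using assms by (auto simp: cell_weight_def)
next
  case (Suc k)
  have "(\<Sum>i<2^Suc k. cell_weight (Suc k) i t) = (\<Sum>c<2^k. cell_weight (Suc k) (2 * c) t + cell_weight (Suc k) (2 * c + 1) t)"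
    using sum_lessThan_double[of "\<lambda>i. cell_weight (Suc k) i t" "2^k"] by simp
  then show ?case using Suc unfolding cell_weight_split by simp
qed

lemma cell_weight_support: "cell_weight k i t \<noteq> 0 \<Longrightarrow> real i / 2^k \<le> t \<and> t \<le> (real i + 1) / 2^k"
  by (auto simp: cell_weight_def field_simps split: if_splits)

text \<open>One argument may be a midpoint because the coefficients see the Haar functions only
  inside open cells, where they are constant. Of the functions that are new at level k + 1, only the
  one on the parent interval of \<open>i\<close> is nonzero at the midpoint, and
  \<open>cell_weight_Suc\<close> adds it in.\<close>

lemma haar_kernel:
  assumes t: "0 \<le> t" "t \<le> 1" and i: "i < 2^k"
  shows "(\<Sum>n\<in>{1..2^k}. haar n t * haar n (midpoint1 k i)) = 2^k * cell_weight k i t"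
  using i
proof (induction k arbitrary: i)
  case 0
  then show ?case using t by (auto simp: cell_weight_def)
next
  case (Suc k)
  define c where "c = i div 2"
  have c: "c < 2^k" using Suc.prems by (auto simp: c_def)
  define s where "s = (if even i then 1 else -1 :: real)"
  have m: "real c < 2^k * midpoint1 (Suc k) i" "2^k * midpoint1 (Suc k) i < real c + 1"
  proof -
    have "i = 2 * c \<or> i = 2 * c + 1" by (auto simp: c_def)
    then have "real i = 2 * real c \<or> real i = 2 * real c + 1" by auto
    moreover have "2^k * midpoint1 (Suc k) i = (real i + 1/2) / 2" by (simp add: midpoint1_def)
    ultimately show "real c < 2^k * midpoint1 (Suc k) i" "2^k * midpoint1 (Suc k) i < real c + 1" by auto
  qed
  have "(\<Sum>n\<in>{1..2^Suc k}. haar n t * haar n (midpoint1 (Suc k) i))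
      = (\<Sum>n\<in>{1..2^k}. haar n t * haar n (midpoint1 (Suc k) i))
        + (\<Sum>n\<in>{2^k+1..2^k+2^k}. haar n t * haar n (midpoint1 (Suc k) i))"
  proof -
    have "{1..2^Suc k} = {1..2^k} \<union> {2^k+1..2^k+2^k::nat}" by auto
    then show ?thesis by (simp only:) (intro sum.union_disjoint; auto)
  qed
  also have "(\<Sum>n\<in>{1..2^k}. haar n t * haar n (midpoint1 (Suc k) i)) = 2^k * cell_weight k c t"
    using Suc.IH[OF c] haar_const[OF _ m] by simp
  also have "(\<Sum>n\<in>{2^k+1..2^k+2^k}. haar n t * haar n (midpoint1 (Suc k) i))
      = (\<Sum>d<2^k. haar (2^k + Suc d) t * haar (2^k + Suc d) (midpoint1 (Suc k) i))"
    by (rule sum.reindex_bij_witness[of _ "\<lambda>d. 2^k + Suc d" "\<lambda>n. n - 2^k - 1"]) auto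
  also have "\<dots> = (\<Sum>d<2^k. if d = c then 2^k * (s * haar_shape k c (2^Suc k * t)) else 0)"
  proof (rule sum.cong[OF refl])
    fix d assume d: "d \<in> {..<2^k::nat}"
    have h: "haar (2^k + Suc d) (midpoint1 (Suc k) i) = sqrt (2^k) * (if i = 2 * d then 1 else if i = 2 * d + 1 then -1 else 0)"
      using haar_open[of k "Suc k" d i "midpoint1 (Suc k) i", OF _ _ midpoint1] d by simp
    have sq: "sqrt (2^k) * sqrt (2^k) = (2::real)^k" by simp
    show "haar (2^k + Suc d) t * haar (2^k + Suc d) (midpoint1 (Suc k) i) = (if d = c then 2^k * (s * haar_shape k c (2^Suc k * t)) else 0)"
    proof (cases "d = c")
      case True
      have "even i \<Longrightarrow> i = 2 * c" "odd i \<Longrightarrow> i = 2 * c + 1" by (auto simp: c_def)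
      then have "(if i = 2 * d then 1 else if i = 2 * d + 1 then -1 else 0 :: real) = s"
        using True by (cases "even i") (auto simp: s_def)
      then have "haar (2^k + Suc d) t * haar (2^k + Suc d) (midpoint1 (Suc k) i)
          = (sqrt (2^k) * sqrt (2^k)) * (s * haar_shape k d (2^Suc k * t))"
        using d unfolding h by (subst haar_eq_shape) auto
      then show ?thesis using True sq by simp
    next
      case False
      then have "i \<noteq> 2 * d" "i \<noteq> 2 * d + 1" by (auto simp: c_def)
      then show ?thesis using False h by simp
    qed
  qed
  also have "\<dots> = 2^k * (s * haar_shape k c (2^Suc k * t))" using c by simp
  also have "2^k * cell_weight k c t + 2^k * (s * haar_shape k c (2^Suc k * t)) = 2^k * (cell_weight k c t + s * haar_shape k c (2^Suc k * t))"
    by (simp add: algebra_simps)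
  also have "cell_weight k c t + s * haar_shape k c (2^Suc k * t) = 2 * cell_weight (Suc k) i t"
  proof (cases "even i")
    case True
    then have "i = 2 * c" by (simp add: c_def)
    then show ?thesis using True cell_weight_Suc(1)[of k c t] by (simp add: s_def)
  next
    case False
    then have "i = 2 * c + 1" by (simp add: c_def)
    then show ?thesis using False cell_weight_Suc(2)[of k c t] by (simp add: s_def)
  qed
  finally show ?case by simp
qed

section \<open>Cells, means and partial sums in several dimensions\<close>

definition cells :: "nat \<Rightarrow> ('n::finite \<Rightarrow> nat) set" where
  "cells k = {c. \<forall>s. c s < 2^k}"

definition cell :: "nat \<Rightarrow> ('n::finite \<Rightarrow> nat) \<Rightarrow> (real^'n) set" where
  "cell k c = cbox (\<chi> s. real (c s) / 2^k) (\<chi> s. (real (c s) + 1) / 2^k)"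

definition theta :: "nat \<Rightarrow> ('n::finite \<Rightarrow> nat) \<Rightarrow> real^'n \<Rightarrow> real" where
  "theta k c x = (\<Prod>s\<in>UNIV. cell_weight k (c s) (x $ s))"

text \<open>The product of the factors \<open>2^k\<close> is the reciprocal of the volume of the
  cell, so this is the mean of \<open>g\<close> over it.\<close>

definition avg :: "nat \<Rightarrow> ('n::finite \<Rightarrow> nat) \<Rightarrow> (real^'n \<Rightarrow> real) \<Rightarrow> real" where
  "avg k c g = (\<Prod>s\<in>(UNIV::'n set). 2^k) * integral (cell k c) g"

lemma cells_PiE: "cells k = UNIV \<rightarrow>\<^sub>E {..<2^k}"
  by (auto simp: cells_def)

lemma finite_cells [simp]: "finite (cells k)"
  unfolding cells_PiE by (intro finite_PiE) auto

lemma mem_cell: "x \<in> cell k c \<longleftrightarrow> (\<forall>s. real (c s) \<le> 2^k * x $ s \<and> 2^k * x $ s \<le> real (c s) + 1)"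
  unfolding cell_def mem_box_cart by (simp add: field_simps)

lemma cell_subset:
  assumes "c \<in> cells k"
  shows "cell k c \<subseteq> cbox 0 1"
proof
  fix x assume x: "x \<in> cell k c"
  have "0 \<le> x $ s \<and> x $ s \<le> 1" for s
  proof -
    have "c s + 1 \<le> 2^k" using assms by (simp add: cells_def Suc_leI)
    then have "real (c s + 1) \<le> real (2^k)" by (simp only: of_nat_le_iff)
    then have "real (c s) + 1 \<le> 2^k" by simp
    moreover have "real (c s) \<le> 2^k * x $ s" "2^k * x $ s \<le> real (c s) + 1" using x by (auto simp: mem_cell)
    ultimately have "2^k * 0 \<le> 2^k * x $ s" "2^k * x $ s \<le> 2^k * 1" by linarith+
    moreover have "(2::real)^k > 0" by simp
    ultimately show ?thesis
      using mult_le_cancel_left_pos[of "2^k" 0 "x $ s"] mult_le_cancel_left_pos[of "2^k" "x $ s" 1] by blast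
  qed
  then show "x \<in> cbox 0 1" by (simp add: mem_box_cart)
qed

lemma Union_cells: "(\<Union>c\<in>cells k. cell k c) = cbox 0 (1::real^'n::finite)"
proof
  show "cbox 0 (1::real^'n) \<subseteq> (\<Union>c\<in>cells k. cell k c)"
  proof
    fix x :: "real^'n" assume "x \<in> cbox 0 1"
    then have x: "0 \<le> x $ s" "x $ s \<le> 1" for s by (auto simp: mem_box_cart)
    have "\<exists>i<2^k. real i \<le> 2^k * x $ s \<and> 2^k * x $ s \<le> real i + 1" for s
    proof -
      have "(\<Sum>i<2^k. cell_weight k i (x $ s)) \<noteq> 0" using sum_cell_weight[OF x[of s]] by simp
      then obtain i where "i < 2^k" "cell_weight k i (x $ s) \<noteq> 0" by (meson lessThan_iff sum.neutral)
      then show ?thesis using cell_weight_support[of k i "x $ s"] by (intro exI[of _ i]) (auto simp: field_simps)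
    qed
    then obtain c where "\<And>s. c s < 2^k" "\<And>s. real (c s) \<le> 2^k * x $ s \<and> 2^k * x $ s \<le> real (c s) + 1" by metis
    then show "x \<in> (\<Union>c\<in>cells k. cell k c)" by (auto simp: cells_def mem_cell)
  qed
qed (use cell_subset in blast)

lemma negligible_cell_Int:
  assumes "c \<noteq> d"
  shows "negligible (cell k c \<inter> cell k d)"
proof -
  have *: "negligible (cell k c \<inter> cell k d)" if "c s < d s" for c d :: "'n::finite \<Rightarrow> nat" and s
  proof (rule negligible_subset)
    show "negligible {x::real^'n. x $ s = real (d s) / 2^k}" 
      by (simp add: cart_eq_inner_axis negligible_standard_hyperplane)
    show "cell k c \<inter> cell k d \<subseteq> {x. x $ s = real (d s) / 2^k}"
    proof
      fix x assume "x \<in> cell k c \<inter> cell k d"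
      then have "2^k * x $ s \<le> real (c s) + 1" "real (d s) \<le> 2^k * x $ s" by (auto simp: mem_cell)
      moreover have "real (c s) + 1 \<le> real (d s)" using that by simp
      ultimately have "2^k * x $ s = real (d s)" by linarith
      then show "x \<in> {x. x $ s = real (d s) / 2^k}" by (simp add: field_simps)
    qed
  qed
  obtain s where "c s \<noteq> d s" using assms by auto
  then consider "c s < d s" | "d s < c s" by linarith
  then show ?thesis
  proof cases
    case 1
    then show ?thesis by (rule *)
  next
    case 2
    then have "negligible (cell k d \<inter> cell k c)" by (rule *)
    then show ?thesis by (simp add: Int_commute)
  qed
qed

definition cell_mid :: "nat \<Rightarrow> ('n::finite \<Rightarrow> nat) \<Rightarrow> real^'n" where
  "cell_mid k c = (\<chi> s. midpoint1 k (c s))"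

lemma haar_multi_const:
  assumes N: "\<And>s. N s \<in> {1..2^k}" and x: "x \<in> box (\<chi> s. real (c s) / 2^k) (\<chi> s. (real (c s) + 1) / 2^k)"
  shows "haar_multi N x = haar_multi N (cell_mid k c)"
proof -
  have "real (c s) < 2^k * x $ s" "2^k * x $ s < real (c s) + 1" for s
    using x by (auto simp: mem_box_cart field_simps)
  then show ?thesis
    unfolding haar_multi_def cell_mid_def using haar_const[OF N] by (intro prod.cong) auto
qed

text \<open>Inside each cell the Haar function is constant, and the faces and overlaps of the cells
  are negligible.\<close>

lemma haar_coeff_cells:
  assumes g: "continuous_on (cbox 0 1) g" and N: "\<And>s. N s \<in> {1..2^k}"
  shows "haar_coeff g N = (\<Sum>c\<in>cells k. haar_multi N (cell_mid k c) * integral (cell k c) g)"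
proof -
  have "((\<lambda>x. g x * haar_multi N x) has_integral haar_multi N (cell_mid k c) * integral (cell k c) g) (cell k c)"
    if c: "c \<in> cells k" for c
  proof -
    have "g integrable_on cell k c"
      unfolding cell_def using continuous_on_subset[OF g cell_subset[OF c]]
      by (intro integrable_continuous) (simp add: cell_def)
    then have "((\<lambda>x. haar_multi N (cell_mid k c) * g x) has_integral haar_multi N (cell_mid k c) * integral (cell k c) g) (cell k c)"
      by (intro has_integral_mult_right integrable_integral)
    from has_integral_spike_interior[OF this[unfolded cell_def], of "\<lambda>x. g x * haar_multi N x"]
    show ?thesis
      unfolding cell_def using haar_multi_const[OF N, where c = c] by (simp add: mult.commute)
  qed
  then have "((\<lambda>x. g x * haar_multi N x) has_integral
      (\<Sum>c\<in>cells k. haar_multi N (cell_mid k c) * integral (cell k c) g)) (\<Union>c\<in>cells k. cell k c)"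
    by (intro has_integral_UN) (auto simp: pairwise_def intro: negligible_cell_Int)
  then show ?thesis unfolding haar_coeff_def Union_cells by (rule integral_unique)
qed

text \<open>The sum over multi-indices of products factorises into one-dimensional kernels, which
  turn each cell integral into a cell mean spread by \<open>theta\<close>.\<close>

lemma haar_sum_cells:
  fixes g :: "real^'n::finite \<Rightarrow> real"
  assumes g: "continuous_on (cbox 0 1) g" and x: "x \<in> cbox 0 1"
  shows "haar_sum g (2^k) x = (\<Sum>c\<in>cells k. avg k c g * theta k c x)"
proof -
  have set: "{N. \<forall>s::'n. N s \<in> {1..2^k}} = UNIV \<rightarrow>\<^sub>E {1..2^k::nat}" by (auto simp: PiE_def)
  have fin: "finite (UNIV \<rightarrow>\<^sub>E {1..2^k} :: ('n \<Rightarrow> nat) set)" by (intro finite_PiE) auto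
  have "haar_sum g (2^k) x
      = (\<Sum>N\<in>UNIV \<rightarrow>\<^sub>E {1..2^k}. \<Sum>c\<in>cells k. integral (cell k c) g * (haar_multi N x * haar_multi N (cell_mid k c)))"
    unfolding haar_sum_def set
  proof (rule sum.cong[OF refl])
    fix N assume "N \<in> (UNIV::'n set) \<rightarrow>\<^sub>E {1..2^k::nat}"
    then have "\<And>s. N s \<in> {1..2^k}" by auto
    from haar_coeff_cells[OF g this]
    show "haar_coeff g N * haar_multi N x = (\<Sum>c\<in>cells k. integral (cell k c) g * (haar_multi N x * haar_multi N (cell_mid k c)))"
      by (simp add: sum_distrib_left sum_distrib_right mult_ac)
  qed
  also have "\<dots> = (\<Sum>c\<in>cells k. integral (cell k c) g * (\<Sum>N\<in>UNIV \<rightarrow>\<^sub>E {1..2^k}. haar_multi N x * haar_multi N (cell_mid k c)))"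
    by (subst sum.swap) (simp add: sum_distrib_left)
  also have "\<dots> = (\<Sum>c\<in>cells k. avg k c g * theta k c x)"
  proof (rule sum.cong[OF refl])
    fix c :: "'n \<Rightarrow> nat" assume c: "c \<in> cells k"
    have "(\<Sum>N\<in>UNIV \<rightarrow>\<^sub>E {1..2^k}. haar_multi N x * haar_multi N (cell_mid k c))
        = (\<Sum>N\<in>UNIV \<rightarrow>\<^sub>E {1..2^k}. \<Prod>s\<in>(UNIV::'n set). haar (N s) (x $ s) * haar (N s) (midpoint1 k (c s)))"
      by (simp add: haar_multi_def cell_mid_def prod.distrib)
    also have "\<dots> = (\<Prod>s\<in>(UNIV::'n set). \<Sum>n\<in>{1..2^k}. haar n (x $ s) * haar n (midpoint1 k (c s)))"
      by (rule prod_sum_PiE[symmetric]) auto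
    also have "\<dots> = (\<Prod>s\<in>(UNIV::'n set). 2^k * cell_weight k (c s) (x $ s))"
      using x c by (intro prod.cong refl haar_kernel) (auto simp: mem_box_cart cells_def)
    also have "\<dots> = (\<Prod>s\<in>(UNIV::'n set). 2^k) * theta k c x" by (simp add: theta_def prod.distrib)
    finally show "integral (cell k c) g * (\<Sum>N\<in>UNIV \<rightarrow>\<^sub>E {1..2^k}. haar_multi N x * haar_multi N (cell_mid k c)) = avg k c g * theta k c x"
      by (simp add: avg_def)
  qed
  finally show ?thesis .
qed

definition parent :: "('n \<Rightarrow> nat) \<Rightarrow> 'n \<Rightarrow> nat" where
  "parent c = (\<lambda>s. c s div 2)"

lemma parent_cells: "c \<in> cells (Suc k) \<Longrightarrow> parent c \<in> cells k"
  by (simp add: cells_def parent_def less_mult_imp_div_less mult.commute)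

text \<open>In each coordinate the weights of the two halves add up to the weight of the whole;
  multiplying out over the coordinates lists all children of \<open>d\<close>.\<close>

lemma theta_split:
  assumes "d \<in> cells k"
  shows "theta k d x = (\<Sum>c\<in>{c\<in>cells (Suc k). parent c = d}. theta (Suc k) c x)"
proof -
  have "theta k d x = (\<Prod>s\<in>UNIV. \<Sum>i\<in>{2 * d s, 2 * d s + 1}. cell_weight (Suc k) i (x $ s))"
    unfolding theta_def using cell_weight_split by (intro prod.cong) auto
  also have "\<dots> = (\<Sum>c\<in>(\<Pi>\<^sub>E s\<in>UNIV. {2 * d s, 2 * d s + 1}). \<Prod>s\<in>UNIV. cell_weight (Suc k) (c s) (x $ s))"
    by (rule prod_sum_PiE) auto
  also have "(\<Pi>\<^sub>E s\<in>UNIV. {2 * d s, 2 * d s + 1}) = {c\<in>cells (Suc k). parent c = d}"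
  proof -
    have "a \<in> {2 * b, 2 * b + 1} \<longleftrightarrow> a < 2^Suc k \<and> a div 2 = b" if "b < 2^k" for a b :: nat
      using that by auto
    then have "(\<forall>s. c s \<in> {2 * d s, 2 * d s + 1}) \<longleftrightarrow> (\<forall>s. c s < 2^Suc k \<and> c s div 2 = d s)" for c
      using assms unfolding cells_def by blast
    then show ?thesis unfolding PiE_UNIV_domain cells_def parent_def by (auto simp: fun_eq_iff)
  qed
  finally show ?thesis by (simp add: theta_def)
qed

lemma sum_theta_parent:
  "(\<Sum>d\<in>cells k. A d * theta k d x) = (\<Sum>c\<in>cells (Suc k). A (parent c) * theta (Suc k) c x)"
proof -
  have "(\<Sum>d\<in>cells k. A d * theta k d x) = (\<Sum>d\<in>cells k. \<Sum>c\<in>{c\<in>cells (Suc k). parent c = d}. A (parent c) * theta (Suc k) c x)"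
    by (intro sum.cong refl) (simp add: theta_split sum_distrib_left)
  also have "\<dots> = (\<Sum>c\<in>cells (Suc k). A (parent c) * theta (Suc k) c x)"
    by (intro sum.group) (auto intro: parent_cells)
  finally show ?thesis .
qed

lemma theta_range: "0 \<le> theta k c x" "theta k c x \<le> 1"
  unfolding theta_def using cell_weight_range by (auto intro!: prod_nonneg prod_le_1)

lemma sum_theta:
  assumes "x \<in> cbox 0 1"
  shows "(\<Sum>c\<in>cells k. theta k c x) = 1"
proof -
  have "(\<Sum>c\<in>cells k. theta k c x) = (\<Prod>s\<in>UNIV. \<Sum>i\<in>{..<2^k}. cell_weight k i (x $ s))"
    unfolding cells_PiE theta_def by (rule prod_sum_PiE[symmetric]) auto
  also have "\<dots> = 1" using assms by (simp add: sum_cell_weight mem_box_cart)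
  finally show ?thesis .
qed

lemma level_fun_theta: "level_fun k (theta k c)"
proof -
  have cong: "cell_weight k i t = cell_weight k i u" if "\<lfloor>2^k * t\<rfloor> = \<lfloor>2^k * u\<rfloor>" "\<lceil>2^k * t\<rceil> = \<lceil>2^k * u\<rceil>" for i and t u :: real
  proof -
    define v w where "v = 2^k * t" and "w = 2^k * u"
    have *: "\<lfloor>v\<rfloor> = \<lfloor>w\<rfloor>" "\<lceil>v\<rceil> = \<lceil>w\<rceil>" using that by (auto simp: v_def w_def)
    have e: "v = real b \<longleftrightarrow> w = real b" for b
    proof -
      have "u = real b \<longleftrightarrow> int b \<le> \<lfloor>u\<rfloor> \<and> \<lceil>u\<rceil> \<le> int b" for u
        by (auto simp: le_floor_iff ceiling_le_iff)
      from this[of v] this[of w] show ?thesis using * by simp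
    qed
    have l: "real b < v \<longleftrightarrow> real b < w" for b
      using *(2) less_ceiling_iff[of "int b" v] less_ceiling_iff[of "int b" w] by simp
    have g: "v < real b \<longleftrightarrow> w < real b" for b
      using *(1) floor_less_iff[of v "int b"] floor_less_iff[of w "int b"] by simp
    show ?thesis
      unfolding cell_weight_def v_def[symmetric] w_def[symmetric]
      using e[of i] e[of "Suc i"] l[of i] g[of "Suc i"] by (simp add: add.commute)
  qed
  have "theta k c x = theta k c y" if "dyadic_code k x = dyadic_code k y" for x y
    unfolding theta_def using fun_cong[OF that] by (intro prod.cong refl cong) (auto simp: dyadic_code_def)
  then show ?thesis unfolding level_fun_def by blast
qed

definition delta :: "nat \<Rightarrow> ('n::finite \<Rightarrow> nat) \<Rightarrow> (real^'n \<Rightarrow> real) \<Rightarrow> real" where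
  "delta k c g = avg (Suc k) c g - avg k (parent c) g"

lemma haar_sum_diff:
  assumes "continuous_on (cbox 0 1) g" "x \<in> cbox 0 1"
  shows "haar_sum g (2^Suc k) x - haar_sum g (2^k) x = (\<Sum>c\<in>cells (Suc k). delta k c g * theta (Suc k) c x)"
proof -
  have "haar_sum g (2^k) x = (\<Sum>c\<in>cells (Suc k). avg k (parent c) g * theta (Suc k) c x)"
    unfolding haar_sum_cells[OF assms] by (rule sum_theta_parent)
  then show ?thesis
    unfolding haar_sum_cells[OF assms, of "Suc k"] delta_def
    by (simp add: sum_subtractf left_diff_distrib)
qed

context dyadic_content
begin

lemma haar_series_term_Suc:
  assumes "continuous_on (cbox 0 1) g"
  shows "haar_series_term \<nu> g (Suc k) \<omega> = (\<Sum>c\<in>cells (Suc k). delta k c g * ival (theta (Suc k) c) \<omega>)"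
proof -
  have "haar_series_term \<nu> g (Suc k) \<omega> = ival (\<lambda>x. \<Sum>c\<in>cells (Suc k). delta k c g * theta (Suc k) c x) \<omega>"
    unfolding haar_series_term_def using haar_sum_diff[OF assms, of _ k]
    by (simp del: power_Suc) (intro simple_int_cong; simp)
  also have "\<dots> = (\<Sum>c\<in>cells (Suc k). delta k c g * ival (theta (Suc k) c) \<omega>)"
    by (rule ival_sum) (rule level_fun_theta)
  finally show ?thesis .
qed

lemma haar_series_term_0:
  assumes "continuous_on (cbox 0 1) g"
  shows "haar_series_term \<nu> g 0 \<omega> = (\<Sum>c\<in>cells 0. avg 0 c g * ival (theta 0 c) \<omega>)"
proof -
  have "haar_series_term \<nu> g 0 \<omega> = ival (\<lambda>x. \<Sum>c\<in>cells 0. avg 0 c g * theta 0 c x) \<omega>"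
    unfolding haar_series_term_def using haar_sum_cells[OF assms, of _ 0]
    by simp (intro simple_int_cong; simp)
  also have "\<dots> = (\<Sum>c\<in>cells 0. avg 0 c g * ival (theta 0 c) \<omega>)"
    by (rule ival_sum) (rule level_fun_theta)
  finally show ?thesis .
qed

end

text \<open>On the unit cube the integrand is a combination of functions \<open>theta\<close>, whose
  level sets are dyadic, and there \<open>mu\<close> and \<nu> agree. Outside the cube this
  representation may fail, but \<open>simple_int\<close> does not look there.\<close>

lemma haar_series_term_content:
  assumes g: "continuous_on (cbox 0 1) g" and \<nu>: "\<forall>A\<in>dyadic_sets. \<nu> A \<omega> = mu A \<omega>"
  shows "haar_series_term mu g k \<omega> = haar_series_term \<nu> g k \<omega>"
proof -
  have lf: "level_fun k (\<lambda>x. \<Sum>c\<in>cells k. A c * theta k c x)" for k and A :: "('a \<Rightarrow> nat) \<Rightarrow> real"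
    unfolding level_fun_def
  proof (intro ballI impI sum.cong refl)
    fix x y :: "real^'a" and c assume "x \<in> cbox 0 1" "y \<in> cbox 0 1" "dyadic_code k x = dyadic_code k y"
    then have "theta k c x = theta k c y" using level_fun_theta[of k c] unfolding level_fun_def by blast
    then show "A c * theta k c x = A c * theta k c y" by simp
  qed
  have "simple_int mu (cbox 0 1) h \<omega> = simple_int \<nu> (cbox 0 1) h \<omega>"
    if "\<And>x. x \<in> cbox 0 1 \<Longrightarrow> h x = (\<Sum>c\<in>cells k. A c * theta k c x)" for h A k
  proof -
    let ?H = "\<lambda>x. \<Sum>c\<in>cells k. A c * theta k c x"
    have "simple_int mu (cbox 0 1) h \<omega> = simple_int mu (cbox 0 1) ?H \<omega>"
      by (rule simple_int_cong) (rule that)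
    also have "\<dots> = simple_int \<nu> (cbox 0 1) ?H \<omega>"
      by (rule simple_int_eq_content[OF lf]) (rule \<nu>)
    also have "\<dots> = simple_int \<nu> (cbox 0 1) h \<omega>"
      by (rule simple_int_cong) (rule that[symmetric])
    finally show ?thesis .
  qed
  from this[OF haar_sum_cells[OF g, of _ 0, simplified]] this[OF haar_sum_diff[OF g]]
  show ?thesis by (cases k) (simp_all add: haar_series_term_def)
qed

section \<open>Tensor Lagrange interpolation\<close>

text \<open>The derivative of the Taylor remainder is the remainder for \<open>u 1\<close>, and a
  function that vanishes at \<open>p\<close> with derivative at most h is at most h (t - p). Using a
  bound for the derivative on the whole interval, rather than integrating, reproduces the constant
  \<open>H\<close> in each step.\<close>

lemma taylor_hoelder:
  fixes u :: "nat \<Rightarrow> real \<Rightarrow> real"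
  assumes der: "\<And>r t. r < l \<Longrightarrow> t \<in> {p..q} \<Longrightarrow> (u r has_real_derivative u (Suc r) t) (at t within {p..q})"
    and hoelder: "\<And>t. t \<in> {p..q} \<Longrightarrow> \<bar>u l t - u l p\<bar> \<le> H * (t - p) powr \<alpha>"
    and H: "0 \<le> H" "0 < \<alpha>" and t: "t \<in> {p..q}"
  shows "\<bar>u 0 t - (\<Sum>r\<le>l. u r p / fact r * (t - p)^r)\<bar> \<le> H * (t - p) powr (real l + \<alpha>)"
  using der hoelder t
proof (induction l arbitrary: u t)
  case 0
  then show ?case by simp
next
  case (Suc l)
  define v where "v t = u 0 t - (\<Sum>r\<le>Suc l. u r p / fact r * (t - p)^r)" for t
  define v' where "v' t = u 1 t - (\<Sum>r\<le>l. u (Suc r) p / fact r * (t - p)^r)" for t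
  have v': "\<bar>v' s\<bar> \<le> H * (s - p) powr (real l + \<alpha>)" if "s \<in> {p..q}" for s
    using Suc.IH[of "\<lambda>r. u (Suc r)" s] Suc.prems that unfolding v'_def by simp
  have dv: "(v has_real_derivative v' s) (at s within {p..t})" if s: "s \<in> {p..t}" for s
  proof -
    have s': "s \<in> {p..q}" and sub: "{p..t} \<subseteq> {p..q}" using s Suc.prems(3) by auto
    have 1: "(u 0 has_real_derivative u 1 s) (at s within {p..t})"
      using DERIV_subset[OF Suc.prems(1)[of 0 s] sub] s' by simp
    have 2: "((\<lambda>t. \<Sum>r\<le>Suc l. u r p / fact r * (t - p)^r) has_real_derivative
        (\<Sum>r\<le>Suc l. u r p / fact r * (real r * (s - p)^(r - 1)))) (at s within {p..t})"
      by (intro derivative_eq_intros refl) (auto intro!: sum.cong simp: mult_ac)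
    have "(\<Sum>r\<le>Suc l. u r p / fact r * (real r * (s - p)^(r - 1)))
        = (\<Sum>r\<le>l. u (Suc r) p / fact (Suc r) * (real (Suc r) * (s - p)^r))"
      by (subst sum.atMost_Suc_shift) simp
    also have "\<dots> = (\<Sum>r\<le>l. u (Suc r) p / fact r * (s - p)^r)"
    proof (rule sum.cong[OF refl])
      fix r
      have "real (Suc r) \<noteq> 0" by simp
      then show "u (Suc r) p / fact (Suc r) * (real (Suc r) * (s - p)^r) = u (Suc r) p / fact r * (s - p)^r"
        unfolding fact_Suc by (simp only: times_divide_eq_left times_divide_eq_right mult.assoc mult_divide_mult_cancel_left)
          (simp add: field_simps del: of_nat_Suc)
    qed
    finally show ?thesis
      using DERIV_diff[OF 1 2] unfolding v_def v'_def by simp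
  qed
  have "v p = 0" unfolding v_def by (subst sum.atMost_Suc_shift) simp
  moreover have "norm (v t - v p) \<le> (H * (t - p) powr (real l + \<alpha>)) * norm (t - p)"
  proof (rule field_differentiable_bound[of "{p..t}" v v'])
    fix s assume s: "s \<in> {p..t}"
    have "\<bar>v' s\<bar> \<le> H * (s - p) powr (real l + \<alpha>)" using s Suc.prems(3) by (intro v') auto
    also have "\<dots> \<le> H * (t - p) powr (real l + \<alpha>)"
      using s H by (intro mult_left_mono powr_mono2) auto
    finally show "norm (v' s) \<le> H * (t - p) powr (real l + \<alpha>)" by simp
  qed (use dv Suc.prems(3) in auto)
  moreover have "(t - p) powr (real l + \<alpha>) * (t - p) = (t - p) powr (real (Suc l) + \<alpha>)"
  proof (cases "t = p")
    case False
    then have "t - p > 0" using Suc.prems(3) by simp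
    then have "(t - p) powr (real l + \<alpha>) * (t - p) powr 1 = (t - p) powr (real l + \<alpha> + 1)"
      by (simp only: powr_add)
    then show ?thesis using \<open>t - p > 0\<close> by (simp add: algebra_simps)
  qed simp
  ultimately have "\<bar>v t\<bar> \<le> H * (t - p) powr (real (Suc l) + \<alpha>)"
    using Suc.prems(3) by (simp add: mult.assoc)
  then show ?case by (simp add: v_def)
qed

section \<open>Lagrange interpolation on the unit interval\<close>

text \<open>Equidistant nodes in [0, 1). Dividing by \<open>Suc l\<close> and not by
  \<open>l\<close> includes the case \<open>l = 0\<close>, where the only node is 0.\<close>

definition tau :: "nat \<Rightarrow> nat \<Rightarrow> real" where "tau l i = real i / real (Suc l)"

definition lagrange :: "nat \<Rightarrow> nat \<Rightarrow> real poly" where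
  "lagrange l i = (\<Prod>j\<in>{..l} - {i}. smult (1 / (tau l i - tau l j)) [:- tau l j, 1:])"

lemma tau_range: "i \<le> l \<Longrightarrow> 0 \<le> tau l i" "i \<le> l \<Longrightarrow> tau l i \<le> 1"
  by (auto simp: tau_def field_simps)

lemma tau_inj: "tau l i = tau l j \<longleftrightarrow> i = j"
  by (simp add: tau_def field_simps)

lemma degree_lagrange: "i \<le> l \<Longrightarrow> degree (lagrange l i) \<le> l"
proof -
  assume i: "i \<le> l"
  have "degree (lagrange l i) \<le> (\<Sum>j\<in>{..l} - {i}. degree (smult (1 / (tau l i - tau l j)) [:- tau l j, 1:]))"
    unfolding lagrange_def by (rule order_trans[OF degree_prod_sum_le]) (simp_all only: o_def finite_Diff finite_atMost order_refl)
  also have "\<dots> \<le> (\<Sum>j\<in>{..l} - {i}. 1)" by (intro sum_mono) (auto intro: order_trans[OF degree_smult_le])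
  also have "\<dots> = l" using i by simp
  finally show ?thesis .
qed

lemma lagrange_tau:
  assumes "i \<le> l" "k \<le> l"
  shows "poly (lagrange l i) (tau l k) = (if i = k then 1 else 0)"
proof -
  have "poly (lagrange l i) (tau l k) = (\<Prod>j\<in>{..l} - {i}. (tau l k - tau l j) / (tau l i - tau l j))"
    unfolding lagrange_def poly_prod by (intro prod.cong) (auto simp: diff_divide_distrib)
  also have "\<dots> = (if i = k then 1 else 0)"
  proof (cases "i = k")
    case True
    then show ?thesis using tau_inj by (auto intro!: prod.neutral)
  next
    case False
    then show ?thesis using assms by (auto intro!: prod_zero bexI[of _ k])
  qed
  finally show ?thesis .
qed

text \<open>The error is a polynomial of degree at most \<open>l\<close> that has the l + 1 nodes as
  roots.\<close>

lemma lagrange_exact_ref: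
  assumes "degree p \<le> l"
  shows "poly p y = (\<Sum>i\<le>l. poly p (tau l i) * poly (lagrange l i) y)"
proof -
  define d where "d = p - (\<Sum>i\<le>l. smult (poly p (tau l i)) (lagrange l i))"
  have deg: "degree d \<le> l"
    unfolding d_def using assms degree_lagrange
    by (intro degree_diff_le degree_sum_le) (auto intro: order_trans[OF degree_smult_le])
  have root: "poly d (tau l k) = 0" if "k \<le> l" for k
  proof -
    have "(\<Sum>i\<le>l. poly p (tau l i) * poly (lagrange l i) (tau l k)) = (\<Sum>i\<le>l. if i = k then poly p (tau l i) else 0)"
      using that by (intro sum.cong) (auto simp: lagrange_tau)
    then show ?thesis using that by (simp add: d_def poly_sum)
  qed
  have "d = 0"
  proof (rule ccontr)
    assume d: "d \<noteq> 0"
    have "card (tau l ` {..l}) \<le> card {x. poly d x = 0}"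
      using root by (intro card_mono poly_roots_finite[OF d]) auto
    also have "\<dots> \<le> degree d" by (rule card_poly_roots_bound[OF d])
    finally show False using deg tau_inj by (simp add: card_image inj_on_def)
  qed
  then have "poly p y = poly (\<Sum>i\<le>l. smult (poly p (tau l i)) (lagrange l i)) y" by (simp add: d_def)
  then show ?thesis by (simp add: poly_sum)
qed

lemma degree_pcompose_linear: "degree (pcompose p [:a, b:]) \<le> degree p"
proof -
  have "degree p * degree [:a, b:] \<le> degree p * 1"
    by (intro mult_left_mono) (auto simp: degree_pCons_eq_if)
  then show ?thesis using degree_pcompose_le[of p "[:a, b:]"] by linarith
qed

lemma lagrange_exact:
  assumes "degree p \<le> l"
  shows "poly p t = (\<Sum>i\<le>l. poly p ((real c + tau l i) / 2^j) * poly (lagrange l i) (2^j * t - real c))"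
proof -
  define q where "q = pcompose p [:real c / 2^j, 1 / 2^j:]"
  have "degree q \<le> l" using assms degree_pcompose_linear order_trans unfolding q_def by blast
  from lagrange_exact_ref[OF this, of "2^j * t - real c"] show ?thesis
    by (simp add: q_def poly_pcompose field_simps)
qed

section \<open>Tensor interpolants on cells and their errors\<close>

definition node :: "nat \<Rightarrow> nat \<Rightarrow> ('n::finite \<Rightarrow> nat) \<Rightarrow> ('n \<Rightarrow> nat) \<Rightarrow> real^'n" where
  "node l j c \<nu> = (\<chi> s. (real (c s) + tau l (\<nu> s)) / 2^j)"

definition basis :: "nat \<Rightarrow> nat \<Rightarrow> ('n::finite \<Rightarrow> nat) \<Rightarrow> ('n \<Rightarrow> nat) \<Rightarrow> real^'n \<Rightarrow> real" where
  "basis l j c \<nu> x = (\<Prod>s\<in>UNIV. poly (lagrange l (\<nu> s)) (2^j * x $ s - real (c s)))"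

definition nodes :: "nat \<Rightarrow> ('n::finite \<Rightarrow> nat) set" where
  "nodes l = UNIV \<rightarrow>\<^sub>E {..l}"

definition interp :: "nat \<Rightarrow> nat \<Rightarrow> ('n::finite \<Rightarrow> nat) \<Rightarrow> (real^'n \<Rightarrow> real) \<Rightarrow> real^'n \<Rightarrow> real" where
  "interp l j c g x = (\<Sum>\<nu>\<in>nodes l. g (node l j c \<nu>) * basis l j c \<nu> x)"

lemma finite_nodes [simp]: "finite (nodes l)"
  unfolding nodes_def by (intro finite_PiE) auto

lemma node_cell: "\<nu> \<in> nodes l \<Longrightarrow> node l j c \<nu> \<in> cell j c"
  using tau_range[of _ l] by (auto simp: mem_cell node_def nodes_def PiE_iff)

text \<open>Basis functions have degree at most \<open>l\<close> in each variable, whichever cell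
  they come from, and tensor interpolation on any cell reproduces such polynomials.\<close>

lemma interp_basis:
  assumes \<nu>: "\<nu> \<in> nodes l"
  shows "interp l j c (basis l k d \<nu>) = basis l k d \<nu>"
proof
  fix x
  define p where "p s = pcompose (lagrange l (\<nu> s)) [:- real (d s), 2^k:]" for s
  have deg: "degree (p s) \<le> l" for s
    using \<nu> degree_lagrange[of "\<nu> s" l] order_trans[OF degree_pcompose_linear]
    by (auto simp: p_def nodes_def PiE_iff)
  have b: "basis l k d \<nu> x = (\<Prod>s\<in>UNIV. poly (p s) (x $ s))" for x
    unfolding basis_def p_def by (simp add: poly_pcompose mult.commute)
  have "basis l k d \<nu> x = (\<Prod>s\<in>UNIV. \<Sum>i\<in>{..l}. poly (p s) ((real (c s) + tau l i) / 2^j) * poly (lagrange l i) (2^j * x $ s - real (c s)))"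
    unfolding b using lagrange_exact[OF deg] by (intro prod.cong) auto
  also have "\<dots> = (\<Sum>\<nu>'\<in>nodes l. \<Prod>s\<in>UNIV. poly (p s) ((real (c s) + tau l (\<nu>' s)) / 2^j) * poly (lagrange l (\<nu>' s)) (2^j * x $ s - real (c s)))"
    unfolding nodes_def by (rule prod_sum_PiE) auto
  also have "\<dots> = interp l j c (basis l k d \<nu>) x"
    unfolding interp_def b by (simp add: node_def basis_def prod.distrib)
  finally show "interp l j c (basis l k d \<nu>) x = basis l k d \<nu> x" by simp
qed

text \<open>The difference of two interpolants is itself exactly interpolated on the finer cell, so its
  coefficients are values of the interpolation error of the coarser one.\<close>

lemma interp_diff:
  "interp l j c g x - interp l k d g x
    = (\<Sum>\<nu>\<in>nodes l. (g (node l j c \<nu>) - interp l k d g (node l j c \<nu>)) * basis l j c \<nu> x)"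
proof -
  have "(\<Sum>\<nu>\<in>nodes l. interp l k d g (node l j c \<nu>) * basis l j c \<nu> x)
      = (\<Sum>\<nu>'\<in>nodes l. g (node l k d \<nu>') * interp l j c (basis l k d \<nu>') x)"
    unfolding interp_def sum_distrib_left sum_distrib_right
    by (subst sum.swap) (simp add: mult.assoc)
  also have "\<dots> = interp l k d g x"
    unfolding interp_def[of l k] by (intro sum.cong) (simp_all add: interp_basis)
  finally show ?thesis by (simp add: interp_def[of l j] left_diff_distrib sum_subtractf)
qed

definition upd :: "real^'n::finite \<Rightarrow> 'n \<Rightarrow> real \<Rightarrow> real^'n" where
  "upd x s t = (\<chi> i. if i = s then t else x $ i)"

text \<open>Interpolation in the coordinates of \<open>S\<close> only. It leads by induction from
  one-dimensional errors to the full tensor interpolant.\<close>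

definition partial_interp :: "'n::finite set \<Rightarrow> nat \<Rightarrow> nat \<Rightarrow> ('n \<Rightarrow> nat) \<Rightarrow> (real^'n \<Rightarrow> real) \<Rightarrow> real^'n \<Rightarrow> real" where
  "partial_interp S l j c g x = (\<Sum>\<nu>\<in>S \<rightarrow>\<^sub>E {..l}. g (\<chi> s. if s \<in> S then (real (c s) + tau l (\<nu> s)) / 2^j else x $ s)
     * (\<Prod>s\<in>S. poly (lagrange l (\<nu> s)) (2^j * x $ s - real (c s))))"

lemma partial_interp_insert:
  assumes "s \<notin> S"
  shows "partial_interp (insert s S) l j c g x
    = (\<Sum>i\<le>l. poly (lagrange l i) (2^j * x $ s - real (c s)) * partial_interp S l j c g (upd x s ((real (c s) + tau l i) / 2^j)))"
proof -
  have fin: "finite S" by simp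
  let ?G = "\<lambda>\<nu>. g (\<chi> r. if r \<in> insert s S then (real (c r) + tau l (\<nu> r)) / 2^j else x $ r)
     * (\<Prod>r\<in>insert s S. poly (lagrange l (\<nu> r)) (2^j * x $ r - real (c r)))"
  have "partial_interp (insert s S) l j c g x = (\<Sum>(i, \<nu>)\<in>{..l} \<times> (S \<rightarrow>\<^sub>E {..l}). ?G (\<nu>(s := i)))"
    unfolding partial_interp_def PiE_insert_eq
    by (subst sum.reindex)
      (use inj_combinator[OF assms, of "\<lambda>_. {..l}"] in \<open>auto simp: case_prod_unfold intro!: sum.cong\<close>)
  also have "\<dots> = (\<Sum>i\<le>l. \<Sum>\<nu>\<in>S \<rightarrow>\<^sub>E {..l}. ?G (\<nu>(s := i)))"
    by (simp add: sum.cartesian_product)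
  also have "\<dots> = (\<Sum>i\<le>l. poly (lagrange l i) (2^j * x $ s - real (c s)) * partial_interp S l j c g (upd x s ((real (c s) + tau l i) / 2^j)))"
  proof (rule sum.cong[OF refl])
    fix i
    have 1: "(\<chi> r. if r \<in> insert s S then (real (c r) + tau l ((\<nu>(s := i)) r)) / 2^j else x $ r)
      = (\<chi> r. if r \<in> S then (real (c r) + tau l (\<nu> r)) / 2^j else upd x s ((real (c s) + tau l i) / 2^j) $ r)" for \<nu>
      using assms by (auto simp: upd_def vec_eq_iff)
    have 2: "(\<Prod>r\<in>insert s S. poly (lagrange l ((\<nu>(s := i)) r)) (2^j * x $ r - real (c r)))
      = poly (lagrange l i) (2^j * x $ s - real (c s)) *
        (\<Prod>r\<in>S. poly (lagrange l (\<nu> r)) (2^j * upd x s ((real (c s) + tau l i) / 2^j) $ r - real (c r)))" for \<nu>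
    proof -
      have "(\<Prod>r\<in>S. poly (lagrange l ((\<nu>(s := i)) r)) (2^j * x $ r - real (c r)))
        = (\<Prod>r\<in>S. poly (lagrange l (\<nu> r)) (2^j * upd x s ((real (c s) + tau l i) / 2^j) $ r - real (c r)))"
        using assms by (intro prod.cong) (auto simp: upd_def)
      then show ?thesis using assms by simp
    qed
    show "(\<Sum>\<nu>\<in>S \<rightarrow>\<^sub>E {..l}. ?G (\<nu>(s := i)))
      = poly (lagrange l i) (2^j * x $ s - real (c s)) * partial_interp S l j c g (upd x s ((real (c s) + tau l i) / 2^j))"
      unfolding 1 2 partial_interp_def sum_distrib_left by (intro sum.cong) (auto simp: mult_ac)
  qed
  finally show ?thesis .
qed

lemma partial_interp_UNIV: "partial_interp UNIV l j c g x = interp l j c g x"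
  by (simp add: partial_interp_def interp_def nodes_def node_def basis_def)

lemma lagrange_bound: "\<exists>K\<ge>1. \<forall>i\<le>l. \<forall>y\<in>{0..1}. \<bar>poly (lagrange l i) y\<bar> \<le> K \<and> (\<forall>z\<in>{0..1}. \<bar>poly (lagrange l i) y - poly (lagrange l i) z\<bar> \<le> K * \<bar>y - z\<bar>)"
proof -
  have "\<exists>K. \<forall>y\<in>{0..1}. \<bar>poly p y\<bar> \<le> K" for p :: "real poly"
  proof -
    have "bounded (poly p ` {0..1})"
      by (intro compact_imp_bounded compact_continuous_image continuous_intros) auto
    then show ?thesis by (auto simp: bounded_iff)
  qed
  then obtain B :: "real poly \<Rightarrow> real" where B: "\<And>p y. y \<in> {0..1} \<Longrightarrow> \<bar>poly p y\<bar> \<le> B p" by metis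
  define K where "K = 1 + (\<Sum>i\<le>l. \<bar>B (lagrange l i)\<bar> + \<bar>B (pderiv (lagrange l i))\<bar>)"
  have K: "B (lagrange l i) \<le> K" "B (pderiv (lagrange l i)) \<le> K" if "i \<le> l" for i
  proof -
    have "\<bar>B (lagrange l i)\<bar> + \<bar>B (pderiv (lagrange l i))\<bar> \<le> (\<Sum>i\<le>l. \<bar>B (lagrange l i)\<bar> + \<bar>B (pderiv (lagrange l i))\<bar>)"
      using that by (intro member_le_sum) auto
    then show "B (lagrange l i) \<le> K" "B (pderiv (lagrange l i)) \<le> K" unfolding K_def by linarith+
  qed
  have "1 \<le> K" unfolding K_def by (simp add: sum_nonneg)
  moreover have "\<bar>poly (lagrange l i) y\<bar> \<le> K" if "i \<le> l" "y \<in> {0..1}" for i y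
    using B[OF that(2), of "lagrange l i"] K(1)[OF that(1)] by linarith
  moreover have "\<bar>poly (lagrange l i) y - poly (lagrange l i) z\<bar> \<le> K * \<bar>y - z\<bar>" if "i \<le> l" "y \<in> {0..1}" "z \<in> {0..1}" for i y z
  proof -
    have "norm (poly (lagrange l i) y - poly (lagrange l i) z) \<le> K * norm (y - z)"
    proof (rule field_differentiable_bound[of "{0..1}" _ "poly (pderiv (lagrange l i))"])
      fix w :: real assume w: "w \<in> {0..1}"
      show "(poly (lagrange l i) has_field_derivative poly (pderiv (lagrange l i)) w) (at w within {0..1})"
        by (rule has_field_derivative_at_within) (rule poly_DERIV)
      show "norm (poly (pderiv (lagrange l i)) w) \<le> K" using B[OF w, of "pderiv (lagrange l i)"] K(2)[OF that(1)] by simp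
    qed (use that in auto)
    then show ?thesis by simp
  qed
  ultimately show ?thesis by blast
qed

lemma cell_ref: "x \<in> cell j c \<Longrightarrow> 2^j * x $ s - real (c s) \<in> {0..1}"
  unfolding mem_cell by (drule spec[of _ s]) auto

lemma upd_cell:
  assumes "x \<in> cell j c" "i \<le> l"
  shows "upd x s ((real (c s) + tau l i) / 2^j) \<in> cell j c"
  using assms tau_range[of i l] by (auto simp: mem_cell upd_def)

text \<open>The coordinates are treated one after another: each adds the one-dimensional error and
  magnifies the previous error by the size of the Lagrange polynomials. So \<open>A\<close> depends
  on \<open>l\<close> and the dimension, but neither on the cell nor on \<open>g\<close>.\<close>

lemma interp_error_tensor:
  "\<exists>A\<ge>0. \<forall>j c (g :: real^'n::finite \<Rightarrow> real) e.
    (\<forall>x\<in>cell j c. \<forall>s. \<bar>g x - (\<Sum>i\<le>l. g (upd x s ((real (c s) + tau l i) / 2^j)) * poly (lagrange l i) (2^j * x $ s - real (c s)))\<bar> \<le> e)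
    \<longrightarrow> (\<forall>x\<in>cell j c. \<bar>g x - interp l j c g x\<bar> \<le> A * e)"
proof -
  obtain K where K: "K \<ge> 1" "\<And>i y. i \<le> l \<Longrightarrow> y \<in> {0..1} \<Longrightarrow> \<bar>poly (lagrange l i) y\<bar> \<le> K"
    using lagrange_bound[of l] by blast
  have "\<exists>A\<ge>0. \<forall>j c (g :: real^'n \<Rightarrow> real) e.
    (\<forall>x\<in>cell j c. \<forall>s. \<bar>g x - (\<Sum>i\<le>l. g (upd x s ((real (c s) + tau l i) / 2^j)) * poly (lagrange l i) (2^j * x $ s - real (c s)))\<bar> \<le> e)
    \<longrightarrow> (\<forall>x\<in>cell j c. \<bar>g x - partial_interp S l j c g x\<bar> \<le> A * e)" if "finite S" for S
    using that
  proof (induction S rule: finite_induct)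
    case empty
    then show ?case by (intro exI[of _ 0]) (simp add: partial_interp_def)
  next
    case (insert s S)
    then obtain A where A: "A \<ge> 0" "\<And>j c (g :: real^'n \<Rightarrow> real) e x.
      (\<forall>x\<in>cell j c. \<forall>s. \<bar>g x - (\<Sum>i\<le>l. g (upd x s ((real (c s) + tau l i) / 2^j)) * poly (lagrange l i) (2^j * x $ s - real (c s)))\<bar> \<le> e)
      \<Longrightarrow> x \<in> cell j c \<Longrightarrow> \<bar>g x - partial_interp S l j c g x\<bar> \<le> A * e" by blast
    have "\<bar>g x - partial_interp (insert s S) l j c g x\<bar> \<le> (1 + real (Suc l) * K * A) * e"
      if e: "\<forall>x\<in>cell j c. \<forall>s. \<bar>g x - (\<Sum>i\<le>l. g (upd x s ((real (c s) + tau l i) / 2^j)) * poly (lagrange l i) (2^j * x $ s - real (c s)))\<bar> \<le> e"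
        and x: "x \<in> cell j c" for j c e x and g :: "real^'n \<Rightarrow> real"
    proof -
      let ?x = "\<lambda>i. upd x s ((real (c s) + tau l i) / 2^j)" and ?L = "\<lambda>i. poly (lagrange l i) (2^j * x $ s - real (c s))"
      have "\<bar>\<Sum>i\<le>l. ?L i * (g (?x i) - partial_interp S l j c g (?x i))\<bar> \<le> (\<Sum>i\<le>l. K * (A * e))"
      proof (rule order_trans[OF sum_abs sum_mono])
        fix i assume "i \<in> {..l}"
        then show "\<bar>?L i * (g (?x i) - partial_interp S l j c g (?x i))\<bar> \<le> K * (A * e)"
          unfolding abs_mult using K(1) A(2)[OF e upd_cell[OF x]] K(2)[OF _ cell_ref[OF x]]
          by (intro mult_mono) auto
      qed
      also have "\<dots> = real (Suc l) * K * A * e" by simp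
      finally have 1: "\<bar>\<Sum>i\<le>l. ?L i * (g (?x i) - partial_interp S l j c g (?x i))\<bar> \<le> real (Suc l) * K * A * e" .
      have "\<bar>g x - (\<Sum>i\<le>l. g (?x i) * ?L i)\<bar> \<le> e" using e x by blast
      moreover have "g x - partial_interp (insert s S) l j c g x
          = (g x - (\<Sum>i\<le>l. g (?x i) * ?L i)) + (\<Sum>i\<le>l. ?L i * (g (?x i) - partial_interp S l j c g (?x i)))"
        unfolding partial_interp_insert[OF insert.hyps(2)] by (simp add: right_diff_distrib sum_subtractf mult.commute)
      ultimately show ?thesis using 1 by (simp add: algebra_simps)
    qed
    moreover have "0 \<le> 1 + real (Suc l) * K * A" using K(1) A(1) by simp
    ultimately show ?case by blast
  qed
  from this[of UNIV] show ?thesis unfolding partial_interp_UNIV by simp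
qed

text \<open>The Taylor polynomial at the left end of the interval is reproduced exactly. Hence only
  its remainder is interpolated, which costs the factor 1 + (l + 1) K.\<close>

lemma interp_error_1d:
  fixes u :: "nat \<Rightarrow> real \<Rightarrow> real"
  assumes der: "\<And>r t. r < l \<Longrightarrow> t \<in> {0..1} \<Longrightarrow> (u r has_real_derivative u (Suc r) t) (at t within {0..1})"
    and hoelder: "\<And>t t'. t \<in> {0..1} \<Longrightarrow> t' \<in> {0..1} \<Longrightarrow> \<bar>u l t - u l t'\<bar> \<le> H * \<bar>t - t'\<bar> powr \<alpha>"
    and H: "0 \<le> H" "0 < \<alpha>" and K: "K \<ge> 1" "\<And>i y. i \<le> l \<Longrightarrow> y \<in> {0..1} \<Longrightarrow> \<bar>poly (lagrange l i) y\<bar> \<le> K"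
    and c: "c < 2^j" and t: "real c \<le> 2^j * t" "2^j * t \<le> real c + 1"
  shows "\<bar>u 0 t - (\<Sum>i\<le>l. u 0 ((real c + tau l i) / 2^j) * poly (lagrange l i) (2^j * t - real c))\<bar>
    \<le> (1 + real (Suc l) * K) * (H * (1 / 2^j) powr (real l + \<alpha>))"
proof -
  define p q where "p = real c / 2^j" and "q = (real c + 1) / 2^j"
  define e where "e = H * (1 / 2^j) powr (real l + \<alpha>)"
  have "real (c + 1) \<le> real (2^j)" using c by (simp only: of_nat_le_iff)
  then have sub: "{p..q} \<subseteq> {0..1}" by (auto simp: p_def q_def field_simps)
  define T where "T = (\<Sum>r\<le>l. monom (u r p / fact r) r)"
  define P where "P = pcompose T [:- p, 1:]"
  have "degree T \<le> l" unfolding T_def by (intro degree_sum_le) (auto intro: order_trans[OF degree_monom_le])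
  then have degP: "degree P \<le> l" unfolding P_def by (rule order_trans[OF degree_pcompose_linear])
  have P: "poly P t = (\<Sum>r\<le>l. u r p / fact r * (t - p)^r)" for t
    by (simp add: P_def T_def poly_pcompose poly_sum poly_monom)
  have R: "\<bar>u 0 s - poly P s\<bar> \<le> e" if s: "s \<in> {p..q}" for s
  proof -
    have "\<bar>u 0 s - poly P s\<bar> \<le> H * (s - p) powr (real l + \<alpha>)"
      unfolding P
    proof (rule taylor_hoelder[OF _ _ H s])
      show "(u r has_real_derivative u (Suc r) t) (at t within {p..q})" if "r < l" "t \<in> {p..q}" for r t
        using der[OF that(1), of t] that(2) sub by (auto intro: DERIV_subset)
      show "\<bar>u l t - u l p\<bar> \<le> H * (t - p) powr \<alpha>" if "t \<in> {p..q}" for t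
        using hoelder[of t p] that sub by (auto simp: subset_eq)
    qed
    also have "\<dots> \<le> e"
      unfolding e_def using s H by (intro mult_left_mono powr_mono2) (auto simp: p_def q_def add_divide_distrib)
    finally show ?thesis .
  qed
  let ?n = "\<lambda>i. (real c + tau l i) / 2^j" and ?L = "\<lambda>i. poly (lagrange l i) (2^j * t - real c)"
  have n: "?n i \<in> {p..q}" if "i \<le> l" for i
    using tau_range[OF that] by (auto simp: p_def q_def divide_right_mono)
  have tpq: "t \<in> {p..q}" using t by (auto simp: p_def q_def field_simps)
  have "\<bar>\<Sum>i\<le>l. (u 0 (?n i) - poly P (?n i)) * ?L i\<bar> \<le> (\<Sum>i\<le>l. e * K)"
  proof (rule order_trans[OF sum_abs sum_mono])
    fix i assume i: "i \<in> {..l}"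
    have "0 \<le> e" unfolding e_def using H by simp
    then show "\<bar>(u 0 (?n i) - poly P (?n i)) * ?L i\<bar> \<le> e * K"
      unfolding abs_mult using i R[OF n] K(2)[of i "2^j * t - real c"] t by (intro mult_mono) auto
  qed
  also have "\<dots> = real (Suc l) * K * e" by simp
  finally have 1: "\<bar>\<Sum>i\<le>l. (u 0 (?n i) - poly P (?n i)) * ?L i\<bar> \<le> real (Suc l) * K * e" .
  have "u 0 t - (\<Sum>i\<le>l. u 0 (?n i) * ?L i) = (u 0 t - poly P t) - (\<Sum>i\<le>l. (u 0 (?n i) - poly P (?n i)) * ?L i)"
    using lagrange_exact[OF degP, of t c j] by (simp add: left_diff_distrib sum_subtractf)
  then show ?thesis using 1 R[OF tpq] unfolding e_def[symmetric] by (simp add: algebra_simps)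
qed

lemma basis_bound: "\<exists>K\<ge>1. \<forall>\<nu>\<in>(nodes l :: ('n::finite \<Rightarrow> nat) set). \<forall>j c. \<forall>x\<in>cell j c.
    \<bar>basis l j c \<nu> x\<bar> \<le> K \<and>
    (\<forall>y\<in>cell j c. \<forall>d. (\<forall>s. 2^j * \<bar>x $ s - y $ s\<bar> \<le> d) \<longrightarrow> \<bar>basis l j c \<nu> x - basis l j c \<nu> y\<bar> \<le> K * d)"
proof -
  obtain K where K: "K \<ge> 1" "\<And>i y. i \<le> l \<Longrightarrow> y \<in> {0..1} \<Longrightarrow> \<bar>poly (lagrange l i) y\<bar> \<le> K"
    "\<And>i y z. i \<le> l \<Longrightarrow> y \<in> {0..1} \<Longrightarrow> z \<in> {0..1} \<Longrightarrow> \<bar>poly (lagrange l i) y - poly (lagrange l i) z\<bar> \<le> K * \<bar>y - z\<bar>"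
    using lagrange_bound[of l] by blast
  define n where "n = CARD('n)"
  have n: "n > 0" by (simp add: n_def)
  define K' where "K' = K^n * real n"
  have K1: "K^n \<ge> 1" using K(1) by (rule one_le_power)
  have "K^n * 1 \<le> K'" unfolding K'_def using K1 n by (intro mult_left_mono) auto
  then have K': "K' \<ge> 1" "K^n \<le> K'" using K1 by auto
  have bd: "\<bar>basis l j c \<nu> x\<bar> \<le> K'" if \<nu>: "\<nu> \<in> nodes l" and x: "x \<in> cell j c" for \<nu> j c and x :: "real^'n"
  proof -
    have "\<bar>basis l j c \<nu> x\<bar> = (\<Prod>s\<in>UNIV. \<bar>poly (lagrange l (\<nu> s)) (2^j * x $ s - real (c s))\<bar>)"
      by (simp add: basis_def abs_prod)
    also have "\<dots> \<le> (\<Prod>s\<in>(UNIV::'n set). K)"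
      using K(2)[OF _ cell_ref[OF x]] \<nu> by (intro prod_mono) (auto simp: nodes_def PiE_iff)
    also have "\<dots> \<le> K'" using K'(2) by (simp add: n_def)
    finally show ?thesis .
  qed
  have lip: "\<bar>basis l j c \<nu> x - basis l j c \<nu> y\<bar> \<le> K' * d"
    if \<nu>: "\<nu> \<in> nodes l" and x: "x \<in> cell j c" and y: "y \<in> cell j c" and d: "\<forall>s. 2^j * \<bar>x $ s - y $ s\<bar> \<le> d"
    for \<nu> j c d and x y :: "real^'n"
  proof -
    \<comment> \<open>Dividing by \<open>K\<close> brings all factors into [-1, 1], as
      \<open>norm_prod_diff\<close> demands for its telescoping estimate.\<close>
    define a b where "a s = poly (lagrange l (\<nu> s)) (2^j * x $ s - real (c s)) / K"
      and "b s = poly (lagrange l (\<nu> s)) (2^j * y $ s - real (c s)) / K" for s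
    have \<nu>': "\<nu> s \<le> l" for s using \<nu> by (auto simp: nodes_def PiE_iff)
    have ab: "\<bar>a s\<bar> \<le> 1" "\<bar>b s\<bar> \<le> 1" for s
      using K(1) K(2)[OF \<nu>' cell_ref[OF x]] K(2)[OF \<nu>' cell_ref[OF y]] by (auto simp: a_def b_def)
    have diff: "\<bar>a s - b s\<bar> \<le> d" for s
    proof -
      have "\<bar>a s - b s\<bar> = \<bar>poly (lagrange l (\<nu> s)) (2^j * x $ s - real (c s)) - poly (lagrange l (\<nu> s)) (2^j * y $ s - real (c s))\<bar> / K"
        using K(1) by (simp add: a_def b_def flip: diff_divide_distrib)
      also have "\<dots> \<le> (K * \<bar>(2^j * x $ s - real (c s)) - (2^j * y $ s - real (c s))\<bar>) / K"
        using K(1) by (intro divide_right_mono K(3)[OF \<nu>' cell_ref[OF x] cell_ref[OF y]]) auto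
      also have "\<dots> = \<bar>2^j * (x $ s - y $ s)\<bar>" using K(1) by (simp add: right_diff_distrib)
      also have "\<dots> = 2^j * \<bar>x $ s - y $ s\<bar>" by (simp add: abs_mult)
      finally show ?thesis using d by (meson order_trans)
    qed
    have "norm ((\<Prod>s\<in>UNIV. a s) - (\<Prod>s\<in>UNIV. b s)) \<le> (\<Sum>s\<in>(UNIV::'n set). norm (a s - b s))"
      using ab by (intro norm_prod_diff) auto
    also have "\<dots> \<le> (\<Sum>s\<in>(UNIV::'n set). d)" using diff by (intro sum_mono) auto
    finally have "\<bar>(\<Prod>s\<in>UNIV. a s) - (\<Prod>s\<in>UNIV. b s)\<bar> \<le> real n * d" by (simp add: n_def)
    moreover have "basis l j c \<nu> x = K^n * (\<Prod>s\<in>UNIV. a s)" "basis l j c \<nu> y = K^n * (\<Prod>s\<in>UNIV. b s)"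
      using K(1) by (simp_all add: basis_def a_def b_def n_def prod_dividef)
    ultimately have "\<bar>basis l j c \<nu> x - basis l j c \<nu> y\<bar> \<le> K^n * (real n * d)"
      using K1 by (simp add: abs_mult flip: right_diff_distrib)
    then show ?thesis by (simp add: K'_def mult.assoc)
  qed
  show ?thesis using K'(1) bd lip by blast
qed

section \<open>Cell means and their increments\<close>

lemma content_cell: "measure lborel (cell k c) = (\<Prod>s\<in>(UNIV::'n::finite set). 1 / 2^k)" for c :: "'n::finite \<Rightarrow> nat"
proof -
  have "(\<chi> s. real (c s) / 2^k) \<in> cell k c" by (simp add: mem_cell)
  then have "cbox (\<chi> s. real (c s) / 2^k) (\<chi> s. (real (c s) + 1) / 2^k) \<noteq> {}" by (auto simp: cell_def)
  then have "measure lborel (cell k c) = (\<Prod>s\<in>UNIV. (real (c s) + 1) / 2^k - real (c s) / 2^k)"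
    unfolding cell_def by (subst content_cbox_cart) auto
  then show ?thesis by (simp add: add_divide_distrib)
qed

lemma avg_const: "avg k c (\<lambda>_. v) = v"
proof -
  have "integral (cell k c) (\<lambda>_. v) = measure lborel (cell k c) * v" unfolding cell_def by simp
  moreover have "(\<Prod>s\<in>(UNIV::'a set). 2^k) * (\<Prod>s\<in>(UNIV::'a set). 1 / 2^k) = (1::real)"
    by (subst prod.distrib[symmetric]) simp
  ultimately show ?thesis by (simp only: avg_def content_cell mult.assoc[symmetric] mult_1_left)
qed

lemma avg_sum:
  assumes "\<And>i. i \<in> I \<Longrightarrow> continuous_on (cell k c) (h i)" "finite I"
  shows "avg k c (\<lambda>x. \<Sum>i\<in>I. a i * h i x) = (\<Sum>i\<in>I. a i * avg k c (h i))"
proof -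
  have "h i integrable_on cell k c" if "i \<in> I" for i
    using assms(1)[OF that] unfolding cell_def by (rule integrable_continuous)
  then have "integral (cell k c) (\<lambda>x. \<Sum>i\<in>I. a i * h i x) = (\<Sum>i\<in>I. a i * integral (cell k c) (h i))"
    using assms(2) by (subst integral_sum) (auto intro: integrable_on_mult_right)
  then show ?thesis by (simp add: avg_def sum_distrib_left mult_ac)
qed

lemma avg_bound:
  assumes "continuous_on (cell k c) g" "\<And>x. x \<in> cell k c \<Longrightarrow> \<bar>g x - v\<bar> \<le> e"
  shows "\<bar>avg k c g - v\<bar> \<le> e"
proof -
  have int: "g integrable_on cell k c" "(\<lambda>_. w) integrable_on cell k c" for w :: real
    using assms(1) unfolding cell_def by (auto intro: integrable_continuous)
  have pos: "0 \<le> (\<Prod>s\<in>(UNIV::'a set). 2^k :: real)" by (intro prod_nonneg) auto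
  have b: "v - e \<le> g x" "g x \<le> v + e" if "x \<in> cell k c" for x using assms(2)[OF that] by linarith+
  have "avg k c (\<lambda>_. v - e) \<le> avg k c g" "avg k c g \<le> avg k c (\<lambda>_. v + e)"
    unfolding avg_def using b by (auto intro!: mult_left_mono[OF _ pos] integral_le int)
  then show ?thesis unfolding avg_const by linarith
qed

lemma cell_parent: "cell (Suc k) c \<subseteq> cell k (parent c)"
proof
  fix x assume x: "x \<in> cell (Suc k) c"
  have "real (parent c s) \<le> 2^k * x $ s \<and> 2^k * x $ s \<le> real (parent c s) + 1" for s
  proof -
    have "real (c s) \<le> 2 * (2^k * x $ s)" "2 * (2^k * x $ s) \<le> real (c s) + 1" using x by (auto simp: mem_cell mult.assoc)
    moreover have "c s = 2 * parent c s \<or> c s = 2 * parent c s + 1" by (auto simp: parent_def)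
    then have "real (c s) = 2 * real (parent c s) \<or> real (c s) = 2 * real (parent c s) + 1" by auto
    ultimately show ?thesis by auto
  qed
  then show "x \<in> cell k (parent c)" by (simp add: mem_cell)
qed

lemma delta_sum:
  assumes "\<And>i. i \<in> I \<Longrightarrow> continuous_on (cell k (parent c)) (h i)" "finite I"
  shows "delta k c (\<lambda>x. \<Sum>i\<in>I. a i * h i x) = (\<Sum>i\<in>I. a i * delta k c (h i))"
proof -
  have "continuous_on (cell (Suc k) c) (h i)" if "i \<in> I" for i
    by (rule continuous_on_subset[OF assms(1)[OF that] cell_parent])
  from avg_sum[OF this assms(2), where a = a] avg_sum[OF assms, where a = a] show ?thesis
    by (simp add: delta_def right_diff_distrib sum_subtractf)
qed

lemma delta_bound:
  assumes "continuous_on (cell k (parent c)) g" "\<And>x. x \<in> cell k (parent c) \<Longrightarrow> \<bar>g x - v\<bar> \<le> e"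
  shows "\<bar>delta k c g\<bar> \<le> 2 * e"
proof -
  have "\<bar>avg (Suc k) c g - v\<bar> \<le> e" "\<bar>avg k (parent c) g - v\<bar> \<le> e"
    using assms cell_parent[of k c] by (auto intro!: avg_bound continuous_on_subset[OF assms(1)])
  then show ?thesis unfolding delta_def by linarith
qed

definition ancestor :: "nat \<Rightarrow> nat \<Rightarrow> ('n \<Rightarrow> nat) \<Rightarrow> 'n \<Rightarrow> nat" where
  "ancestor k j c = (\<lambda>s. c s div 2^(k - j))"

lemma ancestor_cells:
  assumes "c \<in> cells k" "j \<le> k"
  shows "ancestor k j c \<in> cells j"
proof -
  have "c s < 2^j * 2^(k - j)" for s
    using assms by (simp add: cells_def flip: power_add)
  then show ?thesis by (simp add: cells_def ancestor_def less_mult_imp_div_less)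
qed

lemma ancestor_Suc: "j < k \<Longrightarrow> parent (ancestor k (Suc j) c) = ancestor k j c"
proof -
  assume "j < k"
  then have "(2::nat)^(k - j) = 2^(k - Suc j) * 2" by (simp flip: power_Suc2 add: Suc_diff_Suc)
  then show ?thesis by (simp add: parent_def ancestor_def div_mult2_eq)
qed

lemma ancestor_self [simp]: "ancestor k k c = c"
  by (simp add: ancestor_def)

lemma ancestor_parent: "ancestor (Suc k) k c = parent c"
  by (simp add: ancestor_def parent_def)

lemma cell_ancestor:
  assumes "j \<le> k"
  shows "cell k c \<subseteq> cell j (ancestor k j c)"
  using assms
proof (induction j rule: inc_induct)
  case (step j)
  have "cell (Suc j) (ancestor k (Suc j) c) \<subseteq> cell j (parent (ancestor k (Suc j) c))" by (rule cell_parent)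
  then show ?case using step ancestor_Suc[of j k c] by auto
qed simp

lemma card_cells: "card (cells k :: ('n::finite \<Rightarrow> nat) set) = (2 ^ CARD('n)) ^ k"
  by (simp add: cells_PiE card_PiE mult.commute flip: power_mult)

lemma continuous_basis: "continuous_on S (basis l j c \<nu>)"
  unfolding basis_def by (intro continuous_intros)

lemma delta_add:
  assumes "continuous_on (cell k (parent c)) u" "continuous_on (cell k (parent c)) v"
  shows "delta k c (\<lambda>x. u x + v x) = delta k c u + delta k c v"
  using delta_sum[of UNIV k c "\<lambda>b. if b then u else v" "\<lambda>_. 1"] assms by (simp add: UNIV_bool add.commute)

text \<open>A basis function is Lipschitz in the coordinates of its own cell, where lengths are
  multiplied by \<open>2^j\<close>. In these a cell of level \<open>k\<close> has side
  \<open>1 / 2^(k - j)\<close>, so the increment of the means decays accordingly.\<close>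

lemma delta_basis:
  fixes \<nu> c :: "'n::finite \<Rightarrow> nat"
  assumes K: "K \<ge> 1" "\<And>\<nu> j c x y d. \<nu> \<in> (nodes l :: ('n \<Rightarrow> nat) set) \<Longrightarrow> x \<in> cell j c \<Longrightarrow> y \<in> cell j c \<Longrightarrow>
      (\<forall>s. 2^j * \<bar>x $ s - y $ s\<bar> \<le> d) \<Longrightarrow> \<bar>basis l j c \<nu> x - basis l j c \<nu> y\<bar> \<le> K * d"
    and \<nu>: "\<nu> \<in> nodes l" and j: "j \<le> k"
  shows "\<bar>delta k c (basis l j (ancestor (Suc k) j c) \<nu>)\<bar> \<le> 2 * K / 2^(k - j)"
proof -
  let ?Q = "ancestor (Suc k) j c"
  define y where "y = (\<chi> s. real (parent c s) / 2^k)"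
  have y: "y \<in> cell k (parent c)" by (simp add: y_def mem_cell)
  have "parent c = ancestor (Suc k) k c" by (simp add: ancestor_parent)
  moreover have "ancestor k j (ancestor (Suc k) k c) = ?Q"
    using j by (simp add: ancestor_def Suc_diff_le flip: div_mult2_eq)
  ultimately have sub: "cell k (parent c) \<subseteq> cell j ?Q" using cell_ancestor[OF j, of "parent c"] by simp
  have "\<bar>delta k c (basis l j ?Q \<nu>)\<bar> \<le> 2 * (K * (1 / 2^(k - j)))"
  proof (rule delta_bound)
    fix x assume x: "x \<in> cell k (parent c)"
    have "2^j * \<bar>x $ s - y $ s\<bar> \<le> 1 / 2^(k - j)" for s
    proof -
      have "2^k * \<bar>x $ s - y $ s\<bar> = \<bar>2^k * x $ s - 2^k * y $ s\<bar>"
        by (simp add: abs_mult flip: right_diff_distrib)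
      also have "\<dots> \<le> 1"
      proof -
        have "real (parent c s) \<le> 2^k * x $ s \<and> 2^k * x $ s \<le> real (parent c s) + 1" using x unfolding mem_cell ..
        moreover have "2^k * y $ s = real (parent c s)" by (simp add: y_def)
        ultimately show ?thesis by linarith
      qed
      finally have "2^(k - j) * (2^j * \<bar>x $ s - y $ s\<bar>) \<le> 1"
        using j by (simp flip: mult.assoc power_add)
      then show ?thesis by (simp add: field_simps)
    qed
    then show "\<bar>basis l j ?Q \<nu> x - basis l j ?Q \<nu> y\<bar> \<le> K * (1 / 2^(k - j))"
      using x y sub by (intro K(2)[OF \<nu>]) auto
  qed (rule continuous_basis)
  then show ?thesis by simp
qed

section \<open>Almost sure bounds for the Haar series\<close>

text \<open>The class over which the later bounds are uniform. In the application \<beta> is 2 to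
  the power -(l + \<alpha>), and \<open>C\<close> is the same for all z.\<close>

definition approximable :: "nat \<Rightarrow> real \<Rightarrow> real \<Rightarrow> (real^'n::finite \<Rightarrow> real) \<Rightarrow> bool" where
  "approximable l \<beta> C g \<longleftrightarrow> continuous_on (cbox 0 1) g \<and> (\<forall>x\<in>cbox 0 1. \<bar>g x\<bar> \<le> C) \<and>
    (\<forall>j. \<forall>c\<in>cells j. \<forall>x\<in>cell j c. \<bar>g x - interp l j c g x\<bar> \<le> C * \<beta>^j)"

text \<open>Coefficients, in the form given by \<open>interp_diff\<close>, of the difference between
  the interpolants of two successive levels; level 0 starts the telescope.\<close>

definition interp_coeff :: "nat \<Rightarrow> (real^'n::finite \<Rightarrow> real) \<Rightarrow> nat \<Rightarrow> ('n \<Rightarrow> nat) \<Rightarrow> ('n \<Rightarrow> nat) \<Rightarrow> real" where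
  "interp_coeff l g j c \<nu> = (case j of 0 \<Rightarrow> g (node l 0 c \<nu>)
    | Suc i \<Rightarrow> g (node l j c \<nu>) - interp l i (parent c) g (node l j c \<nu>))"

lemma interp_telescope:
  assumes "i \<le> k"
  shows "interp l i (ancestor k i c) g x = (\<Sum>j\<le>i. \<Sum>\<nu>\<in>nodes l. interp_coeff l g j (ancestor k j c) \<nu> * basis l j (ancestor k j c) \<nu> x)"
  using assms
proof (induction i)
  case 0
  then show ?case by (simp add: interp_def interp_coeff_def)
next
  case (Suc i)
  have "interp l (Suc i) (ancestor k (Suc i) c) g x - interp l i (ancestor k i c) g x
      = (\<Sum>\<nu>\<in>nodes l. interp_coeff l g (Suc i) (ancestor k (Suc i) c) \<nu> * basis l (Suc i) (ancestor k (Suc i) c) \<nu> x)"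
    using Suc.prems unfolding interp_diff interp_coeff_def by (simp add: ancestor_Suc)
  then show ?case using Suc by simp
qed

text \<open>For positive \<open>j\<close> the coefficient is an interpolation error of level j - 1,
  which explains the division by \<beta>.\<close>

lemma interp_coeff_bound:
  assumes g: "approximable l \<beta> C g" and \<beta>: "0 < \<beta>" "\<beta> \<le> 1" and C: "0 \<le> C"
    and c: "c \<in> cells j" and \<nu>: "\<nu> \<in> nodes l"
  shows "\<bar>interp_coeff l g j c \<nu>\<bar> \<le> C / \<beta> * \<beta>^j"
proof (cases j)
  case 0
  have "\<bar>g (node l 0 c \<nu>)\<bar> \<le> C"
    using g node_cell[OF \<nu>] cell_subset[OF c] 0 unfolding approximable_def by blast
  also have "C \<le> C / \<beta>" using \<beta> C by (simp add: field_simps mult_left_le)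
  finally show ?thesis by (simp add: 0 interp_coeff_def)
next
  case (Suc i)
  have "node l j c \<nu> \<in> cell i (parent c)" using node_cell[OF \<nu>] cell_parent unfolding Suc by blast
  moreover have "parent c \<in> cells i" using c parent_cells unfolding Suc by blast
  ultimately have "\<bar>g (node l j c \<nu>) - interp l i (parent c) g (node l j c \<nu>)\<bar> \<le> C * \<beta>^i"
    using g unfolding approximable_def by blast
  then show ?thesis using \<beta> by (simp add: Suc interp_coeff_def)
qed

text \<open>The telescope is cut off at level \<open>k\<close>. The remainder is an interpolation
  error of that level, and the rest consists of increments of ancestor basis functions, in which
  \<open>g\<close> appears only through coefficients.\<close>

lemma delta_decomposition:
  assumes g: "continuous_on (cbox 0 1) g" and c: "c \<in> cells (Suc k)"
  shows "delta k c g = delta k c (\<lambda>x. g x - interp l k (parent c) g x)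
    + (\<Sum>j\<le>k. \<Sum>\<nu>\<in>nodes l. interp_coeff l g j (ancestor (Suc k) j c) \<nu> * delta k c (basis l j (ancestor (Suc k) j c) \<nu>))"
proof -
  have sub: "cell k (parent c) \<subseteq> cbox 0 1" by (rule cell_subset[OF parent_cells[OF c]])
  define I where "I = {..k} \<times> (nodes l :: ('a \<Rightarrow> nat) set)"
  have I: "(\<Sum>j\<le>k. \<Sum>\<nu>\<in>nodes l. F j \<nu>) = (\<Sum>(j, \<nu>)\<in>I. F j \<nu>)" for F :: "nat \<Rightarrow> ('a \<Rightarrow> nat) \<Rightarrow> real"
    unfolding I_def by (rule sum.cartesian_product)
  let ?v = "\<lambda>x. \<Sum>z\<in>I. interp_coeff l g (fst z) (ancestor (Suc k) (fst z) c) (snd z) * basis l (fst z) (ancestor (Suc k) (fst z) c) (snd z) x"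
  have v: "interp l k (parent c) g x = ?v x" for x
    using interp_telescope[of k "Suc k" l c g x] unfolding ancestor_parent I by (simp add: case_prod_unfold)
  have "delta k c g = delta k c (\<lambda>x. (g x - interp l k (parent c) g x) + ?v x)" unfolding v by simp
  also have "\<dots> = delta k c (\<lambda>x. g x - interp l k (parent c) g x) + delta k c ?v"
    using continuous_on_subset[OF g sub] unfolding v by (intro delta_add continuous_intros continuous_basis)
  also have "delta k c ?v = (\<Sum>z\<in>I. interp_coeff l g (fst z) (ancestor (Suc k) (fst z) c) (snd z) * delta k c (basis l (fst z) (ancestor (Suc k) (fst z) c) (snd z)))"
    by (intro delta_sum continuous_basis) (simp add: I_def)
  finally show ?thesis unfolding I by (simp add: case_prod_unfold)
qed

lemma sum_Suc_power_bounded: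
  assumes "0 < x" "x < (1::real)"
  shows "\<exists>S\<ge>0. \<forall>K. (\<Sum>k\<le>K. real (Suc k) * x^k) \<le> S"
proof -
  have s: "(\<lambda>k. real (Suc k) * x^k) sums (1 / (1 - x)\<^sup>2)"
    using geometric_deriv_sums[of x] assms by simp
  have "(\<Sum>k\<le>K. real (Suc k) * x^k) \<le> 1 / (1 - x)\<^sup>2" for K
    using sum_le_suminf[of "\<lambda>k. real (Suc k) * x^k" "{..K}"] s assms by (auto simp: sums_iff)
  then show ?thesis using assms by (intro exI[of _ "1 / (1 - x)\<^sup>2"]) auto
qed

lemma abs_le_if_square_le: "a\<^sup>2 \<le> b\<^sup>2 \<Longrightarrow> 0 \<le> b \<Longrightarrow> \<bar>a\<bar> \<le> b" for a b :: real
  by (metis abs_le_square_iff abs_of_nonneg)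

lemma sum_Sigma_triple:
  fixes F :: "nat \<times> 'b \<times> 'c \<Rightarrow> real"
  assumes "\<And>j. finite (A j)" "finite B"
  shows "(\<Sum>i\<in>Sigma {..k} (\<lambda>j. A j \<times> B). F i) = (\<Sum>j\<le>k. \<Sum>Q\<in>A j. \<Sum>\<nu>\<in>B. F (j, Q, \<nu>))"
proof -
  have "(\<Sum>i\<in>Sigma {..k} (\<lambda>j. A j \<times> B). F i) = (\<Sum>j\<le>k. \<Sum>z\<in>A j \<times> B. F (j, z))"
    using assms by (subst sum.Sigma) (auto intro!: sum.cong)
  then show ?thesis by (simp add: sum.cartesian_product case_prod_unfold)
qed

section \<open>Square function bounds for fixed families of integrands\<close>

context dyadic_content
begin

lemma ival_cmult:
  assumes "level_fun k h"
  shows "ival (\<lambda>x. a * h x) \<omega> = a * ival h \<omega>"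
  using ival_sum[of "{()}" k "\<lambda>_. h" "\<lambda>_. a"] assms by simp

text \<open>On each level the weights \<open>theta k c\<close> sum to 1; the factor
  \<open>x^k\<close> makes the total over all levels finite.\<close>

lemma cell_masses_AE_bounded:
  assumes x: "0 < x" "x < (1::real)"
  shows "AE \<omega> in M. \<exists>B. \<forall>k. (\<Sum>c\<in>cells k. (x^k * ival (theta k c) \<omega>)\<^sup>2) \<le> B"
proof -
  obtain S where S: "\<And>K. (\<Sum>k\<le>K. real (Suc k) * x^k) \<le> S" using sum_Suc_power_bounded[OF x] by blast
  have lf: "level_fun k (\<lambda>z. a * theta k c z)" for k a c by (rule level_fun_compose[OF level_fun_theta])
  have "AE \<omega> in M. \<exists>B. \<forall>k. (\<Sum>c\<in>cells k. (ival (\<lambda>z. x^k * theta k c z) \<omega>)\<^sup>2) \<le> B"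
  proof (rule square_function_AE_bounded)
    fix K and z :: "real^'n" assume z: "z \<in> cbox 0 1"
    have "(\<Sum>k\<le>K. \<Sum>c\<in>cells k. \<bar>x^k * theta k c z\<bar>) = (\<Sum>k\<le>K. x^k * (\<Sum>c\<in>cells k. theta k c z))"
      using x by (simp add: abs_mult sum_distrib_left abs_of_nonneg[OF theta_range(1)])
    also have "\<dots> = (\<Sum>k\<le>K. x^k)" using sum_theta[OF z] by simp
    also have "\<dots> \<le> (\<Sum>k\<le>K. real (Suc k) * x^k)" using x by (intro sum_mono) (auto simp: mult_le_cancel_right1)
    finally show "(\<Sum>k\<le>K. \<Sum>c\<in>cells k. \<bar>x^k * theta k c z\<bar>) \<le> S" using S[of K] by linarith
  qed (auto intro: lf)
  then show ?thesis by (simp add: ival_cmult[OF level_fun_theta])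
qed

text \<open>The factor \<open>2^(k - j)\<close> undoes the decay in \<open>delta_basis\<close>, so
  each of the k + 1 ancestor levels contributes a multiple of \<open>x^k\<close>. The total is a
  multiple of \<Sum>k. (k + 1) x^k, which is finite.\<close>

lemma basis_masses_AE_bounded:
  assumes x: "0 < x" "x < (1::real)"
  shows "AE \<omega> in M. \<exists>B. \<forall>k. (\<Sum>(j, Q, \<nu>)\<in>Sigma {..k} (\<lambda>j. cells j \<times> nodes l).
    (x^k * 2^(k - j) * (\<Sum>c\<in>{c\<in>cells (Suc k). ancestor (Suc k) j c = Q}.
      delta k c (basis l j Q \<nu>) * ival (theta (Suc k) c) \<omega>))\<^sup>2) \<le> B"
proof -
  obtain K where K: "K \<ge> 1" "\<And>\<nu> j c x y d. \<nu> \<in> (nodes l :: ('n \<Rightarrow> nat) set) \<Longrightarrow> x \<in> cell j c \<Longrightarrow> y \<in> cell j c \<Longrightarrow>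
      (\<forall>s. 2^j * \<bar>x $ s - y $ s\<bar> \<le> d) \<Longrightarrow> \<bar>basis l j c \<nu> x - basis l j c \<nu> y\<bar> \<le> K * d"
    using basis_bound[where 'n = 'n, of l] by blast
  obtain S where S: "S \<ge> 0" "\<And>K. (\<Sum>k\<le>K. real (Suc k) * x^k) \<le> S" using sum_Suc_power_bounded[OF x] by blast
  define n where "n = real (card (nodes l :: ('n \<Rightarrow> nat) set))"
  \<comment> \<open>The index is shifted by one because the increments of step \<open>k\<close> are
    constant on the atoms of level \<open>Suc k\<close>; nothing is attached to level 0.\<close>
  define I where "I k = (case k of 0 \<Rightarrow> {} | Suc m \<Rightarrow> Sigma {..m} (\<lambda>j. (cells j :: ('n \<Rightarrow> nat) set) \<times> (nodes l :: ('n \<Rightarrow> nat) set)))" for k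
  define \<phi> where "\<phi> k = (\<lambda>(j, Q, \<nu>) (z :: real^'n). \<Sum>c\<in>{c\<in>cells k. ancestor k j c = Q}.
      (x^(k - 1) * 2^(k - 1 - j) * delta (k - 1) c (basis l j Q \<nu>)) * theta k c z)" for k
  have lf: "level_fun k (\<phi> k i)" for k i
    unfolding level_fun_def
  proof (intro ballI impI)
    fix u v :: "real^'n" assume "u \<in> cbox 0 1" "v \<in> cbox 0 1" "dyadic_code k u = dyadic_code k v"
    then have "theta k c u = theta k c v" for c using level_fun_theta[of k c] unfolding level_fun_def by blast
    then show "\<phi> k i u = \<phi> k i v" by (simp add: \<phi>_def case_prod_unfold)
  qed
  have level: "(\<Sum>i\<in>I (Suc m). \<bar>\<phi> (Suc m) i z\<bar>) \<le> 2 * K * n * (real (Suc m) * x^m)" if z: "z \<in> cbox 0 1" for m z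
  proof -
    have "(\<Sum>i\<in>I (Suc m). \<bar>\<phi> (Suc m) i z\<bar>) = (\<Sum>j\<le>m. \<Sum>Q\<in>cells j. \<Sum>\<nu>\<in>nodes l. \<bar>\<phi> (Suc m) (j, Q, \<nu>) z\<bar>)"
      unfolding I_def nat.case by (rule sum_Sigma_triple) auto
    also have "\<dots> \<le> (\<Sum>j\<le>m. 2 * K * n * x^m)"
    proof (rule sum_mono)
      fix j assume "j \<in> {..m}"
      then have j: "j \<le> m" by simp
      have "(\<Sum>Q\<in>cells j. \<Sum>\<nu>\<in>nodes l. \<bar>\<phi> (Suc m) (j, Q, \<nu>) z\<bar>)
        \<le> (\<Sum>Q\<in>cells j. \<Sum>\<nu>\<in>(nodes l :: ('n \<Rightarrow> nat) set). \<Sum>c\<in>{c\<in>cells (Suc m). ancestor (Suc m) j c = Q}. 2 * K * x^m * theta (Suc m) c z)"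
      proof (intro sum_mono)
        fix Q \<nu> assume \<nu>: "\<nu> \<in> (nodes l :: ('n \<Rightarrow> nat) set)"
        show "\<bar>\<phi> (Suc m) (j, Q, \<nu>) z\<bar> \<le> (\<Sum>c\<in>{c\<in>cells (Suc m). ancestor (Suc m) j c = Q}. 2 * K * x^m * theta (Suc m) c z)"
          unfolding \<phi>_def prod.case
        proof (rule order_trans[OF sum_abs sum_mono])
          fix c assume c: "c \<in> {c\<in>cells (Suc m). ancestor (Suc m) j c = Q}"
          have "\<bar>delta m c (basis l j Q \<nu>)\<bar> \<le> 2 * K / 2^(m - j)"
          proof -
            have Q: "ancestor (Suc m) j c = Q" using c by simp
            have "\<bar>delta m c (basis l j (ancestor (Suc m) j c) \<nu>)\<bar> \<le> 2 * K / 2^(m - j)"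
              by (rule delta_basis[OF K(1) _ \<nu> j]) (rule K(2))
            then show ?thesis unfolding Q .
          qed
          then have "2^(m - j) * \<bar>delta m c (basis l j Q \<nu>)\<bar> \<le> 2 * K" by (simp add: field_simps)
          then have "x^m * (2^(m - j) * \<bar>delta m c (basis l j Q \<nu>)\<bar>) * theta (Suc m) c z \<le> x^m * (2 * K) * theta (Suc m) c z"
            using x theta_range by (intro mult_right_mono mult_left_mono) auto
          then show "\<bar>(x^(Suc m - 1) * 2^(Suc m - 1 - j) * delta (Suc m - 1) c (basis l j Q \<nu>)) * theta (Suc m) c z\<bar> \<le> 2 * K * x^m * theta (Suc m) c z"
            using x theta_range[of "Suc m" c z] by (simp add: abs_mult mult_ac)
        qed
      qed
      also have "\<dots> = n * (\<Sum>Q\<in>cells j. \<Sum>c\<in>{c\<in>cells (Suc m). ancestor (Suc m) j c = Q}. 2 * K * x^m * theta (Suc m) c z)"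
        by (simp add: n_def sum_distrib_left)
      also have "(\<Sum>Q\<in>cells j. \<Sum>c\<in>{c\<in>cells (Suc m). ancestor (Suc m) j c = Q}. 2 * K * x^m * theta (Suc m) c z)
          = (\<Sum>c\<in>cells (Suc m). 2 * K * x^m * theta (Suc m) c z)"
        using j by (intro sum.group) (auto intro!: ancestor_cells)
      also have "\<dots> = 2 * K * x^m" using sum_theta[OF z, of "Suc m"] by (simp flip: sum_distrib_left)
      finally show "(\<Sum>Q\<in>cells j. \<Sum>\<nu>\<in>nodes l. \<bar>\<phi> (Suc m) (j, Q, \<nu>) z\<bar>) \<le> 2 * K * n * x^m" by (simp add: mult_ac)
    qed
    also have "\<dots> = 2 * K * n * (real (Suc m) * x^m)" by simp
    finally show ?thesis .
  qed
  have "AE \<omega> in M. \<exists>B. \<forall>k. (\<Sum>i\<in>I k. (ival (\<phi> k i) \<omega>)\<^sup>2) \<le> B"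
  proof (rule square_function_AE_bounded)
    show "finite (I k)" for k by (cases k) (auto simp: I_def)
    show "level_fun k (\<phi> k i)" for k i by (rule lf)
    fix L and z :: "real^'n" assume z: "z \<in> cbox 0 1"
    have "(\<Sum>k\<le>L. \<Sum>i\<in>I k. \<bar>\<phi> k i z\<bar>) \<le> (\<Sum>k\<le>Suc L. \<Sum>i\<in>I k. \<bar>\<phi> k i z\<bar>)"
      by (intro sum_mono2) (auto intro: sum_nonneg)
    also have "\<dots> = (\<Sum>m\<le>L. \<Sum>i\<in>I (Suc m). \<bar>\<phi> (Suc m) i z\<bar>)"
      by (subst sum.atMost_Suc_shift) (simp add: I_def)
    also have "\<dots> \<le> (\<Sum>m\<le>L. 2 * K * n * (real (Suc m) * x^m))" by (intro sum_mono level z)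
    also have "\<dots> = 2 * K * n * (\<Sum>m\<le>L. real (Suc m) * x^m)" by (simp only: sum_distrib_left)
    also have "\<dots> \<le> 2 * K * n * S" using S K(1) by (intro mult_left_mono) (auto simp: n_def)
    finally show "(\<Sum>k\<le>L. \<Sum>i\<in>I k. \<bar>\<phi> k i z\<bar>) \<le> 2 * K * n * S" .
  qed
  then show ?thesis
  proof eventually_elim
    case (elim \<omega>)
    then obtain B where B: "\<And>k. (\<Sum>i\<in>I k. (ival (\<phi> k i) \<omega>)\<^sup>2) \<le> B" by blast
    have "(\<Sum>(j, Q, \<nu>)\<in>Sigma {..k} (\<lambda>j. cells j \<times> nodes l).
      (x^k * 2^(k - j) * (\<Sum>c\<in>{c\<in>cells (Suc k). ancestor (Suc k) j c = Q}.
        delta k c (basis l j Q \<nu>) * ival (theta (Suc k) c) \<omega>))\<^sup>2) = (\<Sum>i\<in>I (Suc k). (ival (\<phi> (Suc k) i) \<omega>)\<^sup>2)" for k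
      unfolding I_def nat.case
    proof (rule sum.cong[OF refl])
      fix i assume i: "i \<in> Sigma {..k} (\<lambda>j. (cells j :: ('n \<Rightarrow> nat) set) \<times> (nodes l :: ('n \<Rightarrow> nat) set))"
      obtain j Q \<nu> where e: "i = (j, Q, \<nu>)" by (cases i) auto
      have "ival (\<phi> (Suc k) (j, Q, \<nu>)) \<omega> = (\<Sum>c\<in>{c\<in>cells (Suc k). ancestor (Suc k) j c = Q}.
          (x^k * 2^(k - j) * delta k c (basis l j Q \<nu>)) * ival (theta (Suc k) c) \<omega>)"
        unfolding \<phi>_def prod.case diff_Suc_1 by (rule ival_sum) (rule level_fun_theta)
      also have "\<dots> = x^k * 2^(k - j) * (\<Sum>c\<in>{c\<in>cells (Suc k). ancestor (Suc k) j c = Q}.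
          delta k c (basis l j Q \<nu>) * ival (theta (Suc k) c) \<omega>)"
        by (simp only: sum_distrib_left mult.assoc)
      finally show "(case i of (j, Q, \<nu>) \<Rightarrow> (x^k * 2^(k - j) * (\<Sum>c\<in>{c\<in>cells (Suc k). ancestor (Suc k) j c = Q}.
          delta k c (basis l j Q \<nu>) * ival (theta (Suc k) c) \<omega>))\<^sup>2) = (ival (\<phi> (Suc k) i) \<omega>)\<^sup>2"
        by (simp only: e prod.case)
    qed
    with B show ?case by (intro exI[of _ B] allI) (simp only:)
  qed
qed

text \<open>For one fixed \<open>g\<close> the increments themselves can serve as integrands, a
  single one per level. The null set then depends on \<open>g\<close>, which is acceptable for one
  initial function.\<close>

lemma lipschitz_term_AE_bounded:
  assumes x: "0 < x" "x < (1::real)" and g: "continuous_on (cbox 0 1) g"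
    and E: "\<And>k c. c \<in> cells (Suc k) \<Longrightarrow> \<bar>delta k c g\<bar> \<le> E / 2^k"
  shows "AE \<omega> in M. \<exists>B. \<forall>k. (x^k * 2^k * haar_series_term \<nu> g (Suc k) \<omega>)\<^sup>2 \<le> B"
proof -
  obtain S where S: "\<And>K. (\<Sum>k\<le>K. real (Suc k) * x^k) \<le> S" using sum_Suc_power_bounded[OF x] by blast
  define \<phi> where "\<phi> k (i::unit) = (case k of 0 \<Rightarrow> (\<lambda>z :: real^'n. 0) | Suc m \<Rightarrow> (\<lambda>z. \<Sum>c\<in>cells (Suc m).
      (x^m * 2^m * delta m c g) * theta (Suc m) c z))" for k i
  have lf: "level_fun k (\<phi> k i)" for k i
    unfolding level_fun_def
  proof (intro ballI impI)
    fix u v :: "real^'n" assume "u \<in> cbox 0 1" "v \<in> cbox 0 1" "dyadic_code k u = dyadic_code k v"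
    then have "theta k c u = theta k c v" for c using level_fun_theta[of k c] unfolding level_fun_def by blast
    then show "\<phi> k i u = \<phi> k i v" by (cases k) (simp_all add: \<phi>_def)
  qed
  have E0: "E \<ge> 0" using E[of "\<lambda>_. 0" 0] by (simp add: cells_def)
  have level: "\<bar>\<phi> (Suc m) i z\<bar> \<le> E * (real (Suc m) * x^m)" if z: "z \<in> cbox 0 1" for m i z
  proof -
    have "\<bar>\<phi> (Suc m) i z\<bar> \<le> (\<Sum>c\<in>cells (Suc m). E * x^m * theta (Suc m) c z)"
      unfolding \<phi>_def nat.case
    proof (rule order_trans[OF sum_abs sum_mono])
      fix c assume c: "c \<in> (cells (Suc m) :: ('n \<Rightarrow> nat) set)"
      have "2^m * \<bar>delta m c g\<bar> \<le> E" using E[OF c] by (simp add: field_simps)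
      then have "x^m * (2^m * \<bar>delta m c g\<bar>) * theta (Suc m) c z \<le> x^m * E * theta (Suc m) c z"
        using x theta_range by (intro mult_right_mono mult_left_mono) auto
      then show "\<bar>(x^m * 2^m * delta m c g) * theta (Suc m) c z\<bar> \<le> E * x^m * theta (Suc m) c z"
        using x theta_range[of "Suc m" c z] by (simp add: abs_mult mult_ac)
    qed
    also have "\<dots> = E * x^m" using sum_theta[OF z, of "Suc m"] by (simp flip: sum_distrib_left)
    also have "\<dots> \<le> E * (real (Suc m) * x^m)"
      using x E0 by (intro mult_left_mono) (auto simp: mult_le_cancel_right1)
    finally show ?thesis .
  qed
  have "AE \<omega> in M. \<exists>B. \<forall>k. (\<Sum>i\<in>UNIV. (ival (\<phi> k i) \<omega>)\<^sup>2) \<le> B"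
  proof (rule square_function_AE_bounded)
    show "level_fun k (\<phi> k i)" for k i by (rule lf)
    fix L and z :: "real^'n" assume z: "z \<in> cbox 0 1"
    have "(\<Sum>k\<le>L. \<Sum>i\<in>UNIV. \<bar>\<phi> k i z\<bar>) \<le> (\<Sum>k\<le>Suc L. \<Sum>i\<in>UNIV. \<bar>\<phi> k i z\<bar>)"
      by (intro sum_mono2) (auto intro: sum_nonneg)
    also have "\<dots> = (\<Sum>m\<le>L. \<bar>\<phi> (Suc m) () z\<bar>)"
      by (subst sum.atMost_Suc_shift) (simp add: \<phi>_def UNIV_unit)
    also have "\<dots> \<le> (\<Sum>m\<le>L. E * (real (Suc m) * x^m))" by (intro sum_mono level z)
    also have "\<dots> = E * (\<Sum>m\<le>L. real (Suc m) * x^m)" by (simp only: sum_distrib_left)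
    also have "\<dots> \<le> E * S" using S E0 by (intro mult_left_mono) auto
    finally show "(\<Sum>k\<le>L. \<Sum>i\<in>UNIV. \<bar>\<phi> k i z\<bar>) \<le> E * S" .
  qed simp
  then show ?thesis
  proof eventually_elim
    case (elim \<omega>)
    then obtain B where B: "\<And>k. (ival (\<phi> k ()) \<omega>)\<^sup>2 \<le> B" by (auto simp: UNIV_unit)
    have eq: "ival (\<phi> (Suc k) ()) \<omega> = x^k * 2^k * haar_series_term \<nu> g (Suc k) \<omega>" for k
    proof -
      have "ival (\<phi> (Suc k) ()) \<omega> = (\<Sum>c\<in>cells (Suc k). (x^k * 2^k * delta k c g) * ival (theta (Suc k) c) \<omega>)"
        unfolding \<phi>_def nat.case by (rule ival_sum) (rule level_fun_theta)
      then show ?thesis unfolding haar_series_term_Suc[OF g] by (simp add: sum_distrib_left mult.assoc)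
    qed
    have "(x^k * 2^k * haar_series_term \<nu> g (Suc k) \<omega>)\<^sup>2 \<le> B" for k
      using B[of "Suc k"] unfolding eq .
    then show ?case by blast
  qed
qed

text \<open>A deterministic statement at an \<omega> where both square function bounds hold, so
  \<open>R\<close> serves all \<open>g\<close> at once. Cauchy--Schwarz pairs the remainders with
  the cell masses and the interpolation coefficients with the normalised basis masses.\<close>

lemma approximable_term_bound:
  fixes \<beta> y x C B B' :: real
  assumes \<beta>: "0 < \<beta>" "\<beta> \<le> 1" "2 ^ CARD('n) * \<beta>\<^sup>2 \<le> y\<^sup>2" and y: "1/2 \<le> y" "y < 1" and x: "x = sqrt y" and C: "0 \<le> C"
    and B: "\<And>k. (\<Sum>c\<in>cells k. (x^k * ival (theta k c) \<omega>)\<^sup>2) \<le> B"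
    and B': "\<And>k. (\<Sum>(j, Q, \<nu>)\<in>Sigma {..k} (\<lambda>j. cells j \<times> nodes l).
      (x^k * 2^(k - j) * (\<Sum>c\<in>{c\<in>cells (Suc k). ancestor (Suc k) j c = Q}.
        delta k c (basis l j Q \<nu>) * ival (theta (Suc k) c) \<omega>))\<^sup>2) \<le> B'"
  shows "\<exists>R\<ge>0. \<forall>g k. approximable l \<beta> C g \<longrightarrow> \<bar>haar_series_term \<nu> g (Suc k) \<omega>\<bar> \<le> R * (real (Suc k) * x^k)"
proof -
  define n where "n = real (card (nodes l :: ('n \<Rightarrow> nat) set))"
  define D where "D = (2::real) ^ CARD('n)"
  have y0: "0 < y" and x0: "0 < x" and xx: "x * x = y" using y x by auto
  have xpow: "(x^k)\<^sup>2 = y^k" for k using xx by (metis power2_eq_square power_mult_distrib)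
  have "(\<Sum>c\<in>cells 0. (x^0 * ival (theta 0 c) \<omega>)\<^sup>2) \<le> B" by (rule B)
  then have B0: "0 \<le> B" by (rule order_trans[rotated]) (simp add: sum_nonneg)
  have B'0: "0 \<le> B'" using B'[of 0] by (rule order_trans[rotated]) (auto intro!: sum_nonneg)
  define R1 where "R1 = 4 * C\<^sup>2 * D * (B / y)"
  define R2 where "R2 = n * (C / \<beta>)\<^sup>2 * B'"
  have R0: "R1 \<ge> 0" "R2 \<ge> 0" using B0 B'0 y0 by (auto simp: R1_def R2_def D_def n_def)
  have main: "\<bar>haar_series_term \<nu> g (Suc k) \<omega>\<bar> \<le> (sqrt R1 + sqrt R2) * (real (Suc k) * x^k)"
    if g: "approximable l \<beta> C g" for g k
  proof -
    have gc: "continuous_on (cbox 0 1) g" using g by (simp add: approximable_def)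
    define m where "m c = ival (theta (Suc k) c) \<omega>" for c
    define e where "e c = delta k c (\<lambda>z. g z - interp l k (parent c) g z)" for c
    define Y where "Y j Q \<nu> = (\<Sum>c\<in>{c\<in>cells (Suc k). ancestor (Suc k) j c = Q}. delta k c (basis l j Q \<nu>) * m c)" for j Q \<nu>
    define b where "b = interp_coeff l g"
    have split: "haar_series_term \<nu> g (Suc k) \<omega> = (\<Sum>c\<in>cells (Suc k). e c * m c)
        + (\<Sum>(j, Q, \<nu>)\<in>Sigma {..k} (\<lambda>j. cells j \<times> nodes l). b j Q \<nu> * Y j Q \<nu>)"
    proof -
      have "haar_series_term \<nu> g (Suc k) \<omega> = (\<Sum>c\<in>cells (Suc k). e c * m c
          + (\<Sum>j\<le>k. \<Sum>\<nu>\<in>nodes l. b j (ancestor (Suc k) j c) \<nu> * delta k c (basis l j (ancestor (Suc k) j c) \<nu>) * m c))"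
        unfolding haar_series_term_Suc[OF gc] m_def[symmetric]
        by (intro sum.cong refl) (simp add: delta_decomposition[OF gc, of _ k l] e_def b_def distrib_right sum_distrib_right)
      also have "\<dots> = (\<Sum>c\<in>cells (Suc k). e c * m c)
          + (\<Sum>j\<le>k. \<Sum>\<nu>\<in>nodes l. \<Sum>c\<in>cells (Suc k). b j (ancestor (Suc k) j c) \<nu> * delta k c (basis l j (ancestor (Suc k) j c) \<nu>) * m c)"
        unfolding sum.distrib
        by (subst (2) sum.swap) (simp add: sum.swap[of _ "nodes l" "cells (Suc k)"])
      also have "(\<Sum>j\<le>k. \<Sum>\<nu>\<in>nodes l. \<Sum>c\<in>cells (Suc k). b j (ancestor (Suc k) j c) \<nu> * delta k c (basis l j (ancestor (Suc k) j c) \<nu>) * m c)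
          = (\<Sum>j\<le>k. \<Sum>\<nu>\<in>nodes l. \<Sum>Q\<in>cells j. b j Q \<nu> * Y j Q \<nu>)"
      proof (rule sum.cong[OF refl], rule sum.cong[OF refl])
        fix j and \<nu> :: "'n \<Rightarrow> nat" assume "j \<in> {..k}"
        then have j: "j \<le> Suc k" by simp
        have "(\<Sum>c\<in>cells (Suc k). b j (ancestor (Suc k) j c) \<nu> * delta k c (basis l j (ancestor (Suc k) j c) \<nu>) * m c)
          = (\<Sum>Q\<in>cells j. \<Sum>c\<in>{c\<in>cells (Suc k). ancestor (Suc k) j c = Q}. b j (ancestor (Suc k) j c) \<nu> * delta k c (basis l j (ancestor (Suc k) j c) \<nu>) * m c)"
          
        proof (rule sum.group[symmetric])
          show "ancestor (Suc k) j ` cells (Suc k) \<subseteq> cells j" using ancestor_cells[OF _ j] by blast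
        qed auto
        also have "\<dots> = (\<Sum>Q\<in>cells j. b j Q \<nu> * Y j Q \<nu>)"
          unfolding Y_def sum_distrib_left by (intro sum.cong refl) (auto simp: mult.assoc)
        finally show "(\<Sum>c\<in>cells (Suc k). b j (ancestor (Suc k) j c) \<nu> * delta k c (basis l j (ancestor (Suc k) j c) \<nu>) * m c)
          = (\<Sum>Q\<in>cells j. b j Q \<nu> * Y j Q \<nu>)" .
      qed
      also have "\<dots> = (\<Sum>j\<le>k. \<Sum>Q\<in>cells j. \<Sum>\<nu>\<in>nodes l. b j Q \<nu> * Y j Q \<nu>)"
        by (intro sum.cong refl sum.swap)
      also have "\<dots> = (\<Sum>(j, Q, \<nu>)\<in>Sigma {..k} (\<lambda>j. cells j \<times> nodes l). b j Q \<nu> * Y j Q \<nu>)"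
        by (subst sum_Sigma_triple) auto
      finally show ?thesis .
    qed
    have part1: "\<bar>\<Sum>c\<in>cells (Suc k). e c * m c\<bar> \<le> sqrt R1 * x^k"
    proof -
      have e: "\<bar>e c\<bar> \<le> 2 * (C * \<beta>^k)" if c: "c \<in> cells (Suc k)" for c
        unfolding e_def
      proof (rule delta_bound[where v = 0])
        have "cell k (parent c) \<subseteq> cbox 0 1" by (rule cell_subset[OF parent_cells[OF c]])
        then show "continuous_on (cell k (parent c)) (\<lambda>z. g z - interp l k (parent c) g z)"
          unfolding interp_def by (intro continuous_intros continuous_basis continuous_on_subset[OF gc])
        show "\<bar>(g z - interp l k (parent c) g z) - 0\<bar> \<le> C * \<beta>^k" if "z \<in> cell k (parent c)" for z
          using g that parent_cells[OF c] unfolding approximable_def by simp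
      qed
      have "(\<Sum>c\<in>cells (Suc k). (e c)\<^sup>2) \<le> (\<Sum>c\<in>(cells (Suc k) :: ('n \<Rightarrow> nat) set). 4 * C\<^sup>2 * (\<beta>\<^sup>2)^k)"
      proof (rule sum_mono)
        fix c :: "'n \<Rightarrow> nat" assume c: "c \<in> cells (Suc k)"
        have "\<bar>e c\<bar>\<^sup>2 \<le> (2 * (C * \<beta>^k))\<^sup>2" by (rule power_mono[OF e[OF c]]) simp
        then show "(e c)\<^sup>2 \<le> 4 * C\<^sup>2 * (\<beta>\<^sup>2)^k" by (simp add: power_mult_distrib mult_ac flip: power_mult)
      qed
      also have "\<dots> = 4 * C\<^sup>2 * D * (D * \<beta>\<^sup>2)^k" by (simp add: card_cells D_def power_mult_distrib)
      also have "\<dots> \<le> 4 * C\<^sup>2 * D * (y\<^sup>2)^k"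
        using \<beta>(3) by (intro mult_left_mono power_mono) (auto simp: D_def)
      finally have E2: "(\<Sum>c\<in>cells (Suc k). (e c)\<^sup>2) \<le> 4 * C\<^sup>2 * D * (y\<^sup>2)^k" .
      have "y^Suc k * (\<Sum>c\<in>cells (Suc k). (m c)\<^sup>2) \<le> B"
      proof -
        have "(\<Sum>c\<in>cells (Suc k). (x^Suc k * m c)\<^sup>2) = y^Suc k * (\<Sum>c\<in>cells (Suc k). (m c)\<^sup>2)"
          by (simp only: power_mult_distrib xpow sum_distrib_left)
        then show ?thesis using B[of "Suc k"] unfolding m_def[symmetric] by (simp only:)
      qed
      then have M2: "(\<Sum>c\<in>cells (Suc k). (m c)\<^sup>2) \<le> B / y^Suc k" using y0 by (simp add: field_simps)
      \<comment> \<open>The square sum of the remainders is of order y^(2k), because 2^d \<beta>^2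
        is at most y^2, and that of the masses at most B / y^(k+1). The product is of order y^k, the
        square of x^k.\<close>
      have "(\<Sum>c\<in>cells (Suc k). e c * m c)\<^sup>2 \<le> (\<Sum>c\<in>cells (Suc k). (e c)\<^sup>2) * (\<Sum>c\<in>cells (Suc k). (m c)\<^sup>2)"
        by (rule Cauchy_Schwarz_ineq_sum)
      also have "\<dots> \<le> (4 * C\<^sup>2 * D * (y\<^sup>2)^k) * (B / y^Suc k)"
        using E2 M2 by (intro mult_mono) (auto intro: sum_nonneg simp: D_def)
      also have "\<dots> = R1 * y^k"
        using y0 by (simp add: R1_def power2_eq_square power_mult_distrib field_simps)
      also have "\<dots> = (sqrt R1 * x^k)\<^sup>2" using R0 by (simp add: power_mult_distrib xpow)
      finally show ?thesis using R0 x0 by (intro abs_le_if_square_le) auto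
    qed
    have part2: "\<bar>\<Sum>(j, Q, \<nu>)\<in>Sigma {..k} (\<lambda>j. cells j \<times> nodes l). b j Q \<nu> * Y j Q \<nu>\<bar> \<le> sqrt R2 * (real (Suc k) * x^k)"
    proof -
      let ?I = "Sigma {..k} (\<lambda>j. cells j \<times> (nodes l :: ('n \<Rightarrow> nat) set))"
      let ?w = "\<lambda>j. x^k * 2^(k - j)"
      have w: "?w j > 0" for j using x0 by simp
      have eq: "(\<Sum>(j, Q, \<nu>)\<in>?I. b j Q \<nu> * Y j Q \<nu>) = (\<Sum>i\<in>?I. (case i of (j, Q, \<nu>) \<Rightarrow> b j Q \<nu> / ?w j) * (case i of (j, Q, \<nu>) \<Rightarrow> ?w j * Y j Q \<nu>))"
        using x0 by (intro sum.cong refl) (auto simp: field_simps)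
      have "(\<Sum>(j, Q, \<nu>)\<in>?I. b j Q \<nu> * Y j Q \<nu>)\<^sup>2
        \<le> (\<Sum>i\<in>?I. (case i of (j, Q, \<nu>) \<Rightarrow> b j Q \<nu> / ?w j)\<^sup>2) * (\<Sum>i\<in>?I. (case i of (j, Q, \<nu>) \<Rightarrow> ?w j * Y j Q \<nu>)\<^sup>2)"
        unfolding eq by (rule Cauchy_Schwarz_ineq_sum)
      also have "\<dots> \<le> (n * (C / \<beta>)\<^sup>2 * (real (Suc k) * y^k)) * B'"
      proof (rule mult_mono)
        show "(\<Sum>i\<in>?I. (case i of (j, Q, \<nu>) \<Rightarrow> ?w j * Y j Q \<nu>)\<^sup>2) \<le> B'"
          using B'[of k] unfolding Y_def m_def by (simp add: case_prod_unfold)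
        have "(\<Sum>i\<in>?I. (case i of (j, Q, \<nu>) \<Rightarrow> b j Q \<nu> / ?w j)\<^sup>2) = (\<Sum>j\<le>k. \<Sum>Q\<in>cells j. \<Sum>\<nu>\<in>nodes l. (b j Q \<nu> / ?w j)\<^sup>2)"
          by (subst sum_Sigma_triple) auto
        also have "\<dots> \<le> (\<Sum>j\<le>k. n * (C / \<beta>)\<^sup>2 * y^k)"
        proof (rule sum_mono)
          fix j assume "j \<in> {..k}"
          then have j: "j \<le> k" by simp
          have "(\<Sum>Q\<in>cells j. \<Sum>\<nu>\<in>nodes l. (b j Q \<nu> / ?w j)\<^sup>2)
            \<le> (\<Sum>Q\<in>(cells j :: ('n \<Rightarrow> nat) set). \<Sum>\<nu>\<in>(nodes l :: ('n \<Rightarrow> nat) set). (C / \<beta> * \<beta>^j / ?w j)\<^sup>2)"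
          proof (intro sum_mono)
            fix Q \<nu> :: "'n \<Rightarrow> nat" assume "Q \<in> cells j" "\<nu> \<in> nodes l"
            then have "\<bar>b j Q \<nu>\<bar> \<le> C / \<beta> * \<beta>^j" unfolding b_def by (intro interp_coeff_bound[OF g \<beta>(1,2) C])
            then have "\<bar>b j Q \<nu>\<bar> / ?w j \<le> C / \<beta> * \<beta>^j / ?w j"
              by (rule divide_right_mono) (rule less_imp_le[OF w])
            moreover have "\<bar>b j Q \<nu> / ?w j\<bar> = \<bar>b j Q \<nu>\<bar> / ?w j" by (simp only: abs_divide abs_of_pos[OF w])
            ultimately have "\<bar>b j Q \<nu> / ?w j\<bar> \<le> C / \<beta> * \<beta>^j / ?w j" by (simp only:)
            then have "\<bar>b j Q \<nu> / ?w j\<bar>\<^sup>2 \<le> (C / \<beta> * \<beta>^j / ?w j)\<^sup>2" by (rule power_mono) simp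
            then show "(b j Q \<nu> / ?w j)\<^sup>2 \<le> (C / \<beta> * \<beta>^j / ?w j)\<^sup>2" by (simp only: power2_abs)
          qed
          also have "\<dots> = n * (C / \<beta>)\<^sup>2 * ((D * \<beta>\<^sup>2)^j * ((1/2)^(k - j))\<^sup>2 / y^k)"
          proof -
            have "(C / \<beta> * \<beta>^j / ?w j)\<^sup>2 = (C / \<beta>)\<^sup>2 * ((\<beta>\<^sup>2)^j * ((1/2)^(k - j))\<^sup>2 / y^k)"
              unfolding xpow[symmetric]
              by (simp add: power_mult_distrib power_divide flip: power_mult) (simp add: mult.commute)
            then show ?thesis by (simp add: card_cells n_def D_def power_mult_distrib)
          qed
          \<comment> \<open>Since y is at least 1/2, the Lipschitz factor 1/2 per level between
            ancestor and cell may be replaced by y. Then every \<open>j\<close> gives the same power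
            y^k.\<close>
          also have "\<dots> \<le> n * (C / \<beta>)\<^sup>2 * ((y\<^sup>2)^j * (y^(k - j))\<^sup>2 / y^k)"
            using \<beta>(3) y by (intro mult_left_mono divide_right_mono mult_mono power_mono) (auto simp: D_def n_def)
          also have "(y\<^sup>2)^j * (y^(k - j))\<^sup>2 / y^k = y^k"
          proof -
            have "(y\<^sup>2)^j * (y^(k - j))\<^sup>2 = y^(2 * j + 2 * (k - j))" by (simp add: power_add power_mult power_even_eq power2_eq_square power_mult_distrib)
            also have "2 * j + 2 * (k - j) = k + k" using j by simp
            finally show ?thesis using y0 by (simp add: power_add)
          qed
          finally show "(\<Sum>Q\<in>cells j. \<Sum>\<nu>\<in>nodes l. (b j Q \<nu> / ?w j)\<^sup>2) \<le> n * (C / \<beta>)\<^sup>2 * y^k" .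
        qed
        also have "\<dots> = n * (C / \<beta>)\<^sup>2 * (real (Suc k) * y^k)" by simp
        finally show "(\<Sum>i\<in>?I. (case i of (j, Q, \<nu>) \<Rightarrow> b j Q \<nu> / ?w j)\<^sup>2) \<le> n * (C / \<beta>)\<^sup>2 * (real (Suc k) * y^k)" .
      qed (use y0 in \<open>auto intro!: sum_nonneg simp: n_def\<close>)
      also have "\<dots> = R2 * (real (Suc k) * y^k)" by (simp add: R2_def)
      \<comment> \<open>A second factor \<open>Suc k\<close> is given away to obtain a perfect
        square.\<close>
      also have "\<dots> \<le> R2 * ((real (Suc k))\<^sup>2 * y^k)"
        using R0 y0 by (intro mult_left_mono mult_right_mono) (auto simp: power2_eq_square mult_le_cancel_right1)
      also have "\<dots> = (sqrt R2 * (real (Suc k) * x^k))\<^sup>2" using R0 by (simp add: power_mult_distrib xpow)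
      finally show ?thesis using R0 x0 by (intro abs_le_if_square_le) auto
    qed
    have "sqrt R1 * x^k \<le> sqrt R1 * (real (Suc k) * x^k)"
      using R0 x0 by (intro mult_left_mono) (auto simp: mult_le_cancel_right1)
    then show ?thesis unfolding split using part1 part2 by (simp add: distrib_right)
  qed
  then show ?thesis using R0 by (intro exI[of _ "sqrt R1 + sqrt R2"]) auto
qed

end

section \<open>Differentiating the series\<close>

lemma C_diff_on_derivative_z:
  assumes f: "C_diff_on m a b f" and ds: "length ds < m" and z: "z \<in> {a..b}" and x: "x \<in> cbox 0 1"
  shows "((\<lambda>t. ipd a b ds f t x) has_real_derivative ipd a b (None # ds) f z x) (at z within {a..b})"
proof -
  have "pdir_exists a b None (ipd a b ds f) z x" using assms unfolding C_diff_on_def by blast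
  then show ?thesis
    by (simp add: pdir_exists_def pdir_def vector_derivative_works has_real_derivative_iff_has_vector_derivative)
qed

lemma upd_simps: "upd (upd x s t) s u = upd x s u" "upd x s t $ s = t" "upd x s (x $ s) = x"
  by (auto simp: upd_def vec_eq_iff)

lemma upd_cbox: "x \<in> cbox 0 1 \<Longrightarrow> t \<in> {0..1} \<Longrightarrow> upd x s t \<in> cbox 0 1"
  by (auto simp: upd_def mem_box_cart)

lemma norm_upd_diff: "norm (upd x s t - upd x s u) = \<bar>t - u\<bar>"
proof -
  have "upd x s t - upd x s u = (t - u) *\<^sub>R axis s 1"
    by (auto simp: upd_def vec_eq_iff axis_def)
  then show ?thesis by (simp add: norm_axis_1)
qed

lemma C_diff_on_derivative_x:
  assumes f: "C_diff_on m a b f" and ds: "length ds < m" and z: "z \<in> {a..b}" and x: "x \<in> cbox 0 1" and t: "t \<in> {0..1}"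
  shows "((\<lambda>t. ipd a b ds f z (upd x s t)) has_real_derivative ipd a b (Some s # ds) f z (upd x s t)) (at t within {0..1})"
proof -
  have "pdir_exists a b (Some s) (ipd a b ds f) z (upd x s t)"
    using f ds z upd_cbox[OF x t] unfolding C_diff_on_def by blast
  moreover have "(\<chi> i. if i = s then t' else upd x s t $ i) = upd x s t'" for t'
    by (auto simp: upd_def vec_eq_iff)
  ultimately show ?thesis
    by (simp add: pdir_exists_def pdir_def vector_derivative_works has_real_derivative_iff_has_vector_derivative upd_simps)
qed

lemma C_diff_on_continuous:
  assumes f: "C_diff_on m a b f" and ds: "length ds \<le> m"
  shows "continuous_on ({a..b} \<times> cbox 0 1) (\<lambda>(z, x). ipd a b ds f z x)"
    and "z \<in> {a..b} \<Longrightarrow> continuous_on (cbox 0 1) (ipd a b ds f z)"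
proof -
  show c: "continuous_on ({a..b} \<times> cbox 0 1) (\<lambda>(z, x). ipd a b ds f z x)"
    using assms unfolding C_diff_on_def by blast
  show "continuous_on (cbox 0 1) (ipd a b ds f z)" if "z \<in> {a..b}"
  proof -
    have "continuous_on (cbox 0 1) (\<lambda>x::real^'a. (z, x))"
      by (rule continuous_on_Pair[OF continuous_on_const continuous_on_id])
    moreover have "(\<lambda>x. (z, x)) ` cbox 0 1 \<subseteq> {a..b} \<times> cbox 0 (1::real^'a)" using that by auto
    ultimately show ?thesis using continuous_on_compose2[OF c] by force
  qed
qed

section \<open>Uniform approximability of the derivative in z\<close>

text \<open>Differentiating the quotient \<open>l\<close> times in one coordinate leaves a quotient
  in z of x-derivatives. The mean value inequality in z, applied to its difference at two points,
  needs precisely the Hoelder hypothesis with the z-derivative outermost. One coordinate at a time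
  is enough by \<open>interp_error_tensor\<close>.\<close>

lemma difference_quotient_interp_error:
  fixes f :: "real \<Rightarrow> real^'n::finite \<Rightarrow> real"
  assumes f: "C_diff_on (Suc l) a b f" and Cf: "0 \<le> Cf" and \<alpha>: "0 < \<alpha>"
    and hoelder: "\<And>ss z x1 x2. length ss = l \<Longrightarrow> z \<in> {a..b} \<Longrightarrow> x1 \<in> cbox 0 1 \<Longrightarrow> x2 \<in> cbox 0 1 \<Longrightarrow>
           \<bar>ipd a b (None # map Some ss) f z x1 - ipd a b (None # map Some ss) f z x2\<bar>
             \<le> Cf * norm (x1 - x2) powr \<alpha>"
  shows "\<exists>C\<ge>0. \<forall>z1\<in>{a..b}. \<forall>z2\<in>{a..b}. z1 \<noteq> z2 \<longrightarrow> (\<forall>j. \<forall>c\<in>cells j. \<forall>x\<in>cell j c.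
    \<bar>(f z2 x - f z1 x) / (z2 - z1) - interp l j c (\<lambda>x. (f z2 x - f z1 x) / (z2 - z1)) x\<bar>
      \<le> C * (1 / 2^j) powr (real l + \<alpha>))"
proof -
  obtain A where A: "A \<ge> 0" "\<And>j c (g :: real^'n \<Rightarrow> real) e x.
      (\<forall>x\<in>cell j c. \<forall>s. \<bar>g x - (\<Sum>i\<le>l. g (upd x s ((real (c s) + tau l i) / 2^j)) * poly (lagrange l i) (2^j * x $ s - real (c s)))\<bar> \<le> e)
      \<Longrightarrow> x \<in> cell j c \<Longrightarrow> \<bar>g x - interp l j c g x\<bar> \<le> A * e"
    using interp_error_tensor[where 'n = 'n, of l] by blast
  obtain K where K: "K \<ge> 1" "\<And>i y. i \<le> l \<Longrightarrow> y \<in> {0..1} \<Longrightarrow> \<bar>poly (lagrange l i) y\<bar> \<le> K"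
    using lagrange_bound[of l] by blast
  define C where "C = A * ((1 + real (Suc l) * K) * Cf)"
  have "\<bar>(f z2 x - f z1 x) / (z2 - z1) - interp l j c (\<lambda>x. (f z2 x - f z1 x) / (z2 - z1)) x\<bar>
      \<le> A * ((1 + real (Suc l) * K) * (Cf * (1 / 2^j) powr (real l + \<alpha>)))"
    if z: "z1 \<in> {a..b}" "z2 \<in> {a..b}" "z1 \<noteq> z2" and c: "c \<in> cells j" and x: "x \<in> cell j c" for z1 z2 j c x
  proof (rule A(2)[OF _ x], intro ballI allI)
    fix x s assume x: "x \<in> cell j c"
    then have x01: "x \<in> cbox 0 1" using cell_subset[OF c] by blast
    define u where "u r t = (ipd a b (map Some (replicate r s)) f z2 (upd x s t)
        - ipd a b (map Some (replicate r s)) f z1 (upd x s t)) / (z2 - z1)" for r t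
    have "\<bar>u 0 (x $ s) - (\<Sum>i\<le>l. u 0 ((real (c s) + tau l i) / 2^j) * poly (lagrange l i) (2^j * x $ s - real (c s)))\<bar>
      \<le> (1 + real (Suc l) * K) * (Cf * (1 / 2^j) powr (real l + \<alpha>))"
    proof (rule interp_error_1d[OF _ _ Cf \<alpha> K])
      show "(u r has_real_derivative u (Suc r) t) (at t within {0..1})" if "r < l" "t \<in> {0..1}" for r t
      proof -
        have "length (map Some (replicate r s)) < Suc l" using that by simp
        from DERIV_cdivide[OF DERIV_diff[OF C_diff_on_derivative_x[OF f this z(2) x01 that(2), of s]
            C_diff_on_derivative_x[OF f this z(1) x01 that(2), of s]], of "z2 - z1"]
        show ?thesis unfolding u_def by simp
      qed
      show "\<bar>u l t - u l t'\<bar> \<le> Cf * \<bar>t - t'\<bar> powr \<alpha>" if t: "t \<in> {0..1}" "t' \<in> {0..1}" for t t'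
      proof -
        define X X' where "X = upd x s t" and "X' = upd x s t'"
        have X: "X \<in> cbox 0 1" "X' \<in> cbox 0 1" using upd_cbox[OF x01] t by (auto simp: X_def X'_def)
        let ?ds = "map Some (replicate l s)"
        have len: "length ?ds < Suc l" by simp
        let ?w = "\<lambda>z. ipd a b ?ds f z X - ipd a b ?ds f z X'"
        have "norm (?w z2 - ?w z1) \<le> Cf * \<bar>t - t'\<bar> powr \<alpha> * norm (z2 - z1)"
        proof (rule field_differentiable_bound[of "{a..b}"])
          fix z assume z: "z \<in> {a..b}"
          show "(?w has_field_derivative (ipd a b (None # ?ds) f z X - ipd a b (None # ?ds) f z X')) (at z within {a..b})"
            using C_diff_on_derivative_z[OF f len z] X by (intro DERIV_diff)
          show "norm (ipd a b (None # ?ds) f z X - ipd a b (None # ?ds) f z X') \<le> Cf * \<bar>t - t'\<bar> powr \<alpha>"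
            using hoelder[OF _ z X, of "replicate l s"] by (simp add: X_def X'_def norm_upd_diff)
        qed (use z in auto)
        moreover have "u l t - u l t' = (?w z2 - ?w z1) / (z2 - z1)"
          unfolding u_def X_def[symmetric] X'_def[symmetric] by (simp flip: diff_divide_distrib)
        ultimately show ?thesis
          using z(3) by (simp add: pos_divide_le_eq)
      qed
      show "c s < 2^j" using c by (simp add: cells_def)
      show "real (c s) \<le> 2^j * x $ s" "2^j * x $ s \<le> real (c s) + 1" using x by (auto simp: mem_cell)
    qed auto
    then show "\<bar>(f z2 x - f z1 x) / (z2 - z1) - (\<Sum>i\<le>l. (f z2 (upd x s ((real (c s) + tau l i) / 2^j)) - f z1 (upd x s ((real (c s) + tau l i) / 2^j))) / (z2 - z1)
        * poly (lagrange l i) (2^j * x $ s - real (c s)))\<bar> \<le> (1 + real (Suc l) * K) * (Cf * (1 / 2^j) powr (real l + \<alpha>))"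
      by (simp add: u_def upd_simps)
  qed
  then have "\<bar>(f z2 x - f z1 x) / (z2 - z1) - interp l j c (\<lambda>x. (f z2 x - f z1 x) / (z2 - z1)) x\<bar>
      \<le> C * (1 / 2^j) powr (real l + \<alpha>)"
    if "z1 \<in> {a..b}" "z2 \<in> {a..b}" "z1 \<noteq> z2" "c \<in> cells j" "x \<in> cell j c" for z1 z2 j c x
    using that by (simp add: C_def mult.assoc)
  moreover have "C \<ge> 0" using A(1) K(1) Cf by (simp add: C_def)
  ultimately show ?thesis by blast
qed

text \<open>The interpolation error involves finitely many values of the function, at all of which
  the difference quotients converge, so the bound passes to the limit.\<close>

lemma derivative_approximable:
  fixes f :: "real \<Rightarrow> real^'n::finite \<Rightarrow> real"
  assumes ab: "a < b" and f: "C_diff_on (Suc l) a b f" and Cf: "0 \<le> Cf" and \<alpha>: "0 < \<alpha>"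
    and bound: "\<And>z x. z \<in> {a..b} \<Longrightarrow> x \<in> cbox 0 1 \<Longrightarrow> \<bar>ipd a b [None] f z x\<bar> \<le> Cf"
    and hoelder: "\<And>ss z x1 x2. length ss = l \<Longrightarrow> z \<in> {a..b} \<Longrightarrow> x1 \<in> cbox 0 1 \<Longrightarrow> x2 \<in> cbox 0 1 \<Longrightarrow>
           \<bar>ipd a b (None # map Some ss) f z x1 - ipd a b (None # map Some ss) f z x2\<bar>
             \<le> Cf * norm (x1 - x2) powr \<alpha>"
  shows "\<exists>C\<ge>0. \<forall>z\<in>{a..b}. approximable l ((1/2) powr (real l + \<alpha>)) C (ipd a b [None] f z)"
proof -
  obtain C where C: "C \<ge> 0" "\<And>z1 z2 j c x. z1 \<in> {a..b} \<Longrightarrow> z2 \<in> {a..b} \<Longrightarrow> z1 \<noteq> z2 \<Longrightarrow> c \<in> cells j \<Longrightarrow> x \<in> cell j c \<Longrightarrow>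
    \<bar>(f z2 x - f z1 x) / (z2 - z1) - interp l j c (\<lambda>x. (f z2 x - f z1 x) / (z2 - z1)) x\<bar>
      \<le> C * (1 / 2^j) powr (real l + \<alpha>)"
    using difference_quotient_interp_error[OF f Cf \<alpha> hoelder] by blast
  define \<beta> where "\<beta> = (1/2::real) powr (real l + \<alpha>)"
  have \<beta>j: "(1 / 2^j) powr (real l + \<alpha>) = \<beta>^j" for j
  proof -
    have "(1 / 2^j :: real) = (1/2) powr real j" by (simp add: powr_realpow power_one_over)
    then show ?thesis by (simp add: \<beta>_def powr_powr powr_power mult.commute)
  qed
  have err: "\<bar>ipd a b [None] f z x - interp l j c (ipd a b [None] f z) x\<bar> \<le> C * \<beta>^j"
    if z: "z \<in> {a..b}" and c: "c \<in> cells j" and x: "x \<in> cell j c" for z j c x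
  proof -
    let ?q = "\<lambda>t x. (f t x - f z x) / (t - z)"
    have lim: "((\<lambda>t. ?q t y) \<longlongrightarrow> ipd a b [None] f z y) (at z within {a..b})" if "y \<in> cbox 0 1" for y
      using C_diff_on_derivative_z[OF f _ z that, of "[]"] by (simp add: has_field_derivative_iff)
    have "((\<lambda>t. \<bar>?q t x - interp l j c (?q t) x\<bar>) \<longlongrightarrow> \<bar>ipd a b [None] f z x - interp l j c (ipd a b [None] f z) x\<bar>) (at z within {a..b})"
      unfolding interp_def
      using x cell_subset[OF c] node_cell[of _ l j c]
      by (intro tendsto_rabs tendsto_diff tendsto_sum tendsto_mult tendsto_const lim) blast+
    moreover have "eventually (\<lambda>t. \<bar>?q t x - interp l j c (?q t) x\<bar> \<le> C * \<beta>^j) (at z within {a..b})"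
      unfolding eventually_at_filter using C(2)[OF z _ _ c x] by (intro always_eventually) (auto simp: \<beta>j)
    \<comment> \<open>Here \<open>a < b\<close> enters: without nearby points of the interval the
      limit would be vacuous.\<close>
    moreover have "z islimpt {a..b}"
    proof (rule connected_imp_perfect)
      show "{a..b} \<noteq> {w}" for w using ab by (metis atLeastAtMost_singleton_iff less_irrefl)
    qed (use z in auto)
    then have "at z within {a..b} \<noteq> bot" by (simp add: trivial_limit_within)
    ultimately show ?thesis by (intro tendsto_upperbound)
  qed
  define C' where "C' = max C Cf"
  have "approximable l \<beta> C' (ipd a b [None] f z)" if z: "z \<in> {a..b}" for z
    unfolding approximable_def
  proof (intro conjI ballI allI)
    show "continuous_on (cbox 0 1) (ipd a b [None] f z)"
      using C_diff_on_continuous(2)[OF f _ z, of "[None]"] by simp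
    show "\<bar>ipd a b [None] f z x\<bar> \<le> C'" if "x \<in> cbox 0 1" for x
      using bound[OF z that] by (simp add: C'_def)
    show "\<bar>ipd a b [None] f z x - interp l j c (ipd a b [None] f z) x\<bar> \<le> C' * \<beta>^j"
      if "c \<in> cells j" "x \<in> cell j c" for j c x
    proof -
      have "C * \<beta>^j \<le> C' * \<beta>^j" by (intro mult_right_mono) (auto simp: C'_def \<beta>_def)
      then show ?thesis using err[OF z that] by linarith
    qed
  qed
  moreover have "C' \<ge> 0" using C(1) by (simp add: C'_def)
  ultimately show ?thesis unfolding \<beta>_def by blast
qed

text \<open>For degree 0 the interpolant is the value at the lower corner of the cell, and the
  tensor estimate asks only for a Lipschitz bound in each coordinate. This follows from the
  boundedness of the continuous first partial derivatives.\<close>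

lemma delta_C1_bound:
  fixes f :: "real \<Rightarrow> real^'n::finite \<Rightarrow> real"
  assumes f: "C_diff_on (Suc l) a b f" and z: "z \<in> {a..b}"
  shows "\<exists>E. \<forall>k. \<forall>c\<in>cells (Suc k). \<bar>delta k c (f z)\<bar> \<le> E / 2^k"
proof -
  have "\<exists>B. \<forall>x\<in>cbox 0 1. \<bar>ipd a b [Some s] f z x\<bar> \<le> B" for s
  proof -
    have "bounded (ipd a b [Some s] f z ` cbox 0 1)"
      using C_diff_on_continuous(2)[OF f _ z, of "[Some s]"]
      by (intro compact_imp_bounded compact_continuous_image) auto
    then show ?thesis by (auto simp: bounded_iff)
  qed
  then obtain Bs where Bs: "\<And>s x. x \<in> cbox 0 1 \<Longrightarrow> \<bar>ipd a b [Some s] f z x\<bar> \<le> Bs s" by metis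
  define B where "B = (\<Sum>s\<in>UNIV. \<bar>Bs s\<bar>)"
  have B: "\<bar>ipd a b [Some s] f z x\<bar> \<le> B" if "x \<in> cbox 0 1" for s x
  proof -
    have "\<bar>Bs s\<bar> \<le> B" unfolding B_def by (intro member_le_sum) auto
    then show ?thesis using Bs[OF that, of s] by linarith
  qed
  have lip: "\<bar>f z x - f z (upd x s t)\<bar> \<le> B * \<bar>x $ s - t\<bar>" if x: "x \<in> cbox 0 1" and t: "t \<in> {0..1}" for x s t
  proof -
    have "norm (f z (upd x s (x $ s)) - f z (upd x s t)) \<le> B * norm (x $ s - t)"
    proof (rule field_differentiable_bound[of "{0..1}" "\<lambda>t. f z (upd x s t)"])
      fix t :: real assume t: "t \<in> {0..1}"
      show "((\<lambda>t. f z (upd x s t)) has_field_derivative ipd a b [Some s] f z (upd x s t)) (at t within {0..1})"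
        using C_diff_on_derivative_x[OF f _ z x t, of "[]" s] by simp
      show "norm (ipd a b [Some s] f z (upd x s t)) \<le> B" using B[OF upd_cbox[OF x t]] by simp
    qed (use t x in \<open>auto simp: mem_box_cart\<close>)
    then show ?thesis by (simp add: upd_simps)
  qed
  obtain A where A: "A \<ge> 0" "\<And>j c (g :: real^'n \<Rightarrow> real) e x.
      (\<forall>x\<in>cell j c. \<forall>s. \<bar>g x - (\<Sum>i\<le>0. g (upd x s ((real (c s) + tau 0 i) / 2^j)) * poly (lagrange 0 i) (2^j * x $ s - real (c s)))\<bar> \<le> e)
      \<Longrightarrow> x \<in> cell j c \<Longrightarrow> \<bar>g x - interp 0 j c g x\<bar> \<le> A * e"
    using interp_error_tensor[where 'n = 'n, of 0] by blast
  have lag0: "poly (lagrange 0 0) y = 1" for y by (simp add: lagrange_def)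
  have "\<bar>delta k c (f z)\<bar> \<le> 2 * A * B / 2^k" if c: "c \<in> cells (Suc k)" for k c
  proof -
    define v where "v = (\<Sum>\<nu>\<in>nodes 0. f z (node 0 k (parent c) \<nu>))"
    have pc: "cell k (parent c) \<subseteq> cbox 0 1" by (rule cell_subset[OF parent_cells[OF c]])
    have const: "interp 0 k (parent c) (f z) x = v" for x
      unfolding interp_def v_def
    proof (rule sum.cong[OF refl])
      fix \<nu> :: "'n \<Rightarrow> nat" assume "\<nu> \<in> nodes 0"
      then have "\<nu> s = 0" for s by (auto simp: nodes_def PiE_iff)
      then show "f z (node 0 k (parent c) \<nu>) * basis 0 k (parent c) \<nu> x = f z (node 0 k (parent c) \<nu>)"
        by (simp add: basis_def lag0)
    qed
    have "\<bar>f z x - v\<bar> \<le> A * (B / 2^k)" if x: "x \<in> cell k (parent c)" for x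
      unfolding const[of x, symmetric]
    proof (rule A(2)[OF _ x], intro ballI allI)
      fix x s assume x: "x \<in> cell k (parent c)"
      have x': "real (parent c s) \<le> 2^k * x $ s" "2^k * x $ s \<le> real (parent c s) + 1" using x by (auto simp: mem_cell)
      have "parent c s \<le> 2^k" using parent_cells[OF c] by (simp add: cells_def less_imp_le)
      then have t: "real (parent c s) / 2^k \<in> {0..1}" by (auto simp: field_simps)
      have "2^k * \<bar>x $ s - real (parent c s) / 2^k\<bar> = \<bar>2^k * (x $ s - real (parent c s) / 2^k)\<bar>"
        by (simp add: abs_mult)
      also have "2^k * (x $ s - real (parent c s) / 2^k) = 2^k * x $ s - real (parent c s)"
        by (simp add: right_diff_distrib)
      also have "\<bar>\<dots>\<bar> \<le> 1" using x' by auto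
      finally have d: "\<bar>x $ s - real (parent c s) / 2^k\<bar> \<le> 1 / 2^k" by (simp add: field_simps)
      have "B \<ge> 0" by (simp add: B_def sum_nonneg)
      then have "B * \<bar>x $ s - real (parent c s) / 2^k\<bar> \<le> B * (1 / 2^k)" using d by (intro mult_left_mono)
      then have "\<bar>f z x - f z (upd x s (real (parent c s) / 2^k))\<bar> \<le> B / 2^k"
        using lip[OF _ t, of x s] x pc by force
      then show "\<bar>f z x - (\<Sum>i\<le>0. f z (upd x s ((real (parent c s) + tau 0 i) / 2^k)) * poly (lagrange 0 i) (2^k * x $ s - real (parent c s)))\<bar> \<le> B / 2^k"
        by (simp add: lag0 tau_def)
    qed
    moreover have "continuous_on (cell k (parent c)) (f z)"
      using C_diff_on_continuous(2)[OF f _ z, of "[]"] continuous_on_subset[OF _ pc] by simp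
    ultimately have "\<bar>delta k c (f z)\<bar> \<le> 2 * (A * (B / 2^k))" by (intro delta_bound)
    then show ?thesis by simp
  qed
  then show ?thesis by blast
qed

section \<open>Termwise differentiation of the series\<close>

lemma avg_derivative:
  fixes f :: "real \<Rightarrow> real^'n::finite \<Rightarrow> real"
  assumes f: "C_diff_on (Suc l) a b f" and z: "z \<in> {a..b}" and c: "c \<in> cells k"
  shows "((\<lambda>t. avg k c (f t)) has_real_derivative avg k c (ipd a b [None] f z)) (at z within {a..b})"
proof -
  have sub: "cell k c \<subseteq> cbox 0 1" by (rule cell_subset[OF c])
  have "((\<lambda>t. integral (cell k c) (f t)) has_real_derivative integral (cell k c) (ipd a b [None] f z)) (at z within {a..b})"
    unfolding cell_def
  proof (rule leibniz_rule_field_derivative[OF _ _ _ z])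
    fix t x assume t: "t \<in> {a..b}" and x: "x \<in> cbox (\<chi> s. real (c s) / 2^k) (\<chi> s. (real (c s) + 1) / 2^k)"
    then show "((\<lambda>t. f t x) has_field_derivative ipd a b [None] f t x) (at t within {a..b})"
      using C_diff_on_derivative_z[OF f _ t, of "[]" x] sub by (auto simp: cell_def)
  next
    fix t assume t: "t \<in> {a..b}"
    show "f t integrable_on cbox (\<chi> s. real (c s) / 2^k) (\<chi> s. (real (c s) + 1) / 2^k)"
      using C_diff_on_continuous(2)[OF f _ t, of "[]"] sub
      by (intro integrable_continuous) (auto simp: cell_def intro: continuous_on_subset)
  next
    show "continuous_on ({a..b} \<times> cbox (\<chi> s. real (c s) / 2^k) (\<chi> s. (real (c s) + 1) / 2^k)) (\<lambda>(t, x). ipd a b [None] f t x)"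
    proof (rule continuous_on_subset)
      show "continuous_on ({a..b} \<times> cbox 0 1) (\<lambda>(t, x). ipd a b [None] f t x)"
        by (rule C_diff_on_continuous(1)[OF f]) simp
      show "{a..b} \<times> cbox (\<chi> s. real (c s) / 2^k) (\<chi> s. (real (c s) + 1) / 2^k) \<subseteq> {a..b} \<times> cbox 0 1"
        using sub unfolding cell_def by (rule Sigma_mono[OF order_refl])
    qed
  qed simp
  then show ?thesis unfolding avg_def by (rule DERIV_cmult)
qed

context dyadic_content
begin

text \<open>Each term is a finite combination of cell means whose coefficients do not depend on t.
  The representation is available only for t in [a, b], hence the transfer of the derivative within
  that interval.\<close>

lemma haar_series_term_derivative:
  fixes f :: "real \<Rightarrow> real^'n \<Rightarrow> real"
  assumes f: "C_diff_on (Suc l) a b f" and z: "z \<in> {a..b}"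
  shows "((\<lambda>t. haar_series_term \<nu> (f t) k \<omega>) has_real_derivative haar_series_term \<nu> (ipd a b [None] f z) k \<omega>) (at z within {a..b})"
proof -
  have cont: "continuous_on (cbox 0 1) (f t)" "continuous_on (cbox 0 1) (ipd a b [None] f t)" if "t \<in> {a..b}" for t
    using C_diff_on_continuous(2)[OF f _ that, of "[]"] C_diff_on_continuous(2)[OF f _ that, of "[None]"] by simp_all
  show ?thesis
  proof (cases k)
    case 0
    have "((\<lambda>t. \<Sum>c\<in>cells 0. avg 0 c (f t) * ival (theta 0 c) \<omega>) has_real_derivative
        (\<Sum>c\<in>cells 0. avg 0 c (ipd a b [None] f z) * ival (theta 0 c) \<omega>)) (at z within {a..b})"
      by (intro DERIV_sum DERIV_cmult_right avg_derivative[OF f z])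
    then show ?thesis
      using has_field_derivative_transform_within[of "\<lambda>t. \<Sum>c\<in>cells 0. avg 0 c (f t) * ival (theta 0 c) \<omega>" _ z "{a..b}" 1]
        z cont by (simp add: 0 haar_series_term_0)
  next
    case (Suc m)
    have "((\<lambda>t. \<Sum>c\<in>cells (Suc m). delta m c (f t) * ival (theta (Suc m) c) \<omega>) has_real_derivative
        (\<Sum>c\<in>cells (Suc m). delta m c (ipd a b [None] f z) * ival (theta (Suc m) c) \<omega>)) (at z within {a..b})"
      unfolding delta_def by (intro DERIV_sum DERIV_cmult_right DERIV_diff avg_derivative[OF f z] parent_cells)
    then show ?thesis
      using has_field_derivative_transform_within[of "\<lambda>t. \<Sum>c\<in>cells (Suc m). delta m c (f t) * ival (theta (Suc m) c) \<omega>" _ z "{a..b}" 1]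
        z cont by (simp add: Suc haar_series_term_Suc)
  qed
qed

lemma first_term_bound:
  assumes "approximable l \<beta> C g"
  shows "\<bar>haar_series_term \<nu> g 0 \<omega>\<bar> \<le> (\<Sum>c\<in>cells 0. C * \<bar>ival (theta 0 c) \<omega>\<bar>)"
proof -
  have g: "continuous_on (cbox 0 1) g" "\<And>x. x \<in> cbox 0 1 \<Longrightarrow> \<bar>g x\<bar> \<le> C"
    using assms by (auto simp: approximable_def)
  show ?thesis
    unfolding haar_series_term_0[OF g(1)]
  proof (rule order_trans[OF sum_abs sum_mono])
    fix c :: "'n \<Rightarrow> nat" assume "c \<in> cells 0"
    then have "cell 0 c \<subseteq> cbox 0 1" by (rule cell_subset)
    then have "\<bar>avg 0 c g - 0\<bar> \<le> C" using g by (intro avg_bound continuous_on_subset[OF g(1)]) auto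
    then show "\<bar>avg 0 c g * ival (theta 0 c) \<omega>\<bar> \<le> C * \<bar>ival (theta 0 c) \<omega>\<bar>"
      by (simp add: abs_mult mult_right_mono)
  qed
qed

end

theorem theorem3:
  fixes M :: "'w measure"
    and mu :: "(real^'n::finite) set \<Rightarrow> 'w \<Rightarrow> real"
    and f :: "real \<Rightarrow> real^'n \<Rightarrow> real"
    and a b :: real and l :: nat and alpha Cf :: real
  assumes "prob_space M" and "complete_measure M"
    and "stoch_measure M (restrict_space borel (cbox 0 1)) mu"
    and "a < b" and "alpha > 0" and "Cf > 0"
    and "C_diff_on (Suc l) a b f"
    and "\<And>ss z x. length ss \<le> l \<Longrightarrow> z \<in> {a..b} \<Longrightarrow> x \<in> cbox 0 1 \<Longrightarrow>
           \<bar>ipd a b (None # map Some ss) f z x\<bar> \<le> Cf"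
    and "\<And>ss z x1 x2. length ss = l \<Longrightarrow> z \<in> {a..b} \<Longrightarrow> x1 \<in> cbox 0 1 \<Longrightarrow> x2 \<in> cbox 0 1 \<Longrightarrow>
           \<bar>ipd a b (None # map Some ss) f z x1 - ipd a b (None # map Some ss) f z x2\<bar>
             \<le> Cf * norm (x1 - x2) powr alpha"
    and "real l + alpha > real CARD('n) / 2"
  shows "AE \<omega> in M.
     (\<forall>z\<in>{a..b}. summable (\<lambda>k. haar_series_term mu (f z) k \<omega>)) \<and>
     (\<forall>z\<in>{a..b}. summable (\<lambda>k. haar_series_term mu (ipd a b [None] f z) k \<omega>)) \<and>
     (\<forall>z\<in>{a..b}. ((\<lambda>t. \<Sum>k. haar_series_term mu (f t) k \<omega>) has_real_derivative
         (\<Sum>k. haar_series_term mu (ipd a b [None] f z) k \<omega>)) (at z within {a..b})) \<and>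
     bounded ((\<lambda>z. \<Sum>k. haar_series_term mu (ipd a b [None] f z) k \<omega>) ` {a..b})"
proof -
  note f = assms(7)
  define g where "g = ipd a b [None] f"
  \<comment> \<open>The cap 1 yields \<open>y \<ge> 1/2\<close>, and the surplus over d/2 yields the
    inequality \<open>\<beta>y\<close>.\<close>
  define \<sigma> where "\<sigma> = min 1 (real l + alpha - real CARD('n) / 2)"
  define \<beta> where "\<beta> = (1/2::real) powr (real l + alpha)"
  define y where "y = (1/2::real) powr \<sigma>"
  define x where "x = sqrt y"
  have \<sigma>: "0 < \<sigma>" "\<sigma> \<le> 1" "\<sigma> \<le> real l + alpha - real CARD('n) / 2" using assms(10) by (auto simp: \<sigma>_def)
  have \<beta>: "0 < \<beta>" "\<beta> \<le> 1" using assms(5) by (auto simp: \<beta>_def intro: powr_le1)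
  have y: "1/2 \<le> y" "y < 1"
  proof -
    have "(1/2::real) powr 1 \<le> (1/2) powr \<sigma>" using \<sigma> by (intro powr_mono') auto
    then show "1/2 \<le> y" by (simp add: y_def)
    have "(1/2::real) powr \<sigma> < (1/2) powr 0" using \<sigma> by (intro powr_less_mono') auto
    then show "y < 1" by (simp add: y_def)
  qed
  have \<beta>y: "2 ^ CARD('n) * \<beta>\<^sup>2 \<le> y\<^sup>2"
  proof -
    have "(2::real) ^ CARD('n) = (1/2) powr (- real CARD('n))"
      by (simp add: powr_minus powr_realpow power_one_over)
    moreover have "\<beta>\<^sup>2 = (1/2) powr (2 * (real l + alpha))" "y\<^sup>2 = (1/2) powr (2 * \<sigma>)"
      by (simp_all add: \<beta>_def y_def powr_power mult.commute)
    ultimately have "2 ^ CARD('n) * \<beta>\<^sup>2 = (1/2) powr (2 * (real l + alpha) - real CARD('n))"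
      by (simp flip: powr_add)
    also have "\<dots> \<le> (1/2) powr (2 * \<sigma>)" using \<sigma> by (intro powr_mono') auto
    finally show ?thesis using \<open>y\<^sup>2 = _\<close> by simp
  qed
  have x: "0 < x" "x < 1" "1 < 2 * x"
  proof -
    show "0 < x" "x < 1" using y by (auto simp: x_def)
    have "1/2 = sqrt (1/4)" by (simp add: real_sqrt_divide)
    also have "\<dots> < x" unfolding x_def using y by (intro real_sqrt_less_mono) auto
    finally show "1 < 2 * x" by simp
  qed
  have bound: "\<bar>ipd a b [None] f z u\<bar> \<le> Cf" if "z \<in> {a..b}" "u \<in> cbox 0 1" for z u
    using assms(8)[of "[]" z u] that by simp
  obtain C where C: "C \<ge> 0" "\<And>z. z \<in> {a..b} \<Longrightarrow> approximable l \<beta> C (g z)"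
    using derivative_approximable[OF assms(4) f less_imp_le[OF assms(6)] assms(5) bound assms(9)]
    unfolding \<beta>_def g_def by blast
  obtain \<nu> where \<nu>: "random_content M (cbox 0 1) dyadic_sets \<nu>" "AE \<omega> in M. \<forall>A\<in>dyadic_sets. \<nu> A \<omega> = mu A \<omega>"
    using stoch_measure_content[OF assms(1,3)] by blast
  interpret dyadic_content M \<nu> by (rule dyadic_content.intro[OF \<nu>(1)])
  have az: "a \<in> {a..b}" using assms(4) by simp
  have cont: "continuous_on (cbox 0 1) (f t)" "continuous_on (cbox 0 1) (g t)" if "t \<in> {a..b}" for t
    using C_diff_on_continuous(2)[OF f _ that, of "[]"] C_diff_on_continuous(2)[OF f _ that, of "[None]"]
    by (simp_all add: g_def)
  obtain E where E: "\<And>k c. c \<in> cells (Suc k) \<Longrightarrow> \<bar>delta k c (f a)\<bar> \<le> E / 2^k"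
    using delta_C1_bound[OF f az] by blast
  have fa: "AE \<omega> in M. \<exists>B. \<forall>k. (x^k * 2^k * haar_series_term \<nu> (f a) (Suc k) \<omega>)\<^sup>2 \<le> B"
    by (rule lipschitz_term_AE_bounded[OF x(1,2) cont(1)[OF az]]) (rule E)
  show ?thesis
    using \<nu>(2) cell_masses_AE_bounded[OF x(1,2)] basis_masses_AE_bounded[OF x(1,2), of l] fa
  proof eventually_elim
    case (elim \<omega>)
    let ?t = "\<lambda>z k. haar_series_term \<nu> (f z) k \<omega>" and ?t' = "\<lambda>z k. haar_series_term \<nu> (g z) k \<omega>"
    have eq: "haar_series_term mu (f z) k \<omega> = ?t z k" "haar_series_term mu (g z) k \<omega> = ?t' z k"
      if "z \<in> {a..b}" for z k
      by (rule haar_series_term_content[OF cont(1)[OF that]], rule elim(1))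
        (rule haar_series_term_content[OF cont(2)[OF that]], rule elim(1))
    obtain B where B: "\<And>k. (\<Sum>c\<in>cells k. (x^k * ival (theta k c) \<omega>)\<^sup>2) \<le> B" using elim(2) by blast
    obtain B' where B': "\<forall>k. (\<Sum>(j, Q, \<nu>)\<in>Sigma {..k} (\<lambda>j. cells j \<times> nodes l).
      (x^k * 2^(k - j) * (\<Sum>c\<in>{c\<in>cells (Suc k). ancestor (Suc k) j c = Q}.
        delta k c (basis l j Q \<nu>) * ival (theta (Suc k) c) \<omega>))\<^sup>2) \<le> B'" using elim(3) ..
    obtain R where R: "R \<ge> 0" "\<And>h k. approximable l \<beta> C h \<Longrightarrow>
        \<bar>haar_series_term \<nu> h (Suc k) \<omega>\<bar> \<le> R * (real (Suc k) * x^k)"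
      using approximable_term_bound[OF \<beta> \<beta>y y x_def C(1) B spec[OF B']] by blast
    \<comment> \<open>A majorant independent of z. It gives uniform convergence of the
      differentiated series and the bound on its sum.\<close>
    define m where "m k = (case k of 0 \<Rightarrow> (\<Sum>c\<in>cells 0. C * \<bar>ival (theta 0 c) \<omega>\<bar>) | Suc i \<Rightarrow> R * (real (Suc i) * x^i))" for k
    have m: "norm (?t' z k) \<le> m k" if "z \<in> {a..b}" for z k
      using first_term_bound[OF C(2)[OF that]] R(2)[OF C(2)[OF that]] by (auto simp: m_def split: nat.split)
    have "summable (\<lambda>k. real (Suc k) * x^k)"
      using geometric_deriv_sums[of x] x by (auto simp: sums_iff)
    then have "summable (\<lambda>k. m (Suc k))" unfolding m_def nat.case by (rule summable_mult)
    then have sm: "summable m" by (simp only: summable_Suc_iff)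
    have s': "summable (?t' z)" if "z \<in> {a..b}" for z
      by (rule summable_comparison_test'[OF sm, of 0]) (rule m[OF that])
    \<comment> \<open>Termwise differentiation requires convergence of the original series at one
      point only. At \<open>a\<close> the terms decay with ratio 1 / (2 x), which is below 1 because
      x exceeds 1/2.\<close>
    have sa: "summable (?t a)"
    proof -
      obtain B where B: "\<And>k. (x^k * 2^k * ?t a (Suc k))\<^sup>2 \<le> B" using elim(4) by blast
      have "0 \<le> B" by (rule order_trans[OF zero_le_power2 B[of 0]])
      have bnd: "\<bar>?t a (Suc k)\<bar> \<le> sqrt B * (1 / (2 * x))^k" for k
      proof -
        have "(x^k * 2^k * ?t a (Suc k))\<^sup>2 \<le> (sqrt B)\<^sup>2" using B[of k] \<open>0 \<le> B\<close> by simp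
        then have "\<bar>x^k * 2^k * ?t a (Suc k)\<bar> \<le> sqrt B" using \<open>0 \<le> B\<close> by (intro abs_le_if_square_le) auto
        moreover have "\<bar>x^k * 2^k * ?t a (Suc k)\<bar> = (2 * x)^k * \<bar>?t a (Suc k)\<bar>"
          using x(1) by (simp add: abs_mult power_mult_distrib)
        ultimately have "\<bar>?t a (Suc k)\<bar> \<le> sqrt B / (2 * x)^k"
          using x(1) by (simp add: pos_le_divide_eq mult.commute)
        then show ?thesis by (simp add: power_one_over)
      qed
      have sg: "summable (\<lambda>k. sqrt B * (1 / (2 * x))^k)"
        using x by (intro summable_mult summable_geometric) simp
      have "summable (\<lambda>k. ?t a (Suc k))"
        by (rule summable_comparison_test'[OF sg, of 0]) (simp only: real_norm_def bnd)
      then show ?thesis by (rule summable_Suc_iff[THEN iffD1])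
    qed
    define T T' where "T k z = ?t z k" and "T' k z = ?t' z k" for k z
    have dT: "(T k has_field_derivative T' k z) (at z within {a..b})" if "z \<in> {a..b}" for k z
      unfolding T_def T'_def g_def by (rule haar_series_term_derivative[OF f that])
    have uT: "uniform_limit {a..b} (\<lambda>n z. \<Sum>k<n. T' k z) (\<lambda>z. \<Sum>k. T' k z) sequentially"
      by (rule Weierstrass_m_test[OF _ sm]) (simp only: T'_def m)
    have sT: "summable (\<lambda>k. T k a)" unfolding T_def by (rule sa)
    have "\<exists>F. \<forall>z\<in>{a..b}. (\<lambda>k. T k z) sums F z \<and> (F has_field_derivative (\<Sum>k. T' k z)) (at z within {a..b})"
      by (rule has_field_derivative_series[OF _ dT uT az sT]) simp_all
    then obtain F where F: "\<And>z. z \<in> {a..b} \<Longrightarrow> ?t z sums F z"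
      "\<And>z. z \<in> {a..b} \<Longrightarrow> (F has_field_derivative (\<Sum>k. ?t' z k)) (at z within {a..b})"
      unfolding T_def T'_def by blast
    have "((\<lambda>t. \<Sum>k. haar_series_term mu (f t) k \<omega>) has_real_derivative
        (\<Sum>k. haar_series_term mu (g z) k \<omega>)) (at z within {a..b})" if z: "z \<in> {a..b}" for z
      unfolding eq(2)[OF z]
    proof (rule has_field_derivative_transform_within[OF F(2)[OF z] zero_less_one z])
      show "F t = (\<Sum>k. haar_series_term mu (f t) k \<omega>)" if "t \<in> {a..b}" for t
        unfolding eq(1)[OF that] using F(1)[OF that] by (simp add: sums_iff)
    qed
    moreover have "bounded ((\<lambda>z. \<Sum>k. haar_series_term mu (g z) k \<omega>) ` {a..b})"
      unfolding bounded_iff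
    proof (intro exI ballI)
      fix w assume "w \<in> (\<lambda>z. \<Sum>k. haar_series_term mu (g z) k \<omega>) ` {a..b}"
      then obtain z where z: "z \<in> {a..b}" "w = (\<Sum>k. ?t' z k)" using eq(2) by auto
      have "summable (\<lambda>k. norm (?t' z k))"
        by (rule summable_comparison_test'[OF sm, of 0]) (simp add: m[OF z(1), unfolded real_norm_def])
      then have "norm (\<Sum>k. ?t' z k) \<le> (\<Sum>k. norm (?t' z k))" by (rule summable_norm)
      also have "\<dots> \<le> (\<Sum>k. m k)" using m[OF z(1)] sm \<open>summable (\<lambda>k. norm (?t' z k))\<close> by (intro suminf_le)
      finally show "norm w \<le> (\<Sum>k. m k)" using z(2) by simp
    qed
    moreover have "summable (\<lambda>k. haar_series_term mu (f z) k \<omega>)" "summable (\<lambda>k. haar_series_term mu (g z) k \<omega>)"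
      if "z \<in> {a..b}" for z
      using s'[OF that] F(1)[OF that] by (auto simp: eq[OF that] sums_iff)
    ultimately show ?case by (simp only: g_def) blast
  qed
qed

end
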